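(* Let $(I,\cdot)$ be a super Cartan datum with a root datum $(Y,X,\langle\,,\rangle)$. Let $M\in\mathcal O$ and let $\Omega:M\to M$ be the operator defined in the context. (a) Assume that there is a coset $C$ of $\mathbb Z[I]$ in $X$ such that $M=M_C:=\bigoplus_{\lambda\in C}M^\lambda$. Let $G:C\to\mathbb Z$ be a function with $G(\lambda)-G(\lambda-i')=\frac{i\cdot i}{2}\langle i,\lambda\rangle$ for all $\lambda\in C$, $i\in I$. Define the linear map $\Xi:M\to M$ by $\Xi(m)=(\pi q^2)^{G(\lambda)}m$ for all $\lambda\in C$ and $m\in M^\lambda$. Then $\Omega\Xi$ is a locally finite $\mathbf U$-module homomorphism. (b) Assume that $M$ is a quotient of the Verma module $M(\lambda')$, $\lambda'\in X$ (with $C$ the coset of $\lambda'$ and $G,\Xi$ as in (a)). Then $\Omega\Xi$ acts as $(\pi q^2)^{G(\lambda')}$ on $M$. (c) For $M$ as in (a), the eigenvalues of $\Omega\Xi$ are of the form $(\pi q^2)^c$ for $c\in\mathbb Z$.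
   Context: A super Cartan datum is a finite set $I=I_{\bar 0}\sqcup I_{\bar 1}$ with $I_{\bar 1}\ne\emptyset$ and a symmetric $\mathbb Z$-valued bilinear form on $\mathbb Z[I]$ such that $d_i=\frac{i\cdot i}{2}\in\mathbb Z_{>0}$; $2\frac{i\cdot j}{i\cdot i}\in-\mathbb N$ for $i\ne j$; and $2\frac{i\cdot j}{i\cdot i}\in 2\mathbb Z$ for $i\in I_{\bar 1}$, $j\in I$. The parity $p:\mathbb Z[I]\to\mathbb Z$ is the homomorphism with $p(i)=0$ on $I_{\bar 0}$, $p(i)=1$ on $I_{\bar 1}$. A root datum consists of finitely generated free abelian groups $Y,X$, a perfect pairing $\langle\,,\rangle:Y\times X\to\mathbb Z$, and embeddings $I\subset X$ ($i\mapsto i'$), $I\subset Y$ ($i\mapsto i$) with linearly independent images and $\langle i,j'\rangle=\frac{2i\cdot j}{i\cdot i}$. $\mathbb Z[I]$ is regarded as a subgroup of $X$ via $i\mapsto i'$. $\mathbb Q(q)^\pi=\mathbb Q(q)[\pi]/(\pi^2-1)$; $q_i=q^{d_i}$, $\pi_i=\pi^{p(i)}$. For $\nu=\sum\nu_ii\in\mathbb N[I]$: $q_\nu=\prod q_i^{\nu_i}$, $\pi_\nu=\prod\pi_i^{\nu_i}$, $\mathrm{ht}\,\nu=\sum\nu_i$. ${}'\mathbf f$ is the free associative unital $\mathbb Q(q)^\pi$-superalgebra on $\theta_i$ $(i\in I)$, with weight grading $|\theta_i|=i$ and parity $p(x)=p(|x|)$. ${}'\mathbf f\otimes{}'\mathbf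 f$ has multiplication $(x_1\otimes x_2)(x_1'\otimes x_2')=q^{|x_2|\cdot|x_1'|}\pi^{p(x_2)p(x_1')}x_1x_1'\otimes x_2x_2'$, and $r$ is the algebra homomorphism with $r(\theta_i)=\theta_i\otimes1+1\otimes\theta_i$. $(\cdot,\cdot)$ is the unique $\mathbb Q(q)^\pi$-valued bilinear form on ${}'\mathbf f$ with $(1,1)=1$, $(\theta_i,\theta_j)=\delta_{ij}(1-\pi_iq_i^{-2})^{-1}$, $(x,y'y'')=(r(x),y'\otimes y'')$, $(xx',y'')=(x\otimes x',r(y''))$, where $(x_1\otimes x_2,x_1'\otimes x_2')=(x_1,x_1')(x_2,x_2')$. $\mathcal I$ is its radical, $\mathbf f={}'\mathbf f/\mathcal I$, and $\mathbf f_\nu$ is the image of the weight-$\nu$ part ${}'\mathbf f_\nu$. $\mathbf U$ is the unital associative $\mathbb Q(q)^\pi$-superalgebra with generators $E_i,F_i$ $(i\in I)$ of parity $p(i)$ and even generators $J_\mu,K_\mu$ $(\mu\in Y)$, and relations: $K_0=1$, $K_\mu K_{\mu'}=K_{\mu+\mu'}$; $J_{2\mu}=1$, $J_\mu J_{\mu'}=J_{\mu+\mu'}$; $J_\mu K_{\mu'}=K_{\mu'}J_\mu$; $K_\mu E_i=q^{\langle\mu,i'\rangle}E_iK_\mu$, $J_\mu E_i=\pi^{\langle\mu,i'\rangle}E_iJ_\mu$; $K_\mu F_i=q^{-\langle\mu,i'\rangle}F_iK_\mu$, $J_\mu F_i=\pi^{-\langle\mu,i'\rangle}F_iJ_\mu$;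 $E_iF_j-\pi^{p(i)p(j)}F_jE_i=\delta_{ij}\frac{\widetilde J_i\widetilde K_i-\widetilde K_{-i}}{\pi_iq_i-q_i^{-1}}$ with $\widetilde K_{\pm i}=K_{\pm d_ii}$, $\widetilde J_{\pm i}=J_{\pm d_ii}$; and $f(E_i:i\in I)=f(F_i:i\in I)=0$ for every $f(\theta_i:i\in I)\in\mathcal I$. $x\mapsto x^\pm$ are the algebra homomorphisms $\mathbf f\to\mathbf U$ with $\theta_i^+=E_i$, $\theta_i^-=F_i$. The antipode $S:\mathbf U\to\mathbf U$ is the $\mathbb Q(q)^\pi$-linear map with $S(E_i)=-\widetilde J_{-i}\widetilde K_{-i}E_i$, $S(F_i)=-F_i\widetilde K_i$, $S(K_\mu)=K_{-\mu}$, $S(J_\mu)=J_{-\mu}$, $S(xy)=\pi^{p(x)p(y)}S(y)S(x)$. Category $\mathcal C$: $\mathbb Z_2$-graded $\mathbf U$-modules $M=M_{\bar0}\oplus M_{\bar1}$ (compatible with the grading of $\mathbf U$) with $M=\bigoplus_{\lambda\in X}M^\lambda$, $M^\lambda=\{m\mid K_\mu m=q^{\langle\mu,\lambda\rangle}m,\ J_\mu m=\pi^{\langle\mu,\lambda\rangle}m\ \forall\mu\in Y\}$, each $M^\lambda$ being $\mathbb Z_2$-graded. $\mathcal O$ is the full subcategory of those $M$ such that for each $m\in M$ there is $n\ge0$ with $x^+m=0$ for all $x\in\mathbf f_\nu$ with $\mathrm{ht}\,\nu\ge n$. The Verma module $M(\lambda)$ is $\mathbf f$ with the unique $\mathbf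 U$-module structure such that $K_\mu y=q^{\langle\mu,\lambda-|y|\rangle}y$, $J_\mu y=\pi^{\langle\mu,\lambda-|y|\rangle}y$, $F_iy=\theta_iy$, $E_i1=0$. Let $B$ be a $\mathbb Q(q)^\pi$-basis of $\mathbf f$ with $B_\nu=B\cap\mathbf f_\nu$ a basis of $\mathbf f_\nu$ for each $\nu$, and $\{b^*\}_{b\in B_\nu}$ the basis of $\mathbf f_\nu$ dual to $B_\nu$ under $(\cdot,\cdot)$. For $M\in\mathcal O$, $\Omega:M\to M$ is $$\Omega(m)=\sum_{b\in B}(-1)^{\mathrm{ht}|b|}\pi_{|b|}q_{|b|}\,S(b^-)b^{*+}m,$$ a sum with finitely many nonzero terms for each $m$. Locally finite means that every vector lies in a finite-dimensional $\mathbb Q(q)$-subspace stable under the operator.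
   Formalization: Ω carries an extra factor π^{binom(p(|b|),2)} in each term; without it (a),(b) fail (one odd i, i·i=2, ⟨i,λ⟩=2, on F²v at π=−1). In (c) the eigenvalue a is in Q(q), or in Q(q)^π with πm=±m, and the claim is am=(πq²)^c m, as a is not determined by m otherwise. *)

theory Defs
  imports "HOL-Library.Poly_Mapping" "HOL-Computational_Algebra.Computational_Algebra"
begin

section \<open>The ground ring\<close>

text \<open>The field of rational functions in \<open>q\<close> is \<^typ>\<open>rat poly fract\<close>.  The element
  \<open>Qpi a b\<close> stands for \<open>a + b \<pi>\<close>, where \<open>\<pi>\<^sup>2 = 1\<close>.\<close>

type_synonym Qq = "rat poly fract"

datatype qpi = Qpi (coeff_one: Qq) (coeff_pi: Qq)

instantiation qpi :: comm_ring_1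
begin

definition "0 = Qpi 0 0"
definition "1 = Qpi 1 0"
definition "x + y = Qpi (coeff_one x + coeff_one y) (coeff_pi x + coeff_pi y)"
definition "x - y = Qpi (coeff_one x - coeff_one y) (coeff_pi x - coeff_pi y)"
definition "- x = Qpi (- coeff_one x) (- coeff_pi x)"
definition "x * y = Qpi (coeff_one x * coeff_one y + coeff_pi x * coeff_pi y)
                        (coeff_one x * coeff_pi y + coeff_pi x * coeff_one y)"

instance
  by standard
    (auto simp: zero_qpi_def one_qpi_def plus_qpi_def minus_qpi_def uminus_qpi_def times_qpi_def
      algebra_simps)

end

text \<open>The ring is not a field.  The function \<open>inverse\<close> below returns the inverse of every unit
  (and is only applied to units): \<open>(a + b \<pi>) (a - b \<pi>) = a\<^sup>2 - b\<^sup>2\<close>, and \<open>a + b \<pi>\<close> is a unit iff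
  \<open>a\<^sup>2 \<noteq> b\<^sup>2\<close>.  It makes the integer powers \<open>x powi n\<close> available.\<close>

instantiation qpi :: inverse
begin

definition "inverse x =
  Qpi (coeff_one x / (coeff_one x ^ 2 - coeff_pi x ^ 2))
      (- coeff_pi x / (coeff_one x ^ 2 - coeff_pi x ^ 2))"
definition "x div y = x * inverse (y :: qpi)"

instance ..

end

lemma qpi_mult_inverse:
  fixes x :: qpi
  assumes "coeff_one x ^ 2 \<noteq> coeff_pi x ^ 2"
  shows "x * inverse x = 1"
proof -
  have "coeff_one x * coeff_one x - coeff_pi x * coeff_pi x \<noteq> 0"
    using assms by (simp add: power2_eq_square)
  then show ?thesis
    by (simp add: times_qpi_def inverse_qpi_def one_qpi_def power2_eq_square
        flip: diff_divide_distrib)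
qed

definition of_Qq :: "Qq \<Rightarrow> qpi" where
  "of_Qq a = Qpi a 0"

definition qq :: qpi where
  "qq = of_Qq (Fract [:0, 1:] 1)"

definition \<pi> :: qpi where
  "\<pi> = Qpi 0 1"


section \<open>Generalities\<close>

text \<open>Under this instance the convolution product on \<open>'g list \<Rightarrow>\<^sub>0 qpi\<close> makes that type the free
  associative unital algebra on \<open>'g\<close>.\<close>

instantiation list :: (type) monoid_add
begin

definition "0 = []"
definition "xs + ys = xs @ ys"

instance
  by standard (auto simp: zero_list_def plus_list_def)

end

type_synonym 'g free_alg = "'g list \<Rightarrow>\<^sub>0 qpi"

definition monom_word :: "'g list \<Rightarrow> 'g free_alg" where
  "monom_word w = Poly_Mapping.single w 1"

definition var :: "'g \<Rightarrow> 'g free_alg" where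
  "var g = monom_word [g]"

definition scal :: "qpi \<Rightarrow> 'g free_alg" where
  "scal c = Poly_Mapping.single [] c"

text \<open>The substitution homomorphism sending each generator \<open>a\<close> to the generator \<open>g a\<close>.\<close>

definition rename :: "('a \<Rightarrow> 'b) \<Rightarrow> 'a free_alg \<Rightarrow> 'b free_alg" where
  "rename g x = (\<Sum>w\<in>Poly_Mapping.keys x. Poly_Mapping.single (map g w) (Poly_Mapping.lookup x w))"

definition is_additive :: "('a::ab_group_add \<Rightarrow> 'b::ab_group_add) \<Rightarrow> bool" where
  "is_additive h \<longleftrightarrow> (\<forall>x y. h (x + y) = h x + h y)"

definition is_ring_hom :: "('a::ring_1 \<Rightarrow> 'b::ring_1) \<Rightarrow> bool" where
  "is_ring_hom h \<longleftrightarrow> is_additive h \<and> h 1 = 1 \<and> (\<forall>x y. h (x * y) = h x * h y)"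

definition two_sided_ideal :: "'a::ring_1 set \<Rightarrow> bool" where
  "two_sided_ideal A \<longleftrightarrow>
     0 \<in> A \<and> (\<forall>x\<in>A. \<forall>y\<in>A. x + y \<in> A) \<and> (\<forall>a\<in>A. \<forall>x y. x * a * y \<in> A)"

text \<open>\<open>quotient_map p A\<close> says that \<open>p\<close> exhibits the type \<open>'b\<close> as the quotient ring of \<open>'a\<close> by \<open>A\<close>.
  The algebras below depend on parameters, so they cannot be introduced as type constructors.\<close>

definition quotient_map :: "('a::ring_1 \<Rightarrow> 'b::ring_1) \<Rightarrow> 'a set \<Rightarrow> bool" where
  "quotient_map p A \<longleftrightarrow> is_ring_hom p \<and> surj p \<and> {x. p x = 0} = A"

definition int_mult :: "int \<Rightarrow> 'a::ab_group_add \<Rightarrow> 'a" where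
  "int_mult n x = (\<Sum>k<nat n. x) - (\<Sum>k<nat (- n). x)"

definition fg_free_abelian :: "'a::ab_group_add itself \<Rightarrow> bool" where
  "fg_free_abelian _ \<longleftrightarrow>
     (\<exists>B::'a set. finite B \<and> \<not> module.dependent int_mult B \<and> module.span int_mult B = UNIV)"

definition direct_sum_on :: "'l set \<Rightarrow> ('l \<Rightarrow> 'm::ab_group_add set) \<Rightarrow> bool" where
  "direct_sum_on C A \<longleftrightarrow>
     (\<forall>m. \<exists>!f. (\<forall>l\<in>C. f l \<in> A l) \<and> (\<forall>l. l \<notin> C \<longrightarrow> f l = 0) \<and>
               finite {l. f l \<noteq> 0} \<and> m = (\<Sum>l | f l \<noteq> 0. f l))"


section \<open>Super Cartan data and root data\<close>

text \<open>The index set \<open>I\<close> is the finite type \<open>'i\<close>.  Elements of \<open>\<nat>[I]\<close> are functions \<open>'i \<Rightarrow> nat\<close>.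
  The form on \<open>\<int>[I]\<close> is given by its values \<open>dot D i j\<close>; \<open>xmap D i\<close> is \<open>i'\<close> and \<open>ymap D i\<close> is the
  image of \<open>i\<close> in \<open>Y\<close>.\<close>

record ('i, 'y, 'x) root_data =
  odd_part :: "'i set"
  dot :: "'i \<Rightarrow> 'i \<Rightarrow> int"
  pairing :: "'y \<Rightarrow> 'x \<Rightarrow> int"
  ymap :: "'i \<Rightarrow> 'y"
  xmap :: "'i \<Rightarrow> 'x"

definition super_cartan_datum :: "('i::finite, 'y, 'x) root_data \<Rightarrow> bool" where
  "super_cartan_datum D \<longleftrightarrow>
     odd_part D \<noteq> {} \<and>
     (\<forall>i j. dot D i j = dot D j i) \<and>
     (\<forall>i. even (dot D i i) \<and> dot D i i > 0) \<and>
     (\<forall>i j. i \<noteq> j \<longrightarrow> dot D i i dvd 2 * dot D i j \<and> 2 * dot D i j div dot D i i \<le> 0) \<and>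
     (\<forall>i\<in>odd_part D. \<forall>j. even (2 * dot D i j div dot D i i))"

definition root_datum ::
  "('i::finite, 'y::ab_group_add, 'x::ab_group_add) root_data \<Rightarrow> bool" where
  "root_datum D \<longleftrightarrow>
     super_cartan_datum D \<and>
     fg_free_abelian TYPE('y) \<and> fg_free_abelian TYPE('x) \<and>
     (\<forall>x. is_additive (\<lambda>y. pairing D y x)) \<and> (\<forall>y. is_additive (\<lambda>x. pairing D y x)) \<and>
     (\<forall>g. is_additive g \<longrightarrow> (\<exists>!y. \<forall>x. pairing D y x = g x)) \<and>
     (\<forall>g. is_additive g \<longrightarrow> (\<exists>!x. \<forall>y. pairing D y x = g y)) \<and>
     (\<forall>c. (\<Sum>i\<in>UNIV. int_mult (c i) (xmap D i)) = 0 \<longrightarrow> (\<forall>i. c i = 0)) \<and>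
     (\<forall>c. (\<Sum>i\<in>UNIV. int_mult (c i) (ymap D i)) = 0 \<longrightarrow> (\<forall>i. c i = 0)) \<and>
     (\<forall>i j. pairing D (ymap D i) (xmap D j) = 2 * dot D i j div dot D i i)"

definition dd :: "('i, 'y, 'x) root_data \<Rightarrow> 'i \<Rightarrow> int" where
  "dd D i = dot D i i div 2"

definition dot_ext :: "('i::finite, 'y, 'x) root_data \<Rightarrow> ('i \<Rightarrow> nat) \<Rightarrow> ('i \<Rightarrow> nat) \<Rightarrow> int" where
  "dot_ext D \<nu> \<mu> = (\<Sum>i\<in>UNIV. \<Sum>j\<in>UNIV. int (\<nu> i) * int (\<mu> j) * dot D i j)"

definition par :: "('i::finite, 'y, 'x) root_data \<Rightarrow> ('i \<Rightarrow> nat) \<Rightarrow> nat" where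
  "par D \<nu> = (\<Sum>i\<in>odd_part D. \<nu> i)"

definition ht :: "('i::finite \<Rightarrow> nat) \<Rightarrow> nat" where
  "ht \<nu> = (\<Sum>i\<in>UNIV. \<nu> i)"

definition q_of :: "('i, 'y, 'x) root_data \<Rightarrow> 'i \<Rightarrow> qpi" where
  "q_of D i = qq powi dd D i"

definition pi_of :: "('i, 'y, 'x) root_data \<Rightarrow> 'i \<Rightarrow> qpi" where
  "pi_of D i = (if i \<in> odd_part D then \<pi> else 1)"

definition q_wt :: "('i::finite, 'y, 'x) root_data \<Rightarrow> ('i \<Rightarrow> nat) \<Rightarrow> qpi" where
  "q_wt D \<nu> = (\<Prod>i\<in>UNIV. q_of D i ^ \<nu> i)"

definition pi_wt :: "('i::finite, 'y, 'x) root_data \<Rightarrow> ('i \<Rightarrow> nat) \<Rightarrow> qpi" where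
  "pi_wt D \<nu> = (\<Prod>i\<in>UNIV. pi_of D i ^ \<nu> i)"

text \<open>\<open>xwt D \<nu>\<close> is the image of \<open>\<nu>\<close> in \<open>X\<close>, and \<open>root_coset D \<lambda>\<close> is \<open>\<lambda> + \<int>[I]\<close>.\<close>

definition xwt ::
  "('i::finite, 'y, 'x::ab_group_add) root_data \<Rightarrow> ('i \<Rightarrow> nat) \<Rightarrow> 'x" where
  "xwt D \<nu> = (\<Sum>i\<in>UNIV. int_mult (int (\<nu> i)) (xmap D i))"

definition root_coset ::
  "('i::finite, 'y, 'x::ab_group_add) root_data \<Rightarrow> 'x \<Rightarrow> 'x set" where
  "root_coset D lam = {lam + (\<Sum>i\<in>UNIV. int_mult (n i) (xmap D i)) | n. True}"


section \<open>The bilinear form on the free algebra\<close>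

text \<open>The weight of a word \<open>w\<close> is \<open>count_list w\<close>.  The tensor square of the free algebra is
  \<open>('i list \<times> 'i list) \<Rightarrow>\<^sub>0 qpi\<close>, with the basis of pairs of words.\<close>

definition free_wt :: "('i \<Rightarrow> nat) \<Rightarrow> 'i free_alg set" where
  "free_wt \<nu> = {x. \<forall>w\<in>Poly_Mapping.keys x. count_list w = \<nu>}"

definition tensor :: "'i free_alg \<Rightarrow> 'i free_alg \<Rightarrow> ('i list \<times> 'i list) \<Rightarrow>\<^sub>0 qpi" where
  "tensor x y = (\<Sum>a\<in>Poly_Mapping.keys x. \<Sum>b\<in>Poly_Mapping.keys y.
     Poly_Mapping.single (a, b) (Poly_Mapping.lookup x a * Poly_Mapping.lookup y b))"

definition tensor_mult :: "('i::finite, 'y, 'x) root_data \<Rightarrow>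
  (('i list \<times> 'i list) \<Rightarrow>\<^sub>0 qpi) \<Rightarrow> (('i list \<times> 'i list) \<Rightarrow>\<^sub>0 qpi) \<Rightarrow> (('i list \<times> 'i list) \<Rightarrow>\<^sub>0 qpi)" where
  "tensor_mult D s t =
     (\<Sum>(a, b)\<in>Poly_Mapping.keys s. \<Sum>(c, d)\<in>Poly_Mapping.keys t.
        Poly_Mapping.single (a @ c, b @ d)
          (Poly_Mapping.lookup s (a, b) * Poly_Mapping.lookup t (c, d) *
           qq powi dot_ext D (count_list b) (count_list c) *
           \<pi> ^ (par D (count_list b) * par D (count_list c))))"

fun r_word :: "('i::finite, 'y, 'x) root_data \<Rightarrow> 'i list \<Rightarrow> (('i list \<times> 'i list) \<Rightarrow>\<^sub>0 qpi)" where
  "r_word D [] = tensor 1 1"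
| "r_word D (i # w) = tensor_mult D (tensor (var i) 1 + tensor 1 (var i)) (r_word D w)"

definition r_map :: "('i::finite, 'y, 'x) root_data \<Rightarrow> 'i free_alg \<Rightarrow> (('i list \<times> 'i list) \<Rightarrow>\<^sub>0 qpi)" where
  "r_map D x = (\<Sum>w\<in>Poly_Mapping.keys x.
     Poly_Mapping.map (\<lambda>c. Poly_Mapping.lookup x w * c) (r_word D w))"

definition tensor_form :: "('i free_alg \<Rightarrow> 'i free_alg \<Rightarrow> qpi) \<Rightarrow>
  (('i list \<times> 'i list) \<Rightarrow>\<^sub>0 qpi) \<Rightarrow> (('i list \<times> 'i list) \<Rightarrow>\<^sub>0 qpi) \<Rightarrow> qpi" where
  "tensor_form B s t =
     (\<Sum>(a, b)\<in>Poly_Mapping.keys s. \<Sum>(c, d)\<in>Poly_Mapping.keys t.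
        Poly_Mapping.lookup s (a, b) * Poly_Mapping.lookup t (c, d) *
        B (monom_word a) (monom_word c) * B (monom_word b) (monom_word d))"

definition canonical_form ::
  "('i::finite, 'y, 'x) root_data \<Rightarrow> ('i free_alg \<Rightarrow> 'i free_alg \<Rightarrow> qpi) \<Rightarrow> bool" where
  "canonical_form D B \<longleftrightarrow>
     (\<forall>y. is_additive (\<lambda>x. B x y)) \<and> (\<forall>x. is_additive (B x)) \<and>
     (\<forall>c x y. B (scal c * x) y = c * B x y \<and> B x (scal c * y) = c * B x y) \<and>
     B 1 1 = 1 \<and>
     (\<forall>i j. B (var i) (var j) =
        (if i = j then inverse (1 - pi_of D i * q_of D i powi (- 2)) else 0)) \<and>
     (\<forall>x y' y''. B x (y' * y'') = tensor_form B (r_map D x) (tensor y' y'')) \<and>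
     (\<forall>x x' y''. B (x * x') y'' = tensor_form B (tensor x x') (r_map D y''))"

definition radical :: "('a \<Rightarrow> 'a \<Rightarrow> qpi) \<Rightarrow> 'a set" where
  "radical B = {x. \<forall>y. B x y = 0}"


section \<open>The quantum supergroup\<close>

datatype ('i, 'y) gen = gE 'i | gF 'i | gJ 'y | gK 'y

definition Jt :: "('i, 'y::ab_group_add, 'x) root_data \<Rightarrow> int \<Rightarrow> 'i \<Rightarrow> ('i, 'y) gen free_alg" where
  "Jt D s i = var (gJ (int_mult (s * dd D i) (ymap D i)))"

definition Kt :: "('i, 'y::ab_group_add, 'x) root_data \<Rightarrow> int \<Rightarrow> 'i \<Rightarrow> ('i, 'y) gen free_alg" where
  "Kt D s i = var (gK (int_mult (s * dd D i) (ymap D i)))"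

inductive_set relators ::
  "('i::finite, 'y::ab_group_add, 'x) root_data \<Rightarrow> ('i free_alg \<Rightarrow> 'i free_alg \<Rightarrow> qpi) \<Rightarrow>
   ('i, 'y) gen free_alg set"
  for D B where
  "var (gK 0) - 1 \<in> relators D B"
| "var (gK \<mu>) * var (gK \<mu>') - var (gK (\<mu> + \<mu>')) \<in> relators D B"
| "var (gJ (\<mu> + \<mu>)) - 1 \<in> relators D B"
| "var (gJ \<mu>) * var (gJ \<mu>') - var (gJ (\<mu> + \<mu>')) \<in> relators D B"
| "var (gJ \<mu>) * var (gK \<mu>') - var (gK \<mu>') * var (gJ \<mu>) \<in> relators D B"
| "var (gK \<mu>) * var (gE i) - scal (qq powi pairing D \<mu> (xmap D i)) * var (gE i) * var (gK \<mu>)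
     \<in> relators D B"
| "var (gJ \<mu>) * var (gE i) - scal (\<pi> powi pairing D \<mu> (xmap D i)) * var (gE i) * var (gJ \<mu>)
     \<in> relators D B"
| "var (gK \<mu>) * var (gF i) - scal (qq powi (- pairing D \<mu> (xmap D i))) * var (gF i) * var (gK \<mu>)
     \<in> relators D B"
| "var (gJ \<mu>) * var (gF i) - scal (\<pi> powi (- pairing D \<mu> (xmap D i))) * var (gF i) * var (gJ \<mu>)
     \<in> relators D B"
| "var (gE i) * var (gF j)
     - scal (if i \<in> odd_part D \<and> j \<in> odd_part D then \<pi> else 1) * var (gF j) * var (gE i)
     - (if i = j
        then scal (inverse (pi_of D i * q_of D i - q_of D i powi (- 1))) * (Jt D 1 i * Kt D 1 i - Kt D (- 1) i)
        else 0)
     \<in> relators D B"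
| "x \<in> radical B \<Longrightarrow> rename gE x \<in> relators D B"
| "x \<in> radical B \<Longrightarrow> rename gF x \<in> relators D B"

fun odd_gen :: "('i, 'y, 'x) root_data \<Rightarrow> ('i, 'y) gen \<Rightarrow> bool" where
  "odd_gen D (gE i) = (i \<in> odd_part D)"
| "odd_gen D (gF i) = (i \<in> odd_part D)"
| "odd_gen D (gJ \<mu>) = False"
| "odd_gen D (gK \<mu>) = False"

text \<open>The form on the free algebra, the algebras \<open>f\<close> and \<open>U\<close> (as the quotients \<open>'f\<close> and \<open>'u\<close> of free
  algebras), the homomorphisms \<open>x \<mapsto> x\<^sup>+\<close> and \<open>x \<mapsto> x\<^sup>-\<close>, and the antipode.\<close>

record ('i, 'y, 'f, 'u) quantum_data =
  form :: "'i free_alg \<Rightarrow> 'i free_alg \<Rightarrow> qpi"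
  f_proj :: "'i free_alg \<Rightarrow> 'f"
  U_proj :: "('i, 'y) gen free_alg \<Rightarrow> 'u"
  plus_hom :: "'f \<Rightarrow> 'u"
  minus_hom :: "'f \<Rightarrow> 'u"
  antipode :: "'u \<Rightarrow> 'u"

definition f_scal :: "('i, 'y, 'f, 'u) quantum_data \<Rightarrow> qpi \<Rightarrow> 'f" where
  "f_scal Q c = f_proj Q (scal c)"

definition U_scal :: "('i, 'y, 'f, 'u) quantum_data \<Rightarrow> qpi \<Rightarrow> 'u" where
  "U_scal Q c = U_proj Q (scal c)"

definition f_wt :: "('i, 'y, 'f, 'u) quantum_data \<Rightarrow> ('i \<Rightarrow> nat) \<Rightarrow> 'f set" where
  "f_wt Q \<nu> = f_proj Q ` free_wt \<nu>"

text \<open>The induced form on \<open>f\<close>, computed on representatives.\<close>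

definition f_form :: "('i, 'y, 'f, 'u) quantum_data \<Rightarrow> 'f \<Rightarrow> 'f \<Rightarrow> qpi" where
  "f_form Q u v = form Q (inv (f_proj Q) u) (inv (f_proj Q) v)"

text \<open>The even (\<open>b = False\<close>) and the odd (\<open>b = True\<close>) part of \<open>U\<close>.\<close>

definition U_par :: "('i, 'y, 'x) root_data \<Rightarrow> ('i, 'y, 'f, 'u) quantum_data \<Rightarrow> bool \<Rightarrow> 'u set" where
  "U_par D Q b =
     U_proj Q ` {x. \<forall>w\<in>Poly_Mapping.keys x. odd (length (filter (odd_gen D) w)) = b}"

definition is_half_hom ::
  "('i, 'y, 'f::ring_1, 'u::ring_1) quantum_data \<Rightarrow> ('i \<Rightarrow> ('i, 'y) gen) \<Rightarrow> ('f \<Rightarrow> 'u) \<Rightarrow> bool" where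
  "is_half_hom Q g h \<longleftrightarrow>
     is_ring_hom h \<and> (\<forall>c. h (f_scal Q c) = U_scal Q c) \<and>
     (\<forall>i. h (f_proj Q (var i)) = U_proj Q (var (g i)))"

definition is_antipode ::
  "('i, 'y::ab_group_add, 'x) root_data \<Rightarrow> ('i, 'y, 'f, 'u::ring_1) quantum_data \<Rightarrow> ('u \<Rightarrow> 'u) \<Rightarrow> bool" where
  "is_antipode D Q S \<longleftrightarrow>
     is_additive S \<and> (\<forall>c x. S (U_scal Q c * x) = U_scal Q c * S x) \<and>
     (\<forall>i. S (U_proj Q (var (gE i))) = U_proj Q (- (Jt D (- 1) i * Kt D (- 1) i * var (gE i)))) \<and>
     (\<forall>i. S (U_proj Q (var (gF i))) = U_proj Q (- (var (gF i) * Kt D 1 i))) \<and>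
     (\<forall>\<mu>. S (U_proj Q (var (gK \<mu>))) = U_proj Q (var (gK (- \<mu>)))) \<and>
     (\<forall>\<mu>. S (U_proj Q (var (gJ \<mu>))) = U_proj Q (var (gJ (- \<mu>)))) \<and>
     (\<forall>a b. \<forall>x\<in>U_par D Q a. \<forall>y\<in>U_par D Q b.
        S (x * y) = U_scal Q (if a \<and> b then \<pi> else 1) * S y * S x)"

definition quantum_supergroup ::
  "('i::finite, 'y::ab_group_add, 'x) root_data \<Rightarrow> ('i, 'y, 'f::ring_1, 'u::ring_1) quantum_data \<Rightarrow> bool" where
  "quantum_supergroup D Q \<longleftrightarrow>
     canonical_form D (form Q) \<and>
     quotient_map (f_proj Q) (radical (form Q)) \<and>
     quotient_map (U_proj Q) (two_sided_ideal hull relators D (form Q)) \<and>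
     is_half_hom Q gE (plus_hom Q) \<and> is_half_hom Q gF (minus_hom Q) \<and>
     is_antipode D Q (antipode Q)"


section \<open>Modules\<close>

definition U_module :: "('u::ring_1 \<Rightarrow> 'm::ab_group_add \<Rightarrow> 'm) \<Rightarrow> bool" where
  "U_module act \<longleftrightarrow>
     (\<forall>u. is_additive (act u)) \<and> (\<forall>m. is_additive (\<lambda>u. act u m)) \<and>
     (\<forall>m. act 1 m = m) \<and> (\<forall>u v m. act (u * v) m = act u (act v m))"

definition U_hom ::
  "('u \<Rightarrow> 'm::ab_group_add \<Rightarrow> 'm) \<Rightarrow> ('u \<Rightarrow> 'n::ab_group_add \<Rightarrow> 'n) \<Rightarrow> ('m \<Rightarrow> 'n) \<Rightarrow> bool" where
  "U_hom act act' T \<longleftrightarrow> is_additive T \<and> (\<forall>u m. T (act u m) = act' u (T m))"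

definition scale :: "('i, 'y, 'f, 'u) quantum_data \<Rightarrow> ('u \<Rightarrow> 'm \<Rightarrow> 'm) \<Rightarrow> qpi \<Rightarrow> 'm \<Rightarrow> 'm" where
  "scale Q act c m = act (U_scal Q c) m"

definition weight_space ::
  "('i, 'y, 'x) root_data \<Rightarrow> ('i, 'y, 'f, 'u) quantum_data \<Rightarrow> ('u \<Rightarrow> 'm \<Rightarrow> 'm) \<Rightarrow> 'x \<Rightarrow> 'm set" where
  "weight_space D Q act lam =
     {m. \<forall>\<mu>. act (U_proj Q (var (gK \<mu>))) m = scale Q act (qq powi pairing D \<mu> lam) m \<and>
             act (U_proj Q (var (gJ \<mu>))) m = scale Q act (\<pi> powi pairing D \<mu> lam) m}"

text \<open>\<open>gr False\<close> and \<open>gr True\<close> are the even and the odd part of the module.  The existence part of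
  the last condition is all that is needed for a weight space to be graded.\<close>

definition category_C ::
  "('i, 'y, 'x) root_data \<Rightarrow> ('i, 'y, 'f, 'u::ring_1) quantum_data \<Rightarrow>
   ('u \<Rightarrow> 'm::ab_group_add \<Rightarrow> 'm) \<Rightarrow> (bool \<Rightarrow> 'm set) \<Rightarrow> bool" where
  "category_C D Q act gr \<longleftrightarrow>
     U_module act \<and>
     (\<forall>b. 0 \<in> gr b \<and> (\<forall>m\<in>gr b. \<forall>n\<in>gr b. m + n \<in> gr b)) \<and>
     direct_sum_on UNIV gr \<and>
     (\<forall>a b. \<forall>u\<in>U_par D Q a. \<forall>m\<in>gr b. act u m \<in> gr (a \<noteq> b)) \<and>
     direct_sum_on UNIV (weight_space D Q act) \<and>
     (\<forall>lam. \<forall>m\<in>weight_space D Q act lam.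
        \<exists>m0\<in>weight_space D Q act lam \<inter> gr False. \<exists>m1\<in>weight_space D Q act lam \<inter> gr True. m = m0 + m1)"

definition category_O ::
  "('i::finite, 'y, 'x) root_data \<Rightarrow> ('i, 'y, 'f, 'u::ring_1) quantum_data \<Rightarrow>
   ('u \<Rightarrow> 'm::ab_group_add \<Rightarrow> 'm) \<Rightarrow> (bool \<Rightarrow> 'm set) \<Rightarrow> bool" where
  "category_O D Q act gr \<longleftrightarrow>
     category_C D Q act gr \<and>
     (\<forall>m. \<exists>n. \<forall>\<nu>. ht \<nu> \<ge> n \<longrightarrow> (\<forall>x\<in>f_wt Q \<nu>. act (plus_hom Q x) m = 0))"

text \<open>\<open>act\<close> is the action of \<open>U\<close> on the Verma module of highest weight \<open>lam\<close>, whose underlying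
  module is \<open>f\<close> itself.\<close>

definition verma ::
  "('i::finite, 'y, 'x::ab_group_add) root_data \<Rightarrow> ('i, 'y, 'f::ring_1, 'u::ring_1) quantum_data \<Rightarrow>
   'x \<Rightarrow> ('u \<Rightarrow> 'f \<Rightarrow> 'f) \<Rightarrow> bool" where
  "verma D Q lam act \<longleftrightarrow>
     U_module act \<and>
     (\<forall>c y. act (U_scal Q c) y = f_scal Q c * y) \<and>
     (\<forall>\<mu> \<nu>. \<forall>y\<in>f_wt Q \<nu>.
        act (U_proj Q (var (gK \<mu>))) y = f_scal Q (qq powi pairing D \<mu> (lam - xwt D \<nu>)) * y \<and>
        act (U_proj Q (var (gJ \<mu>))) y = f_scal Q (\<pi> powi pairing D \<mu> (lam - xwt D \<nu>)) * y) \<and>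
     (\<forall>i y. act (U_proj Q (var (gF i))) y = f_proj Q (var i) * y) \<and>
     (\<forall>i. act (U_proj Q (var (gE i))) 1 = 0)"


section \<open>The Casimir operator\<close>

definition weight_basis :: "('i, 'y, 'f::ring_1, 'u) quantum_data \<Rightarrow> 'f set \<Rightarrow> bool" where
  "weight_basis Q B \<longleftrightarrow>
     \<not> module.dependent (\<lambda>c x. f_scal Q c * x) B \<and>
     module.span (\<lambda>c x. f_scal Q c * x) B = UNIV \<and>
     (\<forall>\<nu>. module.span (\<lambda>c x. f_scal Q c * x) (B \<inter> f_wt Q \<nu>) = f_wt Q \<nu>)"

definition dual_basis ::
  "('i, 'y, 'f::ring_1, 'u) quantum_data \<Rightarrow> 'f set \<Rightarrow> ('f \<Rightarrow> 'f) \<Rightarrow> bool" where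
  "dual_basis Q B star \<longleftrightarrow>
     (\<forall>\<nu>. \<forall>b\<in>B \<inter> f_wt Q \<nu>. star b \<in> f_wt Q \<nu> \<and>
        (\<forall>b'\<in>B \<inter> f_wt Q \<nu>. f_form Q b' (star b) = (if b' = b then 1 else 0)))"

definition f_weight :: "('i, 'y, 'f, 'u) quantum_data \<Rightarrow> 'f \<Rightarrow> 'i \<Rightarrow> nat" where
  "f_weight Q b = (THE \<nu>. b \<in> f_wt Q \<nu>)"

text \<open>The factor \<open>\<pi>\<close> to the power \<open>p(\<nu>) choose 2\<close>, where \<open>\<nu> = |b|\<close>, is the one that also occurs
  in the quasi-R-matrix.  It is sometimes omitted from the formula for \<open>\<Omega>\<close>, but it is needed with
  the antipode above, for which \<open>S (x y) = \<pi>\<^bsup>p(x) p(y)\<^esup> S y * S x\<close>: it is exactly the sign that this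
  rule contributes to \<open>S\<close> of a product of generators \<open>F\<^sub>i\<close> of total weight \<open>\<nu>\<close>.

  Take for instance \<open>I = {i}\<close> with \<open>i\<close> odd and \<open>i \<cdot> i = 2\<close>, and let \<open>v\<close> generate the Verma module of a
  highest weight with \<open>\<langle>i, \<lambda>\<rangle> = 2\<close>.  Equivariance of \<open>\<Omega> \<Xi>\<close> forces \<open>\<Omega> (F\<^sup>2 v) = q\<^sup>4 F\<^sup>2 v\<close>.
  At \<open>\<pi> = -1\<close> the summands for \<open>1\<close>, \<open>\<theta>\<close>, \<open>\<theta>\<^sup>2\<close> contribute the multiples \<open>1\<close>, \<open>q\<^sup>-\<^sup>2 - q\<^sup>2\<close>,
  \<open>q\<^sup>4 - 1 + q\<^sup>2 - q\<^sup>-\<^sup>2\<close> of \<open>F\<^sup>2 v\<close>, with sum \<open>q\<^sup>4\<close>; without the factor the last one changes sign.\<close>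

definition Omega_term ::
  "('i::finite, 'y, 'x) root_data \<Rightarrow> ('i, 'y, 'f, 'u::ring_1) quantum_data \<Rightarrow> ('f \<Rightarrow> 'f) \<Rightarrow>
   ('u \<Rightarrow> 'm \<Rightarrow> 'm) \<Rightarrow> 'm \<Rightarrow> 'f \<Rightarrow> 'm" where
  "Omega_term D Q star act m b =
     (let \<nu> = f_weight Q b in
      scale Q act ((- 1) ^ ht \<nu> * \<pi> ^ (par D \<nu> choose 2) * pi_wt D \<nu> * q_wt D \<nu>)
        (act (antipode Q (minus_hom Q b)) (act (plus_hom Q (star b)) m)))"

definition Omega ::
  "('i::finite, 'y, 'x) root_data \<Rightarrow> ('i, 'y, 'f, 'u::ring_1) quantum_data \<Rightarrow> 'f set \<Rightarrow> ('f \<Rightarrow> 'f) \<Rightarrow>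
   ('u \<Rightarrow> 'm::ab_group_add \<Rightarrow> 'm) \<Rightarrow> 'm \<Rightarrow> 'm" where
  "Omega D Q B star act m =
     (\<Sum>b | b \<in> B \<and> Omega_term D Q star act m b \<noteq> 0. Omega_term D Q star act m b)"

definition casimir_function :: "('i, 'y, 'x::ab_group_add) root_data \<Rightarrow> 'x set \<Rightarrow> ('x \<Rightarrow> int) \<Rightarrow> bool" where
  "casimir_function D C G \<longleftrightarrow>
     (\<forall>lam\<in>C. \<forall>i. G lam - G (lam - xmap D i) = dd D i * pairing D (ymap D i) lam)"

definition is_Xi ::
  "('i, 'y, 'x) root_data \<Rightarrow> ('i, 'y, 'f, 'u) quantum_data \<Rightarrow> ('u \<Rightarrow> 'm::ab_group_add \<Rightarrow> 'm) \<Rightarrow>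
   'x set \<Rightarrow> ('x \<Rightarrow> int) \<Rightarrow> ('m \<Rightarrow> 'm) \<Rightarrow> bool" where
  "is_Xi D Q act C G Xi \<longleftrightarrow>
     is_additive Xi \<and> (\<forall>c m. Xi (scale Q act c m) = scale Q act c (Xi m)) \<and>
     (\<forall>lam\<in>C. \<forall>m\<in>weight_space D Q act lam. Xi m = scale Q act ((\<pi> * qq\<^sup>2) powi G lam) m)"

definition locally_finite ::
  "('i, 'y, 'f, 'u) quantum_data \<Rightarrow> ('u \<Rightarrow> 'm::ab_group_add \<Rightarrow> 'm) \<Rightarrow> ('m \<Rightarrow> 'm) \<Rightarrow> bool" where
  "locally_finite Q act T \<longleftrightarrow>
     (\<forall>m. \<exists>A. finite A \<and> m \<in> module.span (\<lambda>a. scale Q act (of_Qq a)) A \<and>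
        T ` module.span (\<lambda>a. scale Q act (of_Qq a)) A \<subseteq> module.span (\<lambda>a. scale Q act (of_Qq a)) A)"

text \<open>A nonzero \<open>m\<close> is an eigenvector of \<open>T\<close> with eigenvalue \<open>a\<close>.  Since the ground ring is the
  product of the fields \<open>\<pi> = 1\<close> and \<open>\<pi> = -1\<close>, the scalar is taken from \<open>\<rat>(q)\<close>, or else \<open>m\<close> is
  required to lie in one of the two components.  With an arbitrary scalar, a sum of eigenvectors in
  the two components with unrelated eigenvalues, or a vector in one component only, would have
  further eigenvalues, whatever the operator.\<close>

definition eigenvector ::
  "('i, 'y, 'f, 'u) quantum_data \<Rightarrow> ('u \<Rightarrow> 'm::ab_group_add \<Rightarrow> 'm) \<Rightarrow> ('m \<Rightarrow> 'm) \<Rightarrow> qpi \<Rightarrow> 'm \<Rightarrow> bool" where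
  "eigenvector Q act T a m \<longleftrightarrow>
     m \<noteq> 0 \<and> T m = scale Q act a m \<and>
     (a \<in> range of_Qq \<or> scale Q act \<pi> m = m \<or> scale Q act \<pi> m = - m)"

end

theory Submission
  imports Defs
begin

text \<open>Why the theorem holds.  Up to a scalar that depends on the weight of \<open>x\<close> only, \<open>S (x\<^sup>-)\<close> is the
  value at \<open>x\<close> of the antihomomorphism \<open>anti\<close> with \<open>\<theta>\<^sub>i \<mapsto> \<pi>\<^sub>i q\<^sub>i F\<^sub>i K\<^sub>i\<close> (lemma
  \<open>antipode_anti\<close>; here \<open>K\<^sub>i\<close>, \<open>J\<^sub>i\<close> are the elements with index \<open>d\<^sub>i i\<close>), and the coefficient
  in the definition of \<open>\<Omega>\<close> is the one that removes this scalar.  So \<open>\<Omega>\<close> is the sum over the weights \<open>\<nu>\<close> of the images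
  \<open>Om \<nu> 1\<close> of the canonical tensors \<open>\<Sum> b \<otimes> b\<^sup>*\<close> of \<open>f\<^sub>\<nu>\<close> under \<open>x \<otimes> y \<mapsto> anti x \<cdot> y\<^sup>+\<close>.

  The commutators of \<open>F\<^sub>i\<close> with \<open>y\<^sup>+\<close> and of \<open>E\<^sub>i\<close> with \<open>anti x\<close> are expressed by two twisted
  derivations of the free algebra (\<open>pls_word_F\<close>, \<open>E_Gw\<close>).  These are adjoint, for the bilinear form,
  to the left and the right multiplication by \<open>\<theta>\<^sub>i\<close> (\<open>form_var_left\<close>, \<open>form_var_right\<close>), and an
  adjoint pair may be moved from one side of the canonical tensor to the other (\<open>adjoint_sum\<close>).
  The commutator with \<open>Om \<nu> 1\<close> thereby becomes a difference of contributions of adjacent weights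
  plus one diagonal term (\<open>Om_F\<close>, \<open>E_Om\<close>).  Summed over all weights the differences cancel, and
  what remains is \<open>\<Omega> F\<^sub>i = F\<^sub>i K\<^sub>i \<Omega> J\<^sub>i K\<^sub>i\<close> and \<open>E\<^sub>i \<Omega> = J\<^sub>i K\<^sub>i\<^sup>2 \<Omega> E\<^sub>i\<close>.  The difference
  equation for \<open>G\<close> says exactly that \<open>\<Xi>\<close> absorbs \<open>J\<^sub>i K\<^sub>i\<^sup>2\<close>, so that \<open>\<Omega> \<Xi>\<close> commutes with the
  action.

  One point is special to this setting.  Moving \<open>J\<^sub>i\<close> past \<open>E\<^sub>j\<close> produces \<open>\<pi>\<^bsup>i \<cdot> j\<^esup>\<close>, and no
  such factor occurs in the coproduct.  It is harmless if \<open>i \<cdot> j\<close> is even for all \<open>j\<close>, and on the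
  component \<open>\<pi> = 1\<close> of the module.  If some \<open>i \<cdot> j\<close> is odd, then both indices are even, and on the
  component \<open>\<pi> = -1\<close> the quantum Serre relation is so incompatible with the commutator of
  \<open>E\<^sub>j\<close> and \<open>F\<^sub>j\<close> that \<open>E\<^sub>i\<close> and \<open>F\<^sub>i\<close> act as zero there (\<open>odd_dot_vanish\<close>).  The commutation
  rules hold for trivial reasons on that component, hence everywhere, since \<open>2\<close> is invertible
  (\<open>combine_components\<close>).

  Let \<open>T = \<Omega> \<Xi>\<close>.  The term of weight \<open>0\<close> of \<open>\<Omega>\<close> is the identity, so on a vector \<open>m\<close> of weight
  \<open>\<lambda>\<close> the difference \<open>T m - (\<pi> q\<^sup>2)\<^bsup>G \<lambda>\<^esup> m\<close> lies in the submodule generated by vectors \<open>x\<^sup>+ m\<close>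
  with \<open>x\<close> of positive weight.  As \<open>T\<close> is a module homomorphism, an induction on the nilpotency order
  of \<open>m\<close> (\<open>triangular_induct\<close>) yields both local finiteness and a product of operators
  \<open>T - (\<pi> q\<^sup>2)\<^sup>c\<close> that annihilates \<open>m\<close>, hence the eigenvalues.  For a quotient of a Verma module
  the generator is annihilated by all \<open>E\<^sub>i\<close>, and \<open>T\<close> acts everywhere by its value on the generator.\<close>

section \<open>The ground ring\<close>

lemma of_Qq_simps [simp]:
  "of_Qq 0 = 0" "of_Qq 1 = 1" "of_Qq (a + b) = of_Qq a + of_Qq b" "of_Qq (- a) = - of_Qq a"
  "of_Qq (a - b) = of_Qq a - of_Qq b" "of_Qq (a * b) = of_Qq a * of_Qq b"
  by (simp_all add: of_Qq_def zero_qpi_def one_qpi_def plus_qpi_def uminus_qpi_def minus_qpi_def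
      times_qpi_def)

lemma of_Qq_power [simp]: "of_Qq (a ^ n) = of_Qq a ^ n"
  by (induction n) simp_all

lemma of_Qq_inverse: "of_Qq (inverse a) = inverse (of_Qq a)"
  by (simp add: of_Qq_def inverse_qpi_def power2_eq_square field_simps)

lemma of_Qq_powi: "of_Qq (a powi n) = of_Qq a powi n"
  by (simp add: power_int_def of_Qq_inverse)

lemma pi_squared [simp]: "\<pi> * \<pi> = 1" "\<pi> * (\<pi> * c) = c"
  by (simp_all add: \<pi>_def times_qpi_def one_qpi_def)

lemma pi_power_mod_2: "\<pi> ^ n = \<pi> ^ (n mod 2)"
proof -
  have "\<pi> ^ n = \<pi> ^ (2 * (n div 2) + n mod 2)" by simp
  then show ?thesis
    by (simp only: power_add power_mult) (simp add: power2_eq_square)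
qed

lemma pi_power_cong: "even (m + n) \<Longrightarrow> \<pi> ^ m = \<pi> ^ n"
  using pi_power_mod_2[of m] pi_power_mod_2[of n] by (simp add: mod_2_eq_odd)

text \<open>The two characters of the ground ring over \<open>\<rat>(q)\<close>, at \<open>\<pi> = 1\<close> and at \<open>\<pi> = -1\<close>.  Together
  they embed it into a product of two fields, and this is how invertibility is decided.\<close>
definition at_pi :: "Qq \<Rightarrow> qpi \<Rightarrow> Qq" where
  "at_pi s c = coeff_one c + s * coeff_pi c"

lemma at_pi_simps [simp]:
  "at_pi s 0 = 0" "at_pi s 1 = 1" "at_pi s (a + b) = at_pi s a + at_pi s b"
  "at_pi s (- a) = - at_pi s a" "at_pi s (a - b) = at_pi s a - at_pi s b"
  "at_pi s (of_Qq x) = x" "at_pi s \<pi> = s"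
  by (simp_all add: at_pi_def of_Qq_def \<pi>_def zero_qpi_def one_qpi_def plus_qpi_def uminus_qpi_def
      minus_qpi_def algebra_simps)

lemma at_pi_mult: "s * s = 1 \<Longrightarrow> at_pi s (a * b) = at_pi s a * at_pi s b"
proof -
  assume s: "s * s = 1"
  have "at_pi s a * at_pi s b = coeff_one a * coeff_one b + (s * s) * (coeff_pi a * coeff_pi b)
      + s * (coeff_one a * coeff_pi b + coeff_pi a * coeff_one b)"
    by (simp add: at_pi_def algebra_simps)
  then show ?thesis by (simp add: s at_pi_def times_qpi_def)
qed

lemma qpi_unit_iff_at_pi:
  assumes "at_pi 1 c \<noteq> 0" "at_pi (- 1) c \<noteq> 0"
  shows "c * inverse c = 1"
proof (rule qpi_mult_inverse)
  have "at_pi 1 c * at_pi (- 1) c \<noteq> 0" using assms by simp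
  then show "(coeff_one c)\<^sup>2 \<noteq> (coeff_pi c)\<^sup>2"
    by (simp add: at_pi_def power2_eq_square algebra_simps)
qed

text \<open>Integer powers are defined by cases on the sign of the exponent; for a unit the two cases fit together.\<close>
lemma powi_add_unit:
  fixes x :: qpi
  assumes "x * inverse x = 1"
  shows "x powi (m + n) = x powi m * x powi n"
proof -
  have suc: "x powi (k + 1) = x * x powi k" for k
  proof (cases "k \<ge> 0")
    case True
    then show ?thesis by (simp add: power_int_def nat_add_distrib)
  next
    case False
    then have e: "nat (- k) = Suc (nat (- (k + 1)))" by simp
    have "x * inverse x ^ Suc (nat (- (k + 1))) = inverse x ^ nat (- (k + 1))"
      using assms by (simp add: mult.assoc[symmetric])
    then show ?thesis using False e by (auto simp: power_int_def)
  qed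
  have pre: "x powi k = inverse x * x powi (k + 1)" for k
    using assms by (simp add: suc mult.assoc[symmetric] mult.commute[of "inverse x"])
  have "x powi (m + n) = x powi m * x powi n" for n
  proof (induction m rule: int_induct[where k = 0])
    case base
    then show ?case by simp
  next
    case (step1 i)
    then show ?case using suc[of "i + n"] suc[of i] by (simp add: algebra_simps)
  next
    case (step2 i)
    then show ?case using pre[of "i - 1 + n"] pre[of "i - 1"] by (simp add: algebra_simps)
  qed
  then show ?thesis .
qed

lemma powi_minus_unit:
  fixes x :: qpi
  assumes "x * inverse x = 1"
  shows "x powi (- n) * x powi n = 1" "x powi n * x powi (- n) = 1"
  using powi_add_unit[OF assms, of "- n" n] by (simp_all add: mult.commute)

lemma powi_mult_unit:
  fixes x :: qpi
  assumes "x * inverse x = 1"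
  shows "x powi (int n * m) = (x powi m) ^ n"
  by (induction n) (simp_all add: powi_add_unit[OF assms] algebra_simps)

lemma powi_mult_distrib_unit:
  fixes x y :: qpi
  assumes "x * inverse x = 1" "y * inverse y = 1"
  shows "(x * y) powi n = x powi n * y powi n"
proof (cases "n \<ge> 0")
  case True
  then show ?thesis by (simp add: power_int_def power_mult_distrib)
next
  case False
  have "(x * y) * (inverse x * inverse y) = (x * inverse x) * (y * inverse y)" by (simp add: ac_simps)
  then have e1: "(x * y) * (inverse x * inverse y) = 1" using assms by simp
  have z: "z = 0" if "coeff_one z ^ 2 = coeff_pi z ^ 2" and "z * inverse z = 1" for z :: qpi
    using that by (simp add: inverse_qpi_def times_qpi_def one_qpi_def)
  have ne: "at_pi s (x * y) \<noteq> 0" if "s * s = 1" for s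
    using e1 at_pi_mult[OF that, of "x * y" "inverse x * inverse y"] by auto
  have "(x * y) * inverse (x * y) = 1"
    by (rule qpi_unit_iff_at_pi) (rule ne; simp)+
  then have "inverse x * inverse y = inverse (x * y)"
    using e1 by (metis mult.commute mult.left_commute mult.right_neutral)
  then have "inverse (x * y) ^ k = inverse x ^ k * inverse y ^ k" for k
    by (metis power_mult_distrib)
  then show ?thesis using False by (simp add: power_int_def)
qed

definition qX :: Qq where "qX = Fract [:0, 1:] 1"

lemma qq_eq: "qq = of_Qq qX"
  by (simp add: qq_def qX_def)

lemma qX_powi_eq_sign:
  assumes "qX powi n = s" "s = 1 \<or> s = - 1"
  shows "n = 0"
proof (rule ccontr)
  assume n: "n \<noteq> 0"
  have ss: "s * s = 1" using assms(2) by auto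
  have k: "qX ^ nat \<bar>n\<bar> = s"
  proof (cases "n \<ge> 0")
    case True
    then show ?thesis using assms by (simp add: power_int_def)
  next
    case False
    then have "inverse (qX ^ nat \<bar>n\<bar>) = s"
      using assms(1) by (simp add: power_int_def power_inverse)
    then have "qX ^ nat \<bar>n\<bar> = inverse s" by (metis inverse_inverse_eq)
    then show ?thesis using assms(2) by auto
  qed
  have p: "qX ^ k = Fract ([:0, 1:] ^ k) 1" for k
    by (induction k) (simp_all add: One_fract_def qX_def)
  have "s = Fract [:1:] 1 \<or> s = Fract [:- 1:] 1"
    using assms(2) by (auto simp: One_fract_def one_pCons)
  then have "[:0, 1:] ^ nat \<bar>n\<bar> = [:1::rat:] \<or> [:0, 1:] ^ nat \<bar>n\<bar> = [:- 1::rat:]"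
    using k unfolding p by (auto simp: eq_fract)
  then have "degree ([:0, 1::rat:] ^ nat \<bar>n\<bar>) = 0" by auto
  then show False using n by (simp add: degree_power_eq)
qed

lemma qX_nonzero [simp]: "qX \<noteq> 0"
  by (simp add: Zero_fract_def eq_fract qX_def)

lemma qX_powi_eq_iff [simp]: "qX powi m = qX powi n \<longleftrightarrow> m = n"
  using qX_powi_eq_sign[of "m - n" 1] by (auto simp: power_int_diff)

lemma qX_powi_neq_minus: "qX powi m \<noteq> - (qX powi n)"
proof
  assume a: "qX powi m = - (qX powi n)"
  then have "qX powi (m - n) = - 1" by (simp add: power_int_diff)
  then have "m - n = 0" using qX_powi_eq_sign by blast
  then show False using a by simp
qed

lemma qq_powi: "qq powi n = of_Qq (qX powi n)"
  by (simp add: qq_eq of_Qq_powi)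

lemma qq_unit: "qq * inverse qq = 1"
  by (rule qpi_unit_iff_at_pi) (simp_all add: qq_eq)

lemmas qq_powi_add = powi_add_unit[OF qq_unit]

lemma pi_unit: "\<pi> * inverse \<pi> = 1"
  by (rule qpi_unit_iff_at_pi) simp_all

lemmas pi_powi_add = powi_add_unit[OF pi_unit]

lemma pi_qq_unit: "(\<pi> * qq\<^sup>2) * inverse (\<pi> * qq\<^sup>2) = 1"
  by (rule qpi_unit_iff_at_pi) (simp_all add: at_pi_mult power2_eq_square qq_eq)

lemmas pi_qq_powi_add = powi_add_unit[OF pi_qq_unit]

lemma qq_power_unit: "qq\<^sup>2 * inverse (qq\<^sup>2) = 1"
  by (rule qpi_unit_iff_at_pi) (simp_all add: at_pi_mult power2_eq_square qq_eq)

lemma pi_qq_powi: "(\<pi> * qq\<^sup>2) powi n = \<pi> powi n * (qq powi n * qq powi n)"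
proof -
  have "(qq\<^sup>2) powi n = qq powi n * qq powi n"
    by (simp add: power2_eq_square powi_mult_distrib_unit qq_unit)
  then show ?thesis by (simp add: powi_mult_distrib_unit[OF pi_unit qq_power_unit])
qed

lemma inverse_pi: "inverse \<pi> = \<pi>"
  by (simp add: \<pi>_def inverse_qpi_def)

lemma pi_powi_even [simp]: "even n \<Longrightarrow> \<pi> powi n = 1"
  using pi_power_cong[of "nat \<bar>n\<bar>" 0] by (auto simp: power_int_def inverse_pi even_nat_iff)

lemma pi_powi_odd: "odd n \<Longrightarrow> \<pi> powi n = \<pi>"
  using pi_powi_add[of "n - 1" 1] by simp

lemma at_pi_qq_powi [simp]: "at_pi s (qq powi n) = qX powi n"
  by (simp add: qq_powi)

lemma at_pi_pi_powi: "at_pi s (\<pi> powi n) = (if even n then 1 else s)"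
  by (simp add: pi_powi_odd)

lemma at_pi_pi_qq_powi:
  assumes "s * s = 1"
  shows "at_pi s ((\<pi> * qq\<^sup>2) powi n) = (if even n then 1 else s) * qX powi (2 * n)"
proof -
  have "qX powi (2 * n) = qX powi n * qX powi n"
    using power_int_add[of qX n n] by simp
  then show ?thesis
    by (simp add: pi_qq_powi at_pi_mult[OF assms] at_pi_pi_powi)
qed

section \<open>Free algebras\<close>

lemma additive_zero: "is_additive h \<Longrightarrow> h 0 = 0"
  unfolding is_additive_def by (metis add_cancel_right_right)

lemma additive_add: "is_additive h \<Longrightarrow> h (x + y) = h x + h y"
  by (simp add: is_additive_def)

lemma additive_minus: "is_additive h \<Longrightarrow> h (- x) = - h x"
  using additive_add[of h x "- x"] additive_zero[of h] by (simp add: eq_neg_iff_add_eq_0 add.commute)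

lemma additive_diff: "is_additive h \<Longrightarrow> h (x - y) = h x - h y"
  using additive_add[of h x "- y"] additive_minus[of h y] by simp

lemma additive_sum: "is_additive h \<Longrightarrow> h (sum g A) = (\<Sum>a\<in>A. h (g a))"
  by (induction A rule: infinite_finite_induct) (simp_all add: additive_zero additive_add)

lemma scal_simps [simp]:
  "scal 0 = (0 :: 'a free_alg)" "scal 1 = (1 :: 'a free_alg)" "scal (a + b) = scal a + scal b" "scal (- a) = - scal a"
  "scal (a - b) = scal a - scal b"
  using mult_single[of "[] :: 'a list" a "[]" b] single_one[where 'a = "'a list" and 'b = qpi]
  by (simp_all add: scal_def single_add single_uminus single_diff plus_list_def zero_list_def)

lemma scal_mult: "scal (a * b) = (scal a * scal b :: 'a free_alg)"
  using mult_single[of "[] :: 'a list" a "[]" b] by (simp add: scal_def plus_list_def)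

lemma lookup_scal_mult [simp]: "Poly_Mapping.lookup (scal c * x) w = c * Poly_Mapping.lookup x w"
proof -
  have "scal c * x = Poly_Mapping.map ((*) c) x"
    by (simp add: scal_def mult_map_scale_conv_mult zero_list_def)
  then show ?thesis by (simp add: Poly_Mapping.map.rep_eq when_def)
qed

lemma monom_word_append: "monom_word (v @ w) = monom_word v * monom_word w"
  by (simp add: monom_word_def mult_single plus_list_def)

lemma monom_word_Cons: "monom_word (i # w) = var i * monom_word w"
  using monom_word_append[of "[i]" w] by (simp add: var_def)

lemma monom_word_Nil [simp]: "monom_word [] = 1"
  by (simp add: monom_word_def flip: zero_list_def)

lemma lookup_monom_word: "Poly_Mapping.lookup (monom_word v) w = (if v = w then 1 else 0)"
  by (simp add: monom_word_def lookup_single when_def)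

lemma keys_monom_word [simp]: "Poly_Mapping.keys (monom_word w) = {w}"
  by (simp add: monom_word_def)

lemma free_alg_expand:
  "x = (\<Sum>w\<in>Poly_Mapping.keys x. scal (Poly_Mapping.lookup x w) * monom_word w)"
proof (rule poly_mapping_eqI)
  fix v
  have "(\<Sum>w\<in>Poly_Mapping.keys x. Poly_Mapping.lookup x w * (if w = v then 1 else 0)) =
      (\<Sum>w\<in>Poly_Mapping.keys x. if w = v then Poly_Mapping.lookup x v else 0)"
    by (intro sum.cong) auto
  then show "Poly_Mapping.lookup x v = Poly_Mapping.lookup
      (\<Sum>w\<in>Poly_Mapping.keys x. scal (Poly_Mapping.lookup x w) * monom_word w) v"
    by (simp add: lookup_sum lookup_monom_word in_keys_iff)
qed

text \<open>Linear statements about the free algebra need to be checked on words only; the set \<open>W\<close> restricts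
  the words, which gives the version for a fixed weight below.\<close>
lemma free_alg_keys_induct [consumes 1, case_names zero add monom]:
  assumes "Poly_Mapping.keys x \<subseteq> W" and "P 0"
    and "\<And>x y. Poly_Mapping.keys x \<subseteq> W \<Longrightarrow> Poly_Mapping.keys y \<subseteq> W \<Longrightarrow> P x \<Longrightarrow> P y \<Longrightarrow> P (x + y)"
    and "\<And>c w. w \<in> W \<Longrightarrow> P (scal c * monom_word w)"
  shows "P x"
proof -
  have k: "Poly_Mapping.keys (\<Sum>w\<in>A. scal (c w) * monom_word w) \<subseteq> A" for c and A :: "'a list set"
    by (rule subset_trans[OF keys_sum]) (auto simp: in_keys_iff lookup_monom_word split: if_splits)
  have "A \<subseteq> W \<Longrightarrow> P (\<Sum>w\<in>A. scal (Poly_Mapping.lookup x w) * monom_word w)" if "finite A" for A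
    using that
  proof (induction A rule: finite_induct)
    case empty
    then show ?case by (simp add: assms(2))
  next
    case (insert w A)
    have "Poly_Mapping.keys (scal (Poly_Mapping.lookup x w) * monom_word w) \<subseteq> W"
      using insert.prems by (auto simp: in_keys_iff lookup_monom_word split: if_splits)
    moreover have "Poly_Mapping.keys (\<Sum>w\<in>A. scal (Poly_Mapping.lookup x w) * monom_word w) \<subseteq> W"
      using k[of _ A] insert.prems by blast
    ultimately show ?case using insert assms(3,4) by simp
  qed
  from this[OF finite_keys assms(1)] show ?thesis
    by (simp only: free_alg_expand[symmetric])
qed

lemmas free_alg_induct [case_names zero add monom] =
  free_alg_keys_induct[where W = UNIV, simplified]

lemma free_wt_iff: "x \<in> free_wt \<nu> \<longleftrightarrow> Poly_Mapping.keys x \<subseteq> {w. count_list w = \<nu>}"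
  by (auto simp: free_wt_def)

lemma free_wt_induct [consumes 1, case_names zero add monom]:
  assumes "x \<in> free_wt \<nu>" and "P 0"
    and "\<And>x y. x \<in> free_wt \<nu> \<Longrightarrow> y \<in> free_wt \<nu> \<Longrightarrow> P x \<Longrightarrow> P y \<Longrightarrow> P (x + y)"
    and "\<And>c w. count_list w = \<nu> \<Longrightarrow> P (scal c * monom_word w)"
  shows "P x"
  using assms(1)[unfolded free_wt_iff] by (induction rule: free_alg_keys_induct)
    (use assms(2-) in \<open>auto simp: free_wt_iff\<close>)

lemma scal_commute:
  fixes x :: "'a free_alg"
  shows "scal c * x = x * scal c"
proof (induction x rule: free_alg_induct)
  case (monom d w)
  have "monom_word w * scal c = scal c * monom_word w"
    by (simp add: scal_def monom_word_def mult_single plus_list_def)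
  moreover have "scal c * scal d = (scal d * scal c :: 'a free_alg)"
    by (simp only: scal_mult[symmetric] mult.commute)
  ultimately show ?case by (simp add: mult.assoc flip: mult.assoc[of "scal c"])
qed (simp_all add: algebra_simps)

lemma free_wt_simps [simp]:
  "0 \<in> free_wt \<nu>"
  "x \<in> free_wt \<nu> \<Longrightarrow> y \<in> free_wt \<nu> \<Longrightarrow> x + y \<in> free_wt \<nu>"
  "x \<in> free_wt \<nu> \<Longrightarrow> scal c * x \<in> free_wt \<nu>"
  "x \<in> free_wt \<nu> \<Longrightarrow> - x \<in> free_wt \<nu>"
  "monom_word w \<in> free_wt \<nu> \<longleftrightarrow> count_list w = \<nu>"
  using keys_add[of x y] by (auto simp: free_wt_def in_keys_iff lookup_add split: if_splits)

lemma free_wt_diff [simp]: "x \<in> free_wt \<nu> \<Longrightarrow> y \<in> free_wt \<nu> \<Longrightarrow> x - y \<in> free_wt \<nu>"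
  using free_wt_simps(2)[of x \<nu> "- y"] by simp

lemma free_wt_sum: "(\<And>a. a \<in> A \<Longrightarrow> g a \<in> free_wt \<nu>) \<Longrightarrow> sum g A \<in> free_wt \<nu>"
  by (induction A rule: infinite_finite_induct) auto

text \<open>\<open>\<nu> + i\<close>; an opaque constant, because the simplifier would otherwise rewrite the function update.\<close>
definition inc :: "'i \<Rightarrow> ('i \<Rightarrow> nat) \<Rightarrow> 'i \<Rightarrow> nat" where
  "inc i \<nu> = \<nu>(i := Suc (\<nu> i))"

lemma count_list_Cons: "count_list (i # w) = inc i (count_list w)"
  by (auto simp: inc_def)

lemma count_list_snoc: "count_list (w @ [i]) = inc i (count_list w)"
  by (auto simp: inc_def)

lemma count_list_Nil: "count_list [] = (\<lambda>_. 0)"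
  by auto

lemma count_list_eq_0_iff: "count_list w = (\<lambda>_. 0) \<longleftrightarrow> w = []"
  by (cases w) (auto simp: fun_eq_iff)

lemma inc_inject: "inc i \<mu> = inc i \<nu> \<longleftrightarrow> \<mu> = \<nu>"
  by (auto simp: inc_def fun_eq_iff split: if_splits)

lemma var_mult_free_wt:
  assumes "x \<in> free_wt \<nu>"
  shows "var i * x \<in> free_wt (inc i \<nu>)" "x * var i \<in> free_wt (inc i \<nu>)"
  using assms
proof (induction x rule: free_wt_induct)
  case (monom c w)
  have "var i * (scal c * monom_word w) = scal c * monom_word (i # w)"
    by (metis monom_word_Cons mult.assoc scal_commute)
  moreover have "(scal c * monom_word w) * var i = scal c * monom_word (w @ [i])"
    by (simp add: monom_word_append var_def mult.assoc)
  ultimately show "var i * (scal c * monom_word w) \<in> free_wt (inc i \<nu>)"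
    "(scal c * monom_word w) * var i \<in> free_wt (inc i \<nu>)"
    using monom by (simp_all only: free_wt_simps count_list_Cons count_list_snoc)
qed (simp_all add: distrib_left distrib_right)

text \<open>Linear extension of a function on words, for a ring \<open>'r\<close> that is an algebra by means of \<open>s\<close>.\<close>
definition lin :: "(qpi \<Rightarrow> 'r::ring_1) \<Rightarrow> ('g list \<Rightarrow> 'r) \<Rightarrow> 'g free_alg \<Rightarrow> 'r" where
  "lin s g x = (\<Sum>w\<in>Poly_Mapping.keys x. s (Poly_Mapping.lookup x w) * g w)"

lemma lin_superset:
  assumes "is_additive s" "finite A" "Poly_Mapping.keys x \<subseteq> A"
  shows "lin s g x = (\<Sum>w\<in>A. s (Poly_Mapping.lookup x w) * g w)"
  unfolding lin_def using assms
  by (intro sum.mono_neutral_left) (auto simp: in_keys_iff additive_zero)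

lemma lin_add: "is_additive s \<Longrightarrow> lin s g (x + y) = lin s g x + lin s g y"
proof -
  assume s: "is_additive s"
  let ?A = "Poly_Mapping.keys x \<union> Poly_Mapping.keys y"
  have "Poly_Mapping.keys (x + y) \<subseteq> ?A" by (rule keys_add)
  then show ?thesis using s
    by (simp add: lin_superset[of s ?A] lookup_add additive_add distrib_right sum.distrib)
qed

lemma lin_scal_monom:
  assumes "is_additive s"
  shows "lin s g (scal c * monom_word w) = s c * g w"
proof -
  have "Poly_Mapping.keys (scal c * monom_word w) \<subseteq> {w}"
    by (auto simp: in_keys_iff lookup_monom_word split: if_splits)
  from lin_superset[OF assms _ this, of g] show ?thesis by (simp add: lookup_monom_word)
qed

lemma lin_scal:
  assumes "is_additive s" "\<And>a b. s (a * b) = s a * s b"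
  shows "lin s g (scal c * x) = s c * lin s g x"
proof (induction x rule: free_alg_induct)
  case (monom d w)
  then show ?case using lin_scal_monom[OF assms(1), of g "c * d" w]
    by (simp add: lin_scal_monom assms mult.assoc scal_mult)
qed (simp_all add: lin_def distrib_left lin_add[OF assms(1), unfolded lin_def])

lemma is_additive_scal: "is_additive scal"
  by (simp add: is_additive_def)

lemma is_additive_lin: "is_additive s \<Longrightarrow> is_additive (lin s g)"
  unfolding is_additive_def[of "lin s g"] by (simp add: lin_add)

lemma lin_scal_scal: "lin scal g (scal c * x) = scal c * lin scal g x"
  by (rule lin_scal) (simp_all add: is_additive_scal scal_mult)

lemma lin_scal_monom_word [simp]: "lin scal g (monom_word w) = g w"
  using lin_scal_monom[OF is_additive_scal, of g 1 w] by simp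

section \<open>The coproduct and the twisted derivations\<close>

definition dotw :: "('i::finite, 'y, 'x) root_data \<Rightarrow> 'i \<Rightarrow> ('i \<Rightarrow> nat) \<Rightarrow> int" where
  "dotw D i \<nu> = (\<Sum>j\<in>UNIV. int (\<nu> j) * dot D i j)"

definition pari :: "('i, 'y, 'x) root_data \<Rightarrow> 'i \<Rightarrow> nat" where
  "pari D i = (if i \<in> odd_part D then 1 else 0)"

lemma sum_inc:
  fixes f :: "'i::finite \<Rightarrow> int"
  shows "(\<Sum>j\<in>UNIV. int (inc i \<nu> j) * f j) = f i + (\<Sum>j\<in>UNIV. int (\<nu> j) * f j)"
proof -
  have "(\<Sum>j\<in>UNIV. int (inc i \<nu> j) * f j) =
      (\<Sum>j\<in>UNIV. (if j = i then f i else 0) + int (\<nu> j) * f j)"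
    by (intro sum.cong) (auto simp: inc_def algebra_simps)
  then show ?thesis by (simp add: sum.distrib)
qed

lemma dotw_simps [simp]:
  "dotw D i (\<lambda>_. 0) = 0" "dotw D i (inc j \<nu>) = dot D i j + dotw D i \<nu>"
  by (simp_all add: dotw_def sum_inc)

lemma par_simps [simp]:
  fixes D :: "('i::finite, 'y, 'x) root_data"
  shows "par D (\<lambda>_. 0) = 0" "par D (inc j \<nu>) = pari D j + par D \<nu>"
proof -
  have "(\<Sum>k\<in>odd_part D. inc j \<nu> k) = (\<Sum>k\<in>odd_part D. (if k = j then 1 else 0) + \<nu> k)"
    by (intro sum.cong) (auto simp: inc_def)
  then show "par D (inc j \<nu>) = pari D j + par D \<nu>"
    by (simp add: par_def pari_def sum.distrib)
qed (simp add: par_def)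

lemma ht_simps [simp]: "ht (\<lambda>_. 0) = 0" "ht (inc j \<nu>) = Suc (ht \<nu>)"
proof -
  have "(\<Sum>k\<in>UNIV. inc j \<nu> k) = (\<Sum>k\<in>UNIV. (if k = j then 1 else 0) + \<nu> k)"
    by (intro sum.cong) (auto simp: inc_def)
  then show "ht (inc j \<nu>) = Suc (ht \<nu>)"
    by (simp add: ht_def sum.distrib)
qed (simp add: ht_def)

lemma dot_ext_single: "dot_ext D (count_list [i]) \<nu> = dotw D i \<nu>"
proof -
  have "dot_ext D (count_list [i]) \<nu> =
      (\<Sum>k\<in>UNIV. if k = i then \<Sum>j\<in>UNIV. int (\<nu> j) * dot D i j else 0)"
    unfolding dot_ext_def by (intro sum.cong) auto
  then show ?thesis by (simp add: dotw_def)
qed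

lemma par_single: "par D (count_list [i]) = pari D i"
  unfolding count_list_Cons count_list_Nil par_simps by simp

text \<open>The factor by which \<open>\<theta>\<^sub>i\<close> moves past a factor of weight \<open>\<nu>\<close> in the tensor square.\<close>
definition braid :: "('i::finite, 'y, 'x) root_data \<Rightarrow> 'i \<Rightarrow> ('i \<Rightarrow> nat) \<Rightarrow> qpi" where
  "braid D i \<nu> = qq powi dotw D i \<nu> * \<pi> ^ (pari D i * par D \<nu>)"

lemma braid_simps:
  "braid D i (\<lambda>_. 0) = 1"
  "braid D i (inc j \<nu>) = qq powi dot D i j * \<pi> ^ (pari D i * pari D j) * braid D i \<nu>"
  by (simp_all add: braid_def qq_powi_add power_add algebra_simps)

lemma tensor_monom: "tensor (monom_word u) (monom_word v) = Poly_Mapping.single (u, v) 1"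
  by (simp add: tensor_def lookup_monom_word)

lemma lookup_r_word_Nil:
  fixes D :: "('a::finite, 'y, 'x) root_data"
  shows "Poly_Mapping.lookup (r_word D []) (c, d) = (if c = [] \<and> d = [] then 1 else 0)"
  using tensor_monom[of "[] :: 'a list" "[]"] by (simp add: lookup_single when_def)

text \<open>The two summands come from \<open>\<theta>\<^sub>i \<otimes> 1\<close> and \<open>1 \<otimes> \<theta>\<^sub>i\<close>; only the second one passes a factor \<open>c\<close>.\<close>
lemma lookup_r_word_Cons:
  "Poly_Mapping.lookup (r_word D (i # w)) (c, d) =
     (if c \<noteq> [] \<and> hd c = i then Poly_Mapping.lookup (r_word D w) (tl c, d) else 0) +
     (if d \<noteq> [] \<and> hd d = i then Poly_Mapping.lookup (r_word D w) (c, tl d) * braid D i (count_list c) else 0)"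
proof -
  let ?t = "r_word D w"
  have s: "tensor (var i) 1 + tensor 1 (var i) =
      Poly_Mapping.single ([i], []) 1 + Poly_Mapping.single ([], [i]) 1" (is "_ = ?s")
    using tensor_monom[of "[i]" "[]"] tensor_monom[of "[]" "[i]"] by (simp add: var_def)
  have k: "Poly_Mapping.keys ?s = {([i], []), ([], [i])}"
    by (auto simp: in_keys_iff lookup_add lookup_single when_def split: if_splits)
  have l: "Poly_Mapping.lookup ?s ([i], []) = 1" "Poly_Mapping.lookup ?s ([], [i]) = 1"
    by (auto simp: lookup_add lookup_single)
  have n: "dot_ext D (count_list []) \<nu> = 0" "par D (count_list []) = 0" for \<nu>
    by (simp_all add: dot_ext_def par_def)
  have "r_word D (i # w) =
     (\<Sum>(c', d')\<in>Poly_Mapping.keys ?t. Poly_Mapping.single (i # c', d') (Poly_Mapping.lookup ?t (c', d'))) +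
     (\<Sum>(c', d')\<in>Poly_Mapping.keys ?t. Poly_Mapping.single (c', i # d')
        (Poly_Mapping.lookup ?t (c', d') * braid D i (count_list c')))"
    by (simp only: r_word.simps s tensor_mult_def k)
      (simp add: l n dot_ext_single par_single braid_def mult.assoc del: count_list.simps)
  then have "Poly_Mapping.lookup (r_word D (i # w)) (c, d) =
     (\<Sum>p\<in>Poly_Mapping.keys ?t. if (i # fst p, snd p) = (c, d) then Poly_Mapping.lookup ?t p else 0) +
     (\<Sum>p\<in>Poly_Mapping.keys ?t. if (fst p, i # snd p) = (c, d) then Poly_Mapping.lookup ?t p * braid D i (count_list c) else 0)"
    by (simp add: lookup_add lookup_sum lookup_single when_def case_prod_unfold)
      (intro arg_cong2[of _ _ _ _ "(+)"] sum.cong; auto)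
  also have "(\<Sum>p\<in>Poly_Mapping.keys ?t. if (i # fst p, snd p) = (c, d) then Poly_Mapping.lookup ?t p else 0) =
      (\<Sum>p\<in>Poly_Mapping.keys ?t. if p = (tl c, d) then (if c \<noteq> [] \<and> hd c = i then Poly_Mapping.lookup ?t (tl c, d) else 0) else 0)"
    by (intro sum.cong) (cases c; auto)+
  also have "(\<Sum>p\<in>Poly_Mapping.keys ?t. if (fst p, i # snd p) = (c, d) then Poly_Mapping.lookup ?t p * braid D i (count_list c) else 0) =
      (\<Sum>p\<in>Poly_Mapping.keys ?t. if p = (c, tl d) then (if d \<noteq> [] \<and> hd d = i then Poly_Mapping.lookup ?t (c, tl d) * braid D i (count_list c) else 0) else 0)"
    by (intro sum.cong) (cases d; auto)+
  finally show ?thesis by (simp add: in_keys_iff)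
qed

lemma r_word_weight:
  "Poly_Mapping.lookup (r_word D w) (c, d) \<noteq> 0 \<Longrightarrow> count_list w k = count_list c k + count_list d k"
proof (induction w arbitrary: c d)
  case Nil
  then show ?case by (auto simp del: r_word.simps simp: lookup_r_word_Nil split: if_splits)
next
  case (Cons i w)
  then consider "c \<noteq> []" "hd c = i" "Poly_Mapping.lookup (r_word D w) (tl c, d) \<noteq> 0"
    | "d \<noteq> []" "hd d = i" "Poly_Mapping.lookup (r_word D w) (c, tl d) \<noteq> 0"
    by (fastforce simp del: r_word.simps simp: lookup_r_word_Cons split: if_splits)
  then show ?case
    by cases (use Cons.IH[of "tl c" d] Cons.IH[of c "tl d"] in \<open>cases c; cases d; force\<close>)+
qed

lemma lookup_r_word_left_Nil: "Poly_Mapping.lookup (r_word D w) ([], d) = (if d = w then 1 else 0)"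
proof (induction w arbitrary: d)
  case (Cons i w)
  then show ?case by (cases d) (auto simp del: r_word.simps simp: lookup_r_word_Cons braid_simps count_list_Nil)
qed (simp add: lookup_r_word_Nil del: r_word.simps)

lemma lookup_r_word_right_Nil: "Poly_Mapping.lookup (r_word D w) (c, []) = (if c = w then 1 else 0)"
proof (induction w arbitrary: c)
  case (Cons i w)
  then show ?case by (cases c) (auto simp del: r_word.simps simp: lookup_r_word_Cons)
qed (simp add: lookup_r_word_Nil del: r_word.simps)

fun ldr_word :: "('i::finite, 'y, 'x) root_data \<Rightarrow> 'i \<Rightarrow> 'i list \<Rightarrow> 'i free_alg" where
  "ldr_word D i [] = 0"
| "ldr_word D i (j # w) = (if i = j then monom_word w else 0) +
     scal (qq powi dot D j i * \<pi> ^ (pari D j * pari D i)) * (var j * ldr_word D i w)"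

fun rdr_word :: "('i::finite, 'y, 'x) root_data \<Rightarrow> 'i \<Rightarrow> 'i list \<Rightarrow> 'i free_alg" where
  "rdr_word D i [] = 0"
| "rdr_word D i (j # w) = var j * rdr_word D i w +
     (if i = j then scal (braid D i (count_list w)) * monom_word w else 0)"

text \<open>\<open>ldr D i\<close> and \<open>rdr D i\<close> are the maps with \<open>r x = \<theta>\<^sub>i \<otimes> ldr x + \<dots>\<close> and
  \<open>r x = rdr x \<otimes> \<theta>\<^sub>i + \<dots>\<close>.\<close>
definition ldr :: "('i::finite, 'y, 'x) root_data \<Rightarrow> 'i \<Rightarrow> 'i free_alg \<Rightarrow> 'i free_alg" where
  "ldr D i = lin scal (ldr_word D i)"

definition rdr :: "('i::finite, 'y, 'x) root_data \<Rightarrow> 'i \<Rightarrow> 'i free_alg \<Rightarrow> 'i free_alg" where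
  "rdr D i = lin scal (rdr_word D i)"

lemma ldr_simps [simp]:
  "ldr D i 0 = 0" "ldr D i (x + y) = ldr D i x + ldr D i y" "ldr D i (scal c * x) = scal c * ldr D i x"
  "ldr D i (x - y) = ldr D i x - ldr D i y"
  by (simp_all add: ldr_def lin_scal_scal additive_add[OF is_additive_lin[OF is_additive_scal]]
      additive_diff[OF is_additive_lin[OF is_additive_scal]] additive_zero[OF is_additive_lin[OF is_additive_scal]])

lemma rdr_simps [simp]:
  "rdr D i 0 = 0" "rdr D i (x + y) = rdr D i x + rdr D i y" "rdr D i (scal c * x) = scal c * rdr D i x"
  by (simp_all add: rdr_def lin_scal_scal additive_add[OF is_additive_lin[OF is_additive_scal]]
      additive_zero[OF is_additive_lin[OF is_additive_scal]])

lemma ldr_monom [simp]: "ldr D i (monom_word w) = ldr_word D i w"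
  by (simp add: ldr_def)

lemma rdr_monom [simp]: "rdr D i (monom_word w) = rdr_word D i w"
  by (simp add: rdr_def)

lemma lookup_var_mult:
  "Poly_Mapping.lookup (var j * x) d = (if d \<noteq> [] \<and> hd d = j then Poly_Mapping.lookup x (tl d) else 0)"
proof (induction x rule: free_alg_induct)
  case (monom c w)
  have "var j * (scal c * monom_word w) = scal c * monom_word (j # w)"
    by (metis monom_word_Cons mult.assoc scal_commute)
  then show ?case by (cases d) (auto simp: lookup_monom_word)
qed (simp_all add: distrib_left lookup_add)

lemma lookup_ldr_word: "Poly_Mapping.lookup (ldr_word D i w) d = Poly_Mapping.lookup (r_word D w) ([i], d)"
proof (induction w arbitrary: d)
  case (Cons j w)
  have "braid D j (count_list [i]) = qq powi dot D j i * \<pi> ^ (pari D j * pari D i)"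
    unfolding count_list_Cons count_list_Nil braid_simps by simp
  then show ?case
    by (auto simp: lookup_r_word_Cons lookup_add lookup_monom_word lookup_r_word_left_Nil Cons.IH
        lookup_var_mult mult.commute simp del: r_word.simps)
qed (simp add: lookup_r_word_Nil del: r_word.simps)
 
lemma lookup_rdr_word: "Poly_Mapping.lookup (rdr_word D i w) c = Poly_Mapping.lookup (r_word D w) (c, [i])"
proof (induction w arbitrary: c)
  case (Cons j w)
  then show ?case
    by (auto simp: lookup_r_word_Cons lookup_add lookup_monom_word lookup_r_word_right_Nil
        lookup_var_mult simp del: r_word.simps)
qed (simp add: lookup_r_word_Nil del: r_word.simps)

section \<open>The bilinear form\<close>

lemma tensor_form_monom:
  "tensor_form F s (tensor (monom_word u) (monom_word v)) = (\<Sum>p\<in>Poly_Mapping.keys s.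
     Poly_Mapping.lookup s p * F (monom_word (fst p)) (monom_word u) * F (monom_word (snd p)) (monom_word v))"
  by (simp add: tensor_monom tensor_form_def case_prod_unfold)

lemma tensor_form_monom_left:
  "tensor_form F (tensor (monom_word u) (monom_word v)) s = (\<Sum>p\<in>Poly_Mapping.keys s.
     Poly_Mapping.lookup s p * F (monom_word u) (monom_word (fst p)) * F (monom_word v) (monom_word (snd p)))"
  by (simp add: tensor_monom tensor_form_def case_prod_unfold)

lemma r_map_monom: "r_map D (monom_word w) = r_word D w"
proof -
  have "Poly_Mapping.map (\<lambda>c. c) s = s" for s :: "('i list \<times> 'i list) \<Rightarrow>\<^sub>0 qpi"
    by (rule poly_mapping_eqI) (simp add: Poly_Mapping.map.rep_eq when_def)
  then show ?thesis by (simp add: r_map_def lookup_monom_word)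
qed

locale supergroup =
  fixes D :: "('i::finite, 'y::ab_group_add, 'x::ab_group_add) root_data"
    and Q :: "('i, 'y, 'f::ring_1, 'u::ring_1) quantum_data"
  assumes rd: "root_datum D" and qs: "quantum_supergroup D Q"
begin

lemma cf: "canonical_form D (form Q)"
  using qs by (simp add: quantum_supergroup_def)

definition beta :: "'i \<Rightarrow> qpi" where
  "beta i = inverse (1 - pi_of D i * q_of D i powi (- 2))"

abbreviation p :: "'i \<Rightarrow> nat" where "p \<equiv> pari D"

lemma dot_sym: "dot D i j = dot D j i"
  using rd by (simp add: root_datum_def super_cartan_datum_def)

lemma dd_pos: "dd D i > 0" and dot_self: "dot D i i = 2 * dd D i"
proof -
  have "even (dot D i i)" "dot D i i > 0"
    using rd by (auto simp: root_datum_def super_cartan_datum_def)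
  then show "dd D i > 0" "dot D i i = 2 * dd D i" by (auto simp: dd_def elim!: evenE)
qed

lemma form_simps [simp]:
  "form Q 0 y = 0" "form Q x 0 = 0"
  "form Q (x + x') y = form Q x y + form Q x' y" "form Q x (y + y') = form Q x y + form Q x y'"
  "form Q (scal c * x) y = c * form Q x y" "form Q x (scal c * y) = c * form Q x y"
  "form Q (x - x') y = form Q x y - form Q x' y" "form Q x (y - y') = form Q x y - form Q x y'"
  using cf additive_zero[of "form Q x"] additive_zero[of "\<lambda>x. form Q x y"]
    additive_diff[of "form Q x"] additive_diff[of "\<lambda>x. form Q x y"]
  by (auto simp: canonical_form_def additive_add is_additive_def)

lemma form_sum:
  "form Q x (sum g A) = (\<Sum>a\<in>A. form Q x (g a))" "form Q (sum g A) x = (\<Sum>a\<in>A. form Q (g a) x)"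
  by (induction A rule: infinite_finite_induct) simp_all

abbreviation bl :: "'i list \<Rightarrow> 'i list \<Rightarrow> qpi" where
  "bl u v \<equiv> form Q (monom_word u) (monom_word v)"

lemma bl_append_right: "bl w (u @ v) = (\<Sum>t\<in>Poly_Mapping.keys (r_word D w).
    Poly_Mapping.lookup (r_word D w) t * bl (fst t) u * bl (snd t) v)"
  using cf by (simp add: canonical_form_def monom_word_append r_map_monom tensor_form_monom)

lemma bl_append_left: "bl (u @ v) w = (\<Sum>t\<in>Poly_Mapping.keys (r_word D w).
    Poly_Mapping.lookup (r_word D w) t * bl u (fst t) * bl v (snd t))"
  using cf by (simp add: canonical_form_def monom_word_append r_map_monom tensor_form_monom_left)

lemma keys_r_word_single: "Poly_Mapping.keys (r_word D [i]) = {([i], []), ([], [i])}"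
  "Poly_Mapping.lookup (r_word D [i]) ([i], []) = 1" "Poly_Mapping.lookup (r_word D [i]) ([], [i]) = 1"
  by (auto simp: in_keys_iff lookup_r_word_Cons lookup_r_word_Nil braid_simps count_list_Nil tl_Nil
      neq_Nil_conv simp del: r_word.simps split: if_splits)

lemma keys_r_word_Nil: "Poly_Mapping.keys (r_word D []) = {([], [])}"
  "Poly_Mapping.lookup (r_word D []) ([], []) = 1"
  by (auto simp: in_keys_iff lookup_r_word_Nil simp del: r_word.simps split: if_splits)

lemma bl_Nil_Nil: "bl [] [] = 1"
  using cf by (simp add: canonical_form_def)

text \<open>As \<open>1 = 1 \<cdot> 1\<close> and \<open>r \<theta>\<^sub>i = \<theta>\<^sub>i \<otimes> 1 + 1 \<otimes> \<theta>\<^sub>i\<close>, the value \<open>(1, \<theta>\<^sub>i)\<close> is twice itself.\<close>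
lemma bl_Nil_single: "bl [] [i] = 0"
  using bl_append_left[of "[]" "[]" "[i]"] bl_Nil_Nil
  by (simp add: keys_r_word_single del: r_word.simps)

lemma bl_single_Nil: "bl [i] [] = 0"
  using bl_append_right[of "[i]" "[]" "[]"] bl_Nil_Nil
  by (simp add: keys_r_word_single del: r_word.simps)

lemma bl_Nil: "w \<noteq> [] \<Longrightarrow> bl [] w = 0" "w \<noteq> [] \<Longrightarrow> bl w [] = 0"
proof (induction w)
  case (Cons i w)
  show "bl [] (i # w) = 0"
    using bl_append_right[of "[]" "[i]" w] by (simp add: keys_r_word_Nil bl_Nil_single del: r_word.simps monom_word_Nil)
  show "bl (i # w) [] = 0"
    using bl_append_left[of "[i]" w "[]"] by (simp add: keys_r_word_Nil bl_single_Nil del: r_word.simps monom_word_Nil)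
qed auto

lemma bl_single: "bl [i] [j] = (if i = j then beta i else 0)"
  using cf by (simp add: canonical_form_def beta_def flip: var_def)

lemma bl_single_left: "bl [i] v = (if v = [i] then beta i else 0)"
proof (cases v rule: remdups_adj.cases)
  case (3 j k v')
  then show ?thesis
    using bl_append_right[of "[i]" "[j]" "k # v'"]
    by (simp add: keys_r_word_single bl_Nil del: r_word.simps monom_word_Nil)
qed (use bl_single_Nil bl_single in auto)

lemma bl_single_right: "bl v [i] = (if v = [i] then beta i else 0)"
proof (cases v rule: remdups_adj.cases)
  case (3 j k v')
  then show ?thesis
    using bl_append_left[of "[j]" "k # v'" "[i]"]
    by (simp add: keys_r_word_single bl_Nil del: r_word.simps monom_word_Nil)
qed (use bl_Nil_single bl_single in auto)

text \<open>The two rules that relate the form to \<open>r\<close> are mirror images of each other, so peeling off the first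
  letter of \<open>u\<close> on either side gives the same recursion.\<close>
lemma bl_sym: "bl u v = bl v u"
proof (induction u arbitrary: v)
  case Nil
  then show ?case by (cases "v = []") (simp_all add: bl_Nil del: monom_word_Nil)
next
  case (Cons i u)
  then show ?case
    using bl_append_left[of "[i]" u v] bl_append_right[of v "[i]" u]
    by (simp add: bl_single_left bl_single_right)
qed

lemma form_sym: "form Q x y = form Q y x"
proof (induction x rule: free_alg_induct)
  case (monom c w)
  have "form Q (monom_word w) y = form Q y (monom_word w)"
    by (induction y rule: free_alg_induct) (simp_all add: bl_sym)
  then show ?case by simp
qed simp_all

lemma bl_weight: "count_list u \<noteq> count_list v \<Longrightarrow> bl u v = 0"
proof (induction u arbitrary: v)
  case Nil
  then have "v \<noteq> []" by auto
  then show ?case by (rule bl_Nil)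
next
  case (Cons i u)
  have "Poly_Mapping.lookup (r_word D v) t * bl [i] (fst t) * bl u (snd t) = 0"
    if "t \<in> Poly_Mapping.keys (r_word D v)" for t
  proof (rule ccontr)
    assume n: "\<not> ?thesis"
    then have "bl u (snd t) \<noteq> 0" "bl [i] (fst t) \<noteq> 0" by auto
    then have "fst t = [i]" "count_list u = count_list (snd t)"
      using Cons.IH[of "snd t"] by (auto simp: bl_single_left split: if_splits)
    moreover have "count_list v k = count_list (fst t) k + count_list (snd t) k" for k
      using r_word_weight[of D v "fst t" "snd t"] that by (simp add: in_keys_iff)
    ultimately have "count_list v = count_list (i # u)" by (auto simp: fun_eq_iff)
    then show False using Cons.prems by simp
  qed
  then show ?case using bl_append_left[of "[i]" u v] by simp
qed

lemma form_weight: "x \<in> free_wt \<mu> \<Longrightarrow> y \<in> free_wt \<nu> \<Longrightarrow> \<mu> \<noteq> \<nu> \<Longrightarrow> form Q x y = 0"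
proof (induction x rule: free_wt_induct)
  case (monom c w)
  from \<open>y \<in> free_wt \<nu>\<close> have "form Q (monom_word w) y = 0"
    by (induction rule: free_wt_induct) (use monom in \<open>auto simp: bl_weight\<close>)
  then show ?case by simp
qed simp_all

lemma form_monom_lookup:
  "form Q (monom_word u) y = (\<Sum>w\<in>Poly_Mapping.keys y. Poly_Mapping.lookup y w * bl u w)"
  by (subst free_alg_expand[of y]) (simp add: form_sum)

text \<open>The only word that pairs nontrivially with \<open>\<theta>\<^sub>i\<close> is \<open>\<theta>\<^sub>i\<close> itself, so that in
  \<open>(\<theta>\<^sub>i x, y) = (\<theta>\<^sub>i \<otimes> x, r y)\<close> only the part \<open>\<theta>\<^sub>i \<otimes> ldr y\<close> of \<open>r y\<close> contributes.\<close>
lemma form_var_left: "form Q (var i * x) y = beta i * form Q x (ldr D i y)"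
proof -
  have w: "bl (i # u) v = beta i * form Q (monom_word u) (ldr_word D i v)" for u v
  proof -
    let ?r = "r_word D v"
    have "bl (i # u) v = (\<Sum>t\<in>Poly_Mapping.keys ?r.
        Poly_Mapping.lookup ?r t * bl [i] (fst t) * bl u (snd t))"
      using bl_append_left[of "[i]" u v] by simp
    also have "\<dots> = (\<Sum>t\<in>(\<lambda>d. ([i], d)) ` Poly_Mapping.keys (ldr_word D i v).
        Poly_Mapping.lookup ?r t * bl [i] (fst t) * bl u (snd t))"
    proof (rule sum.mono_neutral_right)
      show "(\<lambda>d. ([i], d)) ` Poly_Mapping.keys (ldr_word D i v) \<subseteq> Poly_Mapping.keys ?r"
        by (auto simp: in_keys_iff lookup_ldr_word simp del: r_word.simps)
      have "t \<in> (\<lambda>d. ([i], d)) ` Poly_Mapping.keys (ldr_word D i v)"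
        if "t \<in> Poly_Mapping.keys ?r" "fst t = [i]" for t
        using that by (cases t) (simp add: in_keys_iff lookup_ldr_word image_iff del: r_word.simps)
      then show "\<forall>t\<in>Poly_Mapping.keys ?r - (\<lambda>d. ([i], d)) ` Poly_Mapping.keys (ldr_word D i v).
          Poly_Mapping.lookup ?r t * bl [i] (fst t) * bl u (snd t) = 0"
        by (auto simp: bl_single_left)
    qed simp
    also have "\<dots> = beta i * form Q (monom_word u) (ldr_word D i v)"
      by (simp add: sum.reindex inj_on_def form_monom_lookup[of _ "ldr_word D i v"] lookup_ldr_word
          bl_single_left sum_distrib_left mult.assoc mult.left_commute[of "beta i"] del: r_word.simps)

    finally show ?thesis .
  qed
  show ?thesis
  proof (induction x rule: free_alg_induct)
    case (monom c u)
    have "form Q (monom_word (i # u)) y = beta i * form Q (monom_word u) (ldr D i y)"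
      by (induction y rule: free_alg_induct) (simp_all add: w algebra_simps)
    moreover have "var i * (scal c * monom_word u) = scal c * monom_word (i # u)"
      by (metis monom_word_Cons mult.assoc scal_commute)
    ultimately show ?case by (simp add: algebra_simps)
  qed (simp_all add: algebra_simps)
qed

lemma form_var_right: "form Q (x * var i) y = beta i * form Q x (rdr D i y)"
proof -
  have w: "bl (u @ [i]) v = beta i * form Q (monom_word u) (rdr_word D i v)" for u v
  proof -
    let ?r = "r_word D v"
    have "bl (u @ [i]) v = (\<Sum>t\<in>Poly_Mapping.keys ?r.
        Poly_Mapping.lookup ?r t * bl u (fst t) * bl [i] (snd t))"
      using bl_append_left[of u "[i]" v] by simp
    also have "\<dots> = (\<Sum>t\<in>(\<lambda>d. (d, [i])) ` Poly_Mapping.keys (rdr_word D i v).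
        Poly_Mapping.lookup ?r t * bl u (fst t) * bl [i] (snd t))"
    proof (rule sum.mono_neutral_right)
      show "(\<lambda>d. (d, [i])) ` Poly_Mapping.keys (rdr_word D i v) \<subseteq> Poly_Mapping.keys ?r"
        by (auto simp: in_keys_iff lookup_rdr_word simp del: r_word.simps)
      have "t \<in> (\<lambda>d. (d, [i])) ` Poly_Mapping.keys (rdr_word D i v)"
        if "t \<in> Poly_Mapping.keys ?r" "snd t = [i]" for t
        using that by (cases t) (simp add: in_keys_iff lookup_rdr_word image_iff del: r_word.simps)
      then show "\<forall>t\<in>Poly_Mapping.keys ?r - (\<lambda>d. (d, [i])) ` Poly_Mapping.keys (rdr_word D i v).
          Poly_Mapping.lookup ?r t * bl u (fst t) * bl [i] (snd t) = 0"
        by (auto simp: bl_single_left)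
    qed simp
    also have "\<dots> = beta i * form Q (monom_word u) (rdr_word D i v)"
      by (simp add: sum.reindex inj_on_def form_monom_lookup[of _ "rdr_word D i v"] lookup_rdr_word
          bl_single_left sum_distrib_left mult.assoc mult.left_commute[of "beta i"] del: r_word.simps)
        (simp add: ac_simps)
    finally show ?thesis .
  qed
  show ?thesis
  proof (induction x rule: free_alg_induct)
    case (monom c u)
    have "form Q (monom_word (u @ [i])) y = beta i * form Q (monom_word u) (rdr D i y)"
      by (induction y rule: free_alg_induct) (simp_all add: w algebra_simps)
    moreover have "scal c * monom_word u * var i = scal c * monom_word (u @ [i])"
      by (simp add: monom_word_append mult.assoc var_def)
    ultimately show ?case by (simp add: algebra_simps)
  qed (simp_all add: algebra_simps)
qed

lemma ldr_word_weight:
  assumes "d \<in> Poly_Mapping.keys (ldr_word D i w)"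
  shows "count_list w = inc i (count_list d)"
proof -
  have "Poly_Mapping.lookup (r_word D w) ([i], d) \<noteq> 0"
    using assms by (simp add: in_keys_iff lookup_ldr_word del: r_word.simps)
  from r_word_weight[OF this] show ?thesis by (auto simp: fun_eq_iff inc_def)
qed

lemma rdr_word_weight:
  assumes "d \<in> Poly_Mapping.keys (rdr_word D i w)"
  shows "count_list w = inc i (count_list d)"
proof -
  have "Poly_Mapping.lookup (r_word D w) (d, [i]) \<noteq> 0"
    using assms by (simp add: in_keys_iff lookup_rdr_word del: r_word.simps)
  from r_word_weight[OF this] show ?thesis by (auto simp: fun_eq_iff inc_def)
qed

lemma ldr_word_free_wt: "count_list w = inc i \<nu> \<Longrightarrow> ldr_word D i w \<in> free_wt \<nu>"
  using ldr_word_weight by (force simp: free_wt_def inc_inject)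

lemma rdr_word_free_wt: "count_list w = inc i \<nu> \<Longrightarrow> rdr_word D i w \<in> free_wt \<nu>"
  using rdr_word_weight by (force simp: free_wt_def inc_inject)

lemma ldr_free_wt: "x \<in> free_wt (inc i \<nu>) \<Longrightarrow> ldr D i x \<in> free_wt \<nu>"
  by (induction rule: free_wt_induct) (simp_all add: ldr_word_free_wt)

lemma rdr_free_wt: "x \<in> free_wt (inc i \<nu>) \<Longrightarrow> rdr D i x \<in> free_wt \<nu>"
  by (induction rule: free_wt_induct) (simp_all add: rdr_word_free_wt)

lemma ldr_word_eq_0: "count_list w i = 0 \<Longrightarrow> ldr_word D i w = 0"
  using ldr_word_weight[of _ i w] by (force simp: inc_def simp flip: keys_eq_empty)

lemma rdr_word_eq_0: "count_list w i = 0 \<Longrightarrow> rdr_word D i w = 0"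
  using rdr_word_weight[of _ i w] by (force simp: inc_def simp flip: keys_eq_empty)

lemma ldr_eq_0: "x \<in> free_wt \<nu> \<Longrightarrow> \<nu> i = 0 \<Longrightarrow> ldr D i x = 0"
  by (induction rule: free_wt_induct) (auto simp: ldr_word_eq_0)

lemma rdr_eq_0: "x \<in> free_wt \<nu> \<Longrightarrow> \<nu> i = 0 \<Longrightarrow> rdr D i x = 0"
  by (induction rule: free_wt_induct) (auto simp: rdr_word_eq_0)

lemma radical_iff: "x \<in> radical (form Q) \<longleftrightarrow> (\<forall>w. form Q (monom_word w) x = 0)"
proof -
  have "form Q x y = 0" if "\<And>w. form Q (monom_word w) x = 0" for y
    by (induction y rule: free_alg_induct) (use that in \<open>simp_all add: form_sym[of x]\<close>)
  then show ?thesis by (auto simp: radical_def form_sym)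
qed

text \<open>A criterion for relations of the half algebra, used for the quantum Serre element: pairing \<open>x\<close> with
  a nonempty word strips off its first letter and applies a derivation to \<open>x\<close>.\<close>
lemma radical_if_ldr_eq_0:
  assumes "\<And>i. ldr D i x = 0" "Poly_Mapping.lookup x [] = 0"
  shows "x \<in> radical (form Q)"
  unfolding radical_iff
proof
  fix w
  show "form Q (monom_word w) x = 0"
  proof (cases w)
    case Nil
    have "bl [] v = 0" if "v \<in> Poly_Mapping.keys x" for v
      using that assms(2) by (intro bl_Nil) (auto simp: in_keys_iff)
    then show ?thesis unfolding Nil by (simp add: form_monom_lookup[of _ x] del: monom_word_Nil)
  next
    case (Cons i u)
    then show ?thesis by (simp add: monom_word_Cons form_var_left assms)
  qed
qed

section \<open>Bases of the half algebra\<close>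

lemma f_proj_hom: "is_ring_hom (f_proj Q)"
  using qs by (simp add: quantum_supergroup_def quotient_map_def)

lemma f_proj_simps [simp]:
  "f_proj Q 0 = 0" "f_proj Q 1 = 1" "f_proj Q (x + y) = f_proj Q x + f_proj Q y"
  "f_proj Q (x * y) = f_proj Q x * f_proj Q y" "f_proj Q (x - y) = f_proj Q x - f_proj Q y"
  "f_proj Q (scal c) = f_scal Q c"
  using f_proj_hom additive_zero[of "f_proj Q"] additive_diff[of "f_proj Q"]
  by (auto simp: is_ring_hom_def is_additive_def f_scal_def)

lemma f_proj_sum: "f_proj Q (sum g A) = (\<Sum>a\<in>A. f_proj Q (g a))"
  by (induction A rule: infinite_finite_induct) simp_all

lemma f_proj_eq_0_iff: "f_proj Q x = 0 \<longleftrightarrow> x \<in> radical (form Q)"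
  using qs by (auto simp: quantum_supergroup_def quotient_map_def)

lemma surj_f_proj: "surj (f_proj Q)"
  using qs by (simp add: quantum_supergroup_def quotient_map_def)

text \<open>By the symmetry of the form its left radical is also its right radical, so the choice of
  representatives in either argument does not matter.\<close>
lemma f_form_eq: "f_form Q (f_proj Q x) (f_proj Q y) = form Q x y"
proof -
  have inv: "inv (f_proj Q) (f_proj Q z) - z \<in> radical (form Q)" for z
    using surj_f_inv_f[OF surj_f_proj, of "f_proj Q z"] by (simp flip: f_proj_eq_0_iff)
  have "form Q (inv (f_proj Q) (f_proj Q z)) v = form Q z v" for z v
    using inv[of z] by (auto simp: radical_def)
  then show ?thesis by (simp add: f_form_def) (metis form_sym)
qed

lemma f_scal_simps [simp]:
  "f_scal Q 0 = 0" "f_scal Q 1 = 1" "f_scal Q (a + b) = f_scal Q a + f_scal Q b"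
  "f_scal Q (a * b) = f_scal Q a * f_scal Q b"
  by (simp_all add: scal_mult flip: f_proj_simps)

text \<open>The radical is a graded ideal because different weights are orthogonal.\<close>
lemma f_wt_unique:
  assumes "u \<in> f_wt Q \<mu>" "u \<in> f_wt Q \<nu>" "\<mu> \<noteq> \<nu>"
  shows "u = 0"
proof -
  obtain x y where x: "x \<in> free_wt \<mu>" "u = f_proj Q x" and y: "y \<in> free_wt \<nu>" "u = f_proj Q y"
    using assms by (auto simp: f_wt_def)
  have r: "x - y \<in> radical (form Q)" using x y by (simp flip: f_proj_eq_0_iff)
  have "form Q (monom_word w) x = 0" for w
  proof (cases "count_list w = \<mu>")
    case True
    then have "form Q (monom_word w) y = 0" using form_weight[OF _ y(1)] assms(3) by simp
    then show ?thesis using r by (simp add: radical_iff)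
  next
    case False
    then show ?thesis using form_weight[OF _ x(1), of _ "count_list w"] by simp
  qed
  then show ?thesis using x(2) by (simp add: f_proj_eq_0_iff radical_iff)
qed

lemma f_weight_eq: "u \<in> f_wt Q \<nu> \<Longrightarrow> u \<noteq> 0 \<Longrightarrow> f_weight Q u = \<nu>"
  unfolding f_weight_def using f_wt_unique by blast

lemma finite_words: "finite {w :: 'i list. count_list w = \<nu>}"
proof -
  have l: "length w = ht (count_list w)" for w :: "'i list"
    by (induction w) (simp_all only: count_list_Cons count_list_Nil ht_simps list.size)
  have "finite {w :: 'i list. set w \<subseteq> UNIV \<and> length w = ht \<nu>}"
    by (rule finite_lists_length_eq) simp
  then show ?thesis by (rule rev_finite_subset) (auto simp: l)
qed

lemma f_module: "module (\<lambda>c x. f_scal Q c * x)"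
  by standard (simp_all add: algebra_simps)

end

locale supergroup_basis = supergroup D Q
  for D :: "('i::finite, 'y::ab_group_add, 'x::ab_group_add) root_data"
    and Q :: "('i, 'y, 'f::ring_1, 'u::ring_1) quantum_data" +
  fixes B :: "'f set" and star :: "'f \<Rightarrow> 'f"
  assumes wb: "weight_basis Q B" and db: "dual_basis Q B star"
begin

sublocale fm: module "\<lambda>c x. f_scal Q c * x"
  by (rule f_module)

abbreviation Bw :: "('i \<Rightarrow> nat) \<Rightarrow> 'f set" where "Bw \<nu> \<equiv> B \<inter> f_wt Q \<nu>"

lemma star_f_wt: "b \<in> Bw \<nu> \<Longrightarrow> star b \<in> f_wt Q \<nu>"
  and dual: "b \<in> Bw \<nu> \<Longrightarrow> b' \<in> Bw \<nu> \<Longrightarrow> f_form Q b' (star b) = (if b' = b then 1 else 0)"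
  using db by (auto simp: dual_basis_def)

definition rep :: "('i \<Rightarrow> nat) \<Rightarrow> 'f \<Rightarrow> 'i free_alg" where
  "rep \<nu> u = (SOME x. x \<in> free_wt \<nu> \<and> f_proj Q x = u)"

lemma rep: "u \<in> f_wt Q \<nu> \<Longrightarrow> rep \<nu> u \<in> free_wt \<nu>" "u \<in> f_wt Q \<nu> \<Longrightarrow> f_proj Q (rep \<nu> u) = u"
  unfolding rep_def by (rule someI2_ex; auto simp: f_wt_def)+

lemma form_rep_dual:
  "b \<in> Bw \<nu> \<Longrightarrow> b' \<in> Bw \<nu> \<Longrightarrow> form Q (rep \<nu> b') (rep \<nu> (star b)) = (if b' = b then 1 else 0)"
  using dual[of b \<nu> b'] rep[of b' \<nu>] rep[OF star_f_wt, of b \<nu>]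
    f_form_eq[of "rep \<nu> b'" "rep \<nu> (star b)"] by simp

text \<open>Pairing an expansion in the basis with \<open>b\<^sup>*\<close> shows that its coefficients are the values of the form.\<close>
lemma f_wt_expand_aux:
  assumes x: "x \<in> free_wt \<nu>"
  obtains A where "finite A" "A \<subseteq> Bw \<nu>"
    "f_proj Q x = (\<Sum>b\<in>A. f_scal Q (form Q x (rep \<nu> (star b))) * b)"
    "\<forall>b\<in>Bw \<nu> - A. form Q x (rep \<nu> (star b)) = 0"
proof -
  have "f_proj Q x \<in> fm.span (Bw \<nu>)"
    using wb x by (auto simp: weight_basis_def f_wt_def)
  then obtain A c where A: "finite A" "A \<subseteq> Bw \<nu>" and c: "f_proj Q x = (\<Sum>b\<in>A. f_scal Q (c b) * b)"
    by (auto simp: fm.span_explicit)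
  have p: "f_proj Q x = f_proj Q (\<Sum>b\<in>A. scal (c b) * rep \<nu> b)"
    unfolding c f_proj_sum using A rep(2) by (intro sum.cong) auto
  have e: "form Q x (rep \<nu> (star b)) = (if b \<in> A then c b else 0)" if b: "b \<in> Bw \<nu>" for b
  proof -
    have "form Q x (rep \<nu> (star b)) = form Q (\<Sum>b\<in>A. scal (c b) * rep \<nu> b) (rep \<nu> (star b))"
      using p f_form_eq by metis
    also have "\<dots> = (\<Sum>b'\<in>A. if b' = b then c b else 0)"
      unfolding form_sum
    proof (intro sum.cong refl)
      fix b' assume "b' \<in> A"
      then have "b' \<in> Bw \<nu>" using A by blast
      from form_rep_dual[OF b this]
      show "form Q (scal (c b') * rep \<nu> b') (rep \<nu> (star b)) = (if b' = b then c b else 0)" by simp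
    qed
    finally show ?thesis using A by simp
  qed
  show ?thesis
  proof (rule that[OF A])
    show "f_proj Q x = (\<Sum>b\<in>A. f_scal Q (form Q x (rep \<nu> (star b))) * b)"
      unfolding c
    proof (intro sum.cong refl)
      fix b assume b: "b \<in> A"
      then have "b \<in> Bw \<nu>" using A by blast
      from e[OF this] b
      show "f_scal Q (c b) * b = f_scal Q (form Q x (rep \<nu> (star b))) * b" by simp
    qed
    show "\<forall>b\<in>Bw \<nu> - A. form Q x (rep \<nu> (star b)) = 0"
      using e by simp
  qed
qed

text \<open>There are finitely many words of weight \<open>\<nu>\<close>, and each of them involves finitely many basis
  vectors.  A basis vector involved in none of them would be orthogonal to its own dual vector.\<close>
lemma finite_Bw: "finite (Bw \<nu>)"
proof -
  let ?W = "{w :: 'i list. count_list w = \<nu>}"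
  let ?N = "\<lambda>w. {b \<in> Bw \<nu>. form Q (monom_word w) (rep \<nu> (star b)) \<noteq> 0}"
  have "finite (?N w)" if w: "w \<in> ?W" for w
  proof -
    have "monom_word w \<in> free_wt \<nu>" using w by simp
    then obtain A where A: "finite A"
      "\<forall>b\<in>Bw \<nu> - A. form Q (monom_word w) (rep \<nu> (star b)) = 0"
      by (rule f_wt_expand_aux)
    have "?N w \<subseteq> A" using A(2) by blast
    then show ?thesis using A(1) by (rule finite_subset)
  qed
  moreover have "Bw \<nu> \<subseteq> (\<Union>w\<in>?W. ?N w)"
  proof
    fix b
    assume b: "b \<in> Bw \<nu>"
    have "\<exists>w\<in>?W. form Q (monom_word w) (rep \<nu> (star b)) \<noteq> 0"
    proof (rule ccontr)
      assume n: "\<not> ?thesis"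
      have "form Q x (rep \<nu> (star b)) = 0" if "x \<in> free_wt \<nu>" for x
        using that
      proof (induction rule: free_wt_induct)
        case (monom c w)
        then have "form Q (monom_word w) (rep \<nu> (star b)) = 0" using n by blast
        then show ?case by simp
      qed simp_all
      then have "form Q (rep \<nu> b) (rep \<nu> (star b)) = 0" using rep(1)[of b \<nu>] b by blast
      then show False using form_rep_dual[OF b b] by simp
    qed
    then show "b \<in> (\<Union>w\<in>?W. ?N w)" using b by blast
  qed
  ultimately show ?thesis
    by (intro finite_subset[of "Bw \<nu>" "\<Union>w\<in>?W. ?N w"] finite_UN_I finite_words) auto
qed

lemma f_wt_expand:
  assumes x: "x \<in> free_wt \<nu>"
  shows "f_proj Q x = (\<Sum>b\<in>Bw \<nu>. f_scal Q (form Q x (rep \<nu> (star b))) * b)"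
proof -
  obtain A where "finite A" and A: "A \<subseteq> Bw \<nu>"
    and e: "f_proj Q x = (\<Sum>b\<in>A. f_scal Q (form Q x (rep \<nu> (star b))) * b)"
    and z: "\<forall>b\<in>Bw \<nu> - A. form Q x (rep \<nu> (star b)) = 0"
    by (rule f_wt_expand_aux[OF x])
  have "(\<Sum>b\<in>A. f_scal Q (form Q x (rep \<nu> (star b))) * b) =
      (\<Sum>b\<in>Bw \<nu>. f_scal Q (form Q x (rep \<nu> (star b))) * b)"
    by (rule sum.mono_neutral_left[OF finite_Bw A]) (simp add: z)
  then show ?thesis using e by (rule trans[rotated])
qed

lemma free_wt_expand_radical:
  assumes x: "x \<in> free_wt \<nu>"
  shows "x - (\<Sum>b\<in>Bw \<nu>. scal (form Q x (rep \<nu> (star b))) * rep \<nu> b) \<in> radical (form Q)"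
proof -
  have "(\<Sum>b\<in>Bw \<nu>. f_scal Q (form Q x (rep \<nu> (star b))) * f_proj Q (rep \<nu> b)) =
      (\<Sum>b\<in>Bw \<nu>. f_scal Q (form Q x (rep \<nu> (star b))) * b)"
    by (intro sum.cong) (simp_all add: rep)
  then show ?thesis using f_wt_expand[OF x]
    by (simp add: f_proj_sum flip: f_proj_eq_0_iff)
qed

text \<open>The difference is orthogonal to all vectors of weight \<open>\<nu>\<close>, as one sees by expanding them in the
  basis, and to all other weights in any case.\<close>
lemma free_wt_dual_expand_radical:
  assumes y: "y \<in> free_wt \<nu>"
  shows "y - (\<Sum>b\<in>Bw \<nu>. scal (form Q (rep \<nu> b) y) * rep \<nu> (star b)) \<in> radical (form Q)" (is "?z \<in> _")
  unfolding radical_iff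
proof
  fix w
  have z: "?z \<in> free_wt \<nu>" using y rep(1) star_f_wt by (auto intro!: free_wt_diff free_wt_sum)
  show "form Q (monom_word w) ?z = 0"
  proof (cases "count_list w = \<nu>")
    case True
    let ?x = "monom_word w"
    have r: "?x - (\<Sum>b\<in>Bw \<nu>. scal (form Q ?x (rep \<nu> (star b))) * rep \<nu> b) \<in> radical (form Q)"
      by (rule free_wt_expand_radical) (simp add: True)
    have "form Q ?x y = form Q (\<Sum>b\<in>Bw \<nu>. scal (form Q ?x (rep \<nu> (star b))) * rep \<nu> b) y"
      using r[unfolded radical_def, simplified mem_Collect_eq, THEN spec, of y]
      by (simp only: form_simps right_minus_eq)
    then show ?thesis by (simp add: form_sum mult.commute)
  next
    case False
    then show ?thesis using form_weight[OF _ z, of _ "count_list w"] by simp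
  qed
qed

text \<open>The vectors of \<open>B\<close> that are homogeneous already span, so by independence there are no others.\<close>
lemma B_eq_Union: "B = (\<Union>\<nu>. Bw \<nu>)"
proof
  let ?B = "\<Union>\<nu>. Bw \<nu>"
  have "f_proj Q x \<in> fm.span ?B" for x
  proof (induction x rule: free_alg_induct)
    case (monom c w)
    have "f_proj Q (monom_word w) \<in> fm.span (Bw (count_list w))"
      using wb by (auto simp: weight_basis_def f_wt_def)
    also have "\<dots> \<subseteq> fm.span ?B" by (rule fm.span_mono) auto
    finally show ?case by (simp add: fm.span_scale)
  qed (simp_all add: fm.span_zero fm.span_add)
  then have span: "u \<in> fm.span ?B" for u
    using surjE[OF surj_f_proj, of u] by auto
  show "B \<subseteq> ?B"
  proof
    fix b assume b: "b \<in> B"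
    show "b \<in> ?B"
    proof (rule ccontr)
      assume "b \<notin> ?B"
      then have "?B \<subseteq> B - {b}" by auto
      then have "b \<in> fm.span (B - {b})" using span fm.span_mono by blast
      then obtain A c where A: "finite A" "A \<subseteq> B - {b}" and c: "b = (\<Sum>a\<in>A. f_scal Q (c a) * a)"
        by (auto simp: fm.span_explicit)
      \<comment> \<open>Over a ring that is not a field, dependence has to be exhibited by an explicit relation.\<close>
      let ?c = "\<lambda>a. if a = b then - 1 else c a"
      have "b \<notin> A" using A by blast
      then have "(\<Sum>a\<in>A. f_scal Q (?c a) * a) = (\<Sum>a\<in>A. f_scal Q (c a) * a)"
        by (intro sum.cong) auto
      moreover have "f_scal Q (- 1) * b = - b"
        using fm.scale_minus_left[of 1 b] by simp
      ultimately have "(\<Sum>a\<in>insert b A. f_scal Q (?c a) * a) = 0"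
        using A(1) \<open>b \<notin> A\<close> c by simp
      moreover have "fm.independent B" using wb by (simp add: weight_basis_def)
      ultimately have "?c b = 0"
        using A b by (intro fm.independentD[of B "insert b A" ?c b]) auto
      then show False by simp
    qed
  qed
qed auto

lemma B_nonzero: "b \<in> Bw \<nu> \<Longrightarrow> b \<noteq> 0"
  using dual[of b \<nu> b] f_form_eq[of 0 "rep \<nu> (star b)"] rep(2)[OF star_f_wt, of b \<nu>] by auto

lemma f_weight_B: "b \<in> Bw \<nu> \<Longrightarrow> f_weight Q b = \<nu>"
  using B_nonzero f_weight_eq by blast

end

section \<open>Relations in the quantum supergroup\<close>

lemma int_mult_minus: "int_mult (- n) x = - int_mult n x"
  by (simp add: int_mult_def)

lemma additive_int_mult: "is_additive g \<Longrightarrow> g (int_mult n x) = n * (g x :: int)"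
  by (cases "n \<ge> 0") (simp_all add: int_mult_def additive_diff additive_minus additive_sum)

lemma pari_cases: "pari D i = 0 \<or> pari D i = 1"
  by (simp add: pari_def)

context supergroup
begin

lemma U_proj_hom: "is_ring_hom (U_proj Q)"
  using qs by (simp add: quantum_supergroup_def quotient_map_def)

lemma surj_U_proj: "surj (U_proj Q)"
  using qs by (simp add: quantum_supergroup_def quotient_map_def)

lemma U_proj_simps [simp]:
  "U_proj Q 0 = 0" "U_proj Q 1 = 1" "U_proj Q (x + y) = U_proj Q x + U_proj Q y"
  "U_proj Q (x * y) = U_proj Q x * U_proj Q y" "U_proj Q (x - y) = U_proj Q x - U_proj Q y"
  "U_proj Q (- x) = - U_proj Q x" "U_proj Q (scal c) = U_scal Q c"
  using U_proj_hom additive_zero[of "U_proj Q"] additive_diff[of "U_proj Q"] additive_minus[of "U_proj Q"]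
  by (auto simp: is_ring_hom_def is_additive_def U_scal_def)

lemma U_scal_simps:
  "U_scal Q 0 = 0" "U_scal Q 1 = 1" "U_scal Q (a + b) = U_scal Q a + U_scal Q b"
  "U_scal Q (a * b) = U_scal Q a * U_scal Q b" "U_scal Q (- a) = - U_scal Q a"
  "U_scal Q (a - b) = U_scal Q a - U_scal Q b"
  by (simp_all add: scal_mult flip: U_proj_simps)

lemma U_scal_commute: "U_scal Q c * u = u * U_scal Q c"
  using surjE[OF surj_U_proj, of u] by (metis scal_commute U_proj_simps(4,7))

definition us :: "qpi \<Rightarrow> 'u \<Rightarrow> 'u" (infixr \<open>\<bullet>\<close> 75) where
  "c \<bullet> u = U_scal Q c * u"

lemma us_simps [simp]:
  "0 \<bullet> u = 0" "1 \<bullet> u = u" "c \<bullet> 0 = 0" "c \<bullet> d \<bullet> u = (c * d) \<bullet> u" "(- c) \<bullet> u = - (c \<bullet> u)"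
  "(c \<bullet> u) * v = c \<bullet> (u * v)" "u * (c \<bullet> v) = c \<bullet> (u * v)" "c \<bullet> (- u) = - (c \<bullet> u)"
proof -
  show "u * (c \<bullet> v) = c \<bullet> (u * v)"
    by (simp only: us_def mult.assoc[symmetric] U_scal_commute[of c u])
qed (simp_all add: us_def U_scal_simps mult.assoc)

lemma us_add: "c \<bullet> (u + v) = c \<bullet> u + c \<bullet> v"
  and us_diff: "c \<bullet> (u - v) = c \<bullet> u - c \<bullet> v"
  and us_diff_left: "(a - b) \<bullet> u = a \<bullet> u - b \<bullet> u"
  by (simp_all add: us_def distrib_left distrib_right left_diff_distrib right_diff_distrib U_scal_simps)

lemma us_fold [simp]: "U_scal Q c * u = c \<bullet> u"
  by (simp add: us_def)

lemma us_sum: "c \<bullet> sum g A = (\<Sum>a\<in>A. c \<bullet> g a)"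
  by (induction A rule: infinite_finite_induct) (simp_all add: us_add)

abbreviation E :: "'i \<Rightarrow> 'u" where "E i \<equiv> U_proj Q (var (gE i))"
abbreviation F :: "'i \<Rightarrow> 'u" where "F i \<equiv> U_proj Q (var (gF i))"
abbreviation J :: "'y \<Rightarrow> 'u" where "J \<mu> \<equiv> U_proj Q (var (gJ \<mu>))"
abbreviation K :: "'y \<Rightarrow> 'u" where "K \<mu> \<equiv> U_proj Q (var (gK \<mu>))"

definition Jp :: "'i \<Rightarrow> 'u" where "Jp i = U_proj Q (Jt D 1 i)"
definition Jm :: "'i \<Rightarrow> 'u" where "Jm i = U_proj Q (Jt D (- 1) i)"
definition Kp :: "'i \<Rightarrow> 'u" where "Kp i = U_proj Q (Kt D 1 i)"
definition Km :: "'i \<Rightarrow> 'u" where "Km i = U_proj Q (Kt D (- 1) i)"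

definition gam :: "'i \<Rightarrow> qpi" where
  "gam i = inverse (pi_of D i * q_of D i - q_of D i powi (- 1))"

lemma relator: "x \<in> relators D (form Q) \<Longrightarrow> U_proj Q x = 0"
  using qs hull_subset[of "relators D (form Q)" two_sided_ideal]
  by (auto simp: quantum_supergroup_def quotient_map_def)

lemma K_0: "K 0 = 1"
  using relator[OF relators.intros(1)] by simp

lemma K_add: "K \<mu> * K \<mu>' = K (\<mu> + \<mu>')"
  using relator[OF relators.intros(2)] by simp

lemma JK_commute: "J \<mu> * K \<mu>' = K \<mu>' * J \<mu>"
  using relator[OF relators.intros(5)] by simp

lemma K_E: "K \<mu> * E i = qq powi pairing D \<mu> (xmap D i) \<bullet> (E i * K \<mu>)"
  using relator[OF relators.intros(6)] by (simp add: mult.assoc)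

lemma J_E: "J \<mu> * E i = \<pi> powi pairing D \<mu> (xmap D i) \<bullet> (E i * J \<mu>)"
  using relator[OF relators.intros(7)] by (simp add: mult.assoc)

lemma K_F: "K \<mu> * F i = qq powi (- pairing D \<mu> (xmap D i)) \<bullet> (F i * K \<mu>)"
  using relator[OF relators.intros(8)] by (simp add: mult.assoc)

lemma J_F: "J \<mu> * F i = \<pi> powi (- pairing D \<mu> (xmap D i)) \<bullet> (F i * J \<mu>)"
  using relator[OF relators.intros(9)] by (simp add: mult.assoc)

lemma E_F: "E i * F j = \<pi> ^ (p i * p j) \<bullet> (F j * E i) +
    (if i = j then gam i \<bullet> (Jp i * Kp i - Km i) else 0)"
proof -
  have "(if i \<in> odd_part D \<and> j \<in> odd_part D then \<pi> else 1) = \<pi> ^ (p i * p j)"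
    by (simp add: pari_def)
  then show ?thesis
    using relator[OF relators.intros(10), of i j]
    by (auto simp: mult.assoc gam_def Jp_def Kp_def Km_def us_diff algebra_simps)
qed

lemma pairing_additive: "is_additive (\<lambda>y. pairing D y x)" "is_additive (pairing D y)"
  using rd by (auto simp: root_datum_def)

lemma pairing_ymap:
  "pairing D (int_mult (s * dd D i) (ymap D i)) x = s * dd D i * pairing D (ymap D i) x"
  using additive_int_mult[OF pairing_additive(1)] by simp

text \<open>The divisibility in the definition of a Cartan datum turns the rounded quotient into a true one.\<close>
lemma dd_pairing: "dd D i * pairing D (ymap D i) (xmap D j) = dot D i j"
proof -
  have "dot D i i dvd 2 * dot D i j"
    using rd by (cases "i = j") (auto simp: root_datum_def super_cartan_datum_def)
  then obtain k where "2 * dot D i j = dot D i i * k" by (elim dvdE)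
  moreover have "pairing D (ymap D i) (xmap D j) = 2 * dot D i j div dot D i i"
    using rd by (simp add: root_datum_def)
  ultimately show ?thesis using dd_pos[of i] by (auto simp: dot_self)
qed

lemma Kp_Km: "Kp i * Km i = 1" "Km i * Kp i = 1"
  by (simp_all add: Kp_def Km_def Kt_def K_add int_mult_minus K_0)

lemma Kp_E: "Kp i * E j = qq powi dot D i j \<bullet> (E j * Kp i)"
  and Jp_E: "Jp i * E j = \<pi> powi dot D i j \<bullet> (E j * Jp i)"
  and Kp_F: "Kp i * F j = qq powi (- dot D i j) \<bullet> (F j * Kp i)"
  and Jp_F: "Jp i * F j = \<pi> powi (- dot D i j) \<bullet> (F j * Jp i)"
  and Km_E: "Km i * E j = qq powi (- dot D i j) \<bullet> (E j * Km i)"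
  using pairing_ymap[of 1 i "xmap D j"] pairing_ymap[of "- 1" i "xmap D j"] dd_pairing[of i j]
  by (simp_all add: Kp_def Jp_def Km_def Kt_def Jt_def K_E J_E K_F J_F JK_commute)

lemma Kp_Kp: "Kp i * Kp j = Kp j * Kp i" and Jp_Kp: "Jp i * Kp j = Kp j * Jp i"
  by (simp_all add: Kp_def Jp_def Kt_def Jt_def K_add JK_commute add.commute)

lemma E_Kp: "E j * Kp i = qq powi (- dot D i j) \<bullet> (Kp i * E j)"
  and E_Km: "E j * Km i = qq powi dot D i j \<bullet> (Km i * E j)"
  and F_Kp: "F j * Kp i = qq powi dot D i j \<bullet> (Kp i * F j)"
  by (simp_all add: Kp_E Km_E Kp_F powi_minus_unit[OF qq_unit])

lemma q_of_powi: "q_of D i powi n = qq powi (dd D i * n)"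
  by (simp add: q_of_def qq_powi flip: of_Qq_powi) (simp add: power_int_mult)

lemma pi_of_squared: "pi_of D i * pi_of D i = 1"
  by (simp add: pi_of_def)

lemma beta_unit: "(1 - pi_of D i * q_of D i powi (- 2)) * beta i = 1"
  unfolding beta_def
proof (rule qpi_unit_iff_at_pi)
  have "at_pi s (1 - pi_of D i * q_of D i powi (- 2)) \<noteq> 0" if "s = 1 \<or> s = - 1" for s
  proof -
    have s: "s * s = 1" using that by auto
    have "qX powi (dd D i * - 2) \<noteq> 1" "qX powi (dd D i * - 2) \<noteq> - 1"
      using qX_powi_eq_sign[of "dd D i * - 2"] dd_pos[of i] by auto
    moreover have "at_pi s (pi_of D i) = 1 \<or> at_pi s (pi_of D i) = - 1" using that by (auto simp: pi_of_def)
    ultimately show ?thesis by (auto simp: q_of_powi at_pi_mult[OF s] add_eq_0_iff minus_equation_iff)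
  qed
  then show "at_pi 1 (1 - pi_of D i * q_of D i powi (- 2)) \<noteq> 0"
    "at_pi (- 1) (1 - pi_of D i * q_of D i powi (- 2)) \<noteq> 0" by auto
qed

lemma unit_unique: "a * b = 1 \<Longrightarrow> a * c = 1 \<Longrightarrow> b = (c :: qpi)"
  by (metis mult.commute mult.left_commute mult.right_neutral)

text \<open>The constant of the commutator of \<open>E\<^sub>i\<close> and \<open>F\<^sub>i\<close> and the norm of \<open>\<theta>\<^sub>i\<close> fit together: it is
  this relation that makes the contributions of adjacent weights to \<open>\<Omega>\<close> cancel.\<close>
lemma gam_beta: "gam i * (pi_of D i * q_of D i) = beta i"
proof -
  have q: "q_of D i * q_of D i powi (- 2) = q_of D i powi (- 1)"
  proof -
    have "q_of D i * q_of D i powi (- 2) = qq powi dd D i * qq powi (dd D i * - 2)"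
      by (simp only: q_of_powi) (simp only: q_of_def)
    also have "\<dots> = qq powi (dd D i * - 1)"
      by (simp flip: qq_powi_add)
    finally show ?thesis by (simp only: q_of_powi)
  qed
  have e: "pi_of D i * q_of D i - q_of D i powi (- 1) =
      (pi_of D i * q_of D i) * (1 - pi_of D i * q_of D i powi (- 2))" (is "?a = ?b * ?c")
  proof -
    have "?b * ?c = ?b - (pi_of D i * pi_of D i) * (q_of D i * q_of D i powi (- 2))"
      by (simp add: right_diff_distrib ac_simps)
    then show ?thesis by (simp only: q pi_of_squared mult_1)
  qed
  have qi: "q_of D i * qq powi (- dd D i) = 1"
    using powi_minus_unit[OF qq_unit] by (simp add: q_of_def)
  \<comment> \<open>\<open>\<pi>\<^sub>i q\<^sub>i\<^sup>-\<^sup>1\<close> is the inverse of \<open>\<pi>\<^sub>i q\<^sub>i\<close>.\<close>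
  have "?b * (pi_of D i * qq powi (- dd D i)) = (pi_of D i * pi_of D i) * (q_of D i * qq powi (- dd D i))"
    by (simp only: ac_simps)
  then have b: "?b * (pi_of D i * qq powi (- dd D i)) = 1" by (simp add: qi pi_of_squared)
  have "?a * (pi_of D i * qq powi (- dd D i) * beta i) = (?b * (pi_of D i * qq powi (- dd D i))) * (?c * beta i)"
    unfolding e by (simp only: ac_simps)
  then have u: "?a * (pi_of D i * qq powi (- dd D i) * beta i) = 1" by (simp add: b beta_unit)
  have ne: "at_pi s ?a \<noteq> 0" if "s * s = 1" for s
    using at_pi_mult[OF that, of ?a "pi_of D i * qq powi (- dd D i) * beta i"]
    unfolding u by auto
  have "?a * gam i = 1" unfolding gam_def
    by (rule qpi_unit_iff_at_pi) (rule ne; simp)+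
  then have "gam i = pi_of D i * qq powi (- dd D i) * beta i"
    using u by (rule unit_unique)
  then have "gam i * ?b = (?b * (pi_of D i * qq powi (- dd D i))) * beta i"
    by (simp only: ac_simps)
  then show ?thesis by (simp add: b)
qed

section \<open>Commutators\<close>

definition pls :: "'i free_alg \<Rightarrow> 'u" where "pls x = plus_hom Q (f_proj Q x)"

lemma pls_simps [simp]:
  "pls 0 = 0" "pls 1 = 1" "pls (x + y) = pls x + pls y" "pls (x - y) = pls x - pls y"
  "pls (x * y) = pls x * pls y" "pls (scal c) = U_scal Q c" "pls (var i) = E i"
proof -
  have h: "is_half_hom Q gE (plus_hom Q)" using qs by (simp add: quantum_supergroup_def)
  then have a: "is_additive (plus_hom Q)" by (simp add: is_half_hom_def is_ring_hom_def)
  show "pls 0 = 0" "pls 1 = 1" "pls (x + y) = pls x + pls y" "pls (x - y) = pls x - pls y"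
    "pls (x * y) = pls x * pls y" "pls (scal c) = U_scal Q c" "pls (var i) = E i"
    using h additive_zero[OF a] additive_add[OF a] additive_diff[OF a]
    by (auto simp: pls_def is_half_hom_def is_ring_hom_def)
qed

lemma pls_scal [simp]: "pls (scal c * x) = c \<bullet> pls x"
  by simp

lemma pls_word_Cons: "pls (monom_word (i # w)) = E i * pls (monom_word w)"
  by (simp add: monom_word_Cons)

text \<open>The images of the generators and of the words under the antihomomorphism that replaces
  \<open>x \<mapsto> S (x\<^sup>-)\<close>.  The factor \<open>\<pi>\<^sub>i q\<^sub>i\<close> distributes the coefficient \<open>\<pi>\<^sub>\<nu> q\<^sub>\<nu>\<close> of \<open>\<Omega>\<close> over the
  letters of a word.\<close>
definition G :: "'i \<Rightarrow> 'u" where "G i = (pi_of D i * q_of D i) \<bullet> (F i * Kp i)"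

fun Gw :: "'i list \<Rightarrow> 'u" where
  "Gw [] = 1"
| "Gw (j # w) = Gw w * G j"

text \<open>Defined on the free algebra; that it respects the radical on each weight space follows from its
  description by the antipode in \<open>antipode_anti\<close>.\<close>
definition anti :: "'i free_alg \<Rightarrow> 'u" where "anti = lin (U_scal Q) Gw"

lemma is_additive_U_scal: "is_additive (U_scal Q)"
  by (simp add: is_additive_def U_scal_simps)

lemma anti_simps [simp]:
  "anti 0 = 0" "anti (x + y) = anti x + anti y" "anti (x - y) = anti x - anti y"
  "anti (scal c * x) = c \<bullet> anti x" "anti (monom_word w) = Gw w"
proof -
  have a: "is_additive anti" unfolding anti_def by (rule is_additive_lin[OF is_additive_U_scal])
  show "anti 0 = 0" "anti (x + y) = anti x + anti y" "anti (x - y) = anti x - anti y"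
    by (simp_all add: additive_zero[OF a] additive_add[OF a] additive_diff[OF a])
  show "anti (scal c * x) = c \<bullet> anti x"
    by (simp add: anti_def lin_scal[OF is_additive_U_scal U_scal_simps(4)])
  show "anti (monom_word w) = Gw w"
    using lin_scal_monom[OF is_additive_U_scal, of Gw 1 w] by (simp add: anti_def U_scal_simps)
qed

lemma Gw_snoc: "Gw (w @ [i]) = G i * Gw w"
  by (induction w) (simp_all add: mult.assoc)

lemma anti_var: "anti (var i * x) = anti x * G i" "anti (x * var i) = G i * anti x"
proof (induction x rule: free_alg_induct)
  case (monom c w)
  have "var i * (scal c * monom_word w) = scal c * monom_word (i # w)"
    by (metis monom_word_Cons mult.assoc scal_commute)
  then show "anti (var i * (scal c * monom_word w)) = anti (scal c * monom_word w) * G i"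
    by simp
  have "scal c * monom_word w * var i = scal c * monom_word (w @ [i])"
    by (simp add: monom_word_append mult.assoc var_def)
  then show "anti (scal c * monom_word w * var i) = G i * anti (scal c * monom_word w)"
    by (simp add: Gw_snoc)
qed (simp_all add: distrib_left distrib_right)

lemma G_Kp: "G j * Kp i = qq powi dot D i j \<bullet> (Kp i * G j)"
proof -
  have "F j * (Kp j * Kp i) = (F j * Kp i) * Kp j"
    by (simp only: Kp_Kp[of j i] mult.assoc)
  then have "F j * (Kp j * Kp i) = qq powi dot D i j \<bullet> (Kp i * (F j * Kp j))"
    by (simp only: F_Kp us_simps mult.assoc)
  then show ?thesis
    by (simp add: G_def mult.assoc mult.commute)
qed

lemma E_G: "E i * G j = (\<pi> ^ (p i * p j) * qq powi (- dot D i j)) \<bullet> (G j * E i) +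
    (if i = j then beta i \<bullet> (Jp i * Kp i * Kp i - 1) else 0)"
proof -
  let ?c = "pi_of D j * q_of D j"
  have a: "F j * E i * Kp j = qq powi (- dot D i j) \<bullet> (F j * Kp j * E i)"
    by (simp only: mult.assoc E_Kp us_simps dot_sym[of j i])
  have "E i * F j * Kp j = \<pi> ^ (p i * p j) \<bullet> (F j * E i * Kp j) +
      (if i = j then gam i \<bullet> ((Jp i * Kp i - Km i) * Kp i) else 0)"
    by (auto simp: E_F distrib_right)
  also have "\<dots> = (\<pi> ^ (p i * p j) * qq powi (- dot D i j)) \<bullet> (F j * Kp j * E i) +
      (if i = j then gam i \<bullet> (Jp i * Kp i * Kp i - 1) else 0)"
    by (simp only: a us_simps left_diff_distrib Kp_Km)
  finally have "E i * G j = (?c * (\<pi> ^ (p i * p j) * qq powi (- dot D i j))) \<bullet> (F j * Kp j * E i) +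
      (if i = j then (?c * gam i) \<bullet> (Jp i * Kp i * Kp i - 1) else 0)"
    by (simp add: G_def mult.assoc[symmetric] us_add)
  moreover have "(?c * (\<pi> ^ (p i * p j) * qq powi (- dot D i j))) \<bullet> (F j * Kp j * E i) =
      (\<pi> ^ (p i * p j) * qq powi (- dot D i j)) \<bullet> (G j * E i)"
    by (simp add: G_def mult.commute)
  moreover have "i = j \<Longrightarrow> ?c * gam i = beta i"
    using gam_beta[of i] by (simp only: mult.commute)
  ultimately show ?thesis by auto
qed

lemma HP_E: "Jp i * Kp i * E j = (\<pi> powi dot D i j * qq powi dot D i j) \<bullet> (E j * (Jp i * Kp i))"
proof -
  have "Jp i * Kp i * E j = qq powi dot D i j \<bullet> (Jp i * E j * Kp i)" by (simp add: mult.assoc Kp_E)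
  then show ?thesis by (simp add: Jp_E mult.assoc mult.commute)
qed

lemma HP_pls_word: "Jp i * Kp i * pls (monom_word w) =
  (\<pi> powi dotw D i (count_list w) * qq powi dotw D i (count_list w)) \<bullet> (pls (monom_word w) * (Jp i * Kp i))"
proof (induction w)
  case Nil
  then show ?case by (simp add: count_list_Nil)
next
  case (Cons j w)
  let ?c = "\<pi> powi dot D i j * qq powi dot D i j"
  let ?d = "\<pi> powi dotw D i (count_list w) * qq powi dotw D i (count_list w)"
  have "Jp i * Kp i * pls (monom_word (j # w)) = (Jp i * Kp i * E j) * pls (monom_word w)"
    by (simp only: pls_word_Cons mult.assoc)
  also have "\<dots> = ?c \<bullet> (E j * (Jp i * Kp i * pls (monom_word w)))"
    unfolding HP_E by (simp only: us_simps mult.assoc)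
  also have "\<dots> = (?c * ?d) \<bullet> (E j * pls (monom_word w) * (Jp i * Kp i))"
    unfolding Cons.IH by (simp only: us_simps mult.assoc)
  also have "?c * ?d = \<pi> powi dotw D i (count_list (j # w)) * qq powi dotw D i (count_list (j # w))"
    by (simp only: count_list_Cons dotw_simps qq_powi_add pi_powi_add ac_simps)
  finally show ?case by (simp only: pls_word_Cons)
qed

lemma G_HQ: "G j * (Jp i * Kp i * Kp i) =
  (\<pi> powi dot D i j * (qq powi dot D i j * qq powi dot D i j)) \<bullet> (Jp i * Kp i * Kp i * G j)"
proof -
  have pi: "\<pi> powi dot D i j * \<pi> powi (- dot D i j) = 1"
    by (rule powi_minus_unit[OF pi_unit])
  have "Jp i * G j = (pi_of D j * q_of D j) \<bullet> (Jp i * F j * Kp j)"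
    by (simp add: G_def mult.assoc)
  also have "\<dots> = \<pi> powi (- dot D i j) \<bullet> (G j * Jp i)"
    by (simp add: Jp_F G_def mult.assoc Jp_Kp mult.commute)
  finally have "\<pi> powi dot D i j \<bullet> (Jp i * G j) = G j * Jp i"
    by (simp add: pi)
  then have J: "G j * Jp i = \<pi> powi dot D i j \<bullet> (Jp i * G j)" ..
  have "G j * (Jp i * Kp i * Kp i) = (G j * Jp i) * Kp i * Kp i" by (simp only: mult.assoc)
  also have "\<dots> = \<pi> powi dot D i j \<bullet> (Jp i * ((G j * Kp i) * Kp i))"
    by (simp only: J us_simps mult.assoc)
  also have "\<dots> = (\<pi> powi dot D i j * qq powi dot D i j) \<bullet> (Jp i * Kp i * (G j * Kp i))"
    by (simp only: G_Kp us_simps mult.assoc)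
  also have "\<dots> = (\<pi> powi dot D i j * qq powi dot D i j * qq powi dot D i j) \<bullet> (Jp i * Kp i * Kp i * G j)"
    by (simp only: G_Kp us_simps mult.assoc)
  finally show ?thesis by (simp only: mult.assoc)
qed

lemma Gw_HQ: "Gw w * (Jp i * Kp i * Kp i) =
  (\<pi> powi dotw D i (count_list w) * (qq powi dotw D i (count_list w) * qq powi dotw D i (count_list w))) \<bullet>
    (Jp i * Kp i * Kp i * Gw w)"
proof (induction w)
  case Nil
  then show ?case by (simp add: count_list_Nil)
next
  case (Cons j w)
  let ?H = "Jp i * Kp i * Kp i"
  let ?c = "\<pi> powi dot D i j * (qq powi dot D i j * qq powi dot D i j)"
  let ?d = "\<pi> powi dotw D i (count_list w) * (qq powi dotw D i (count_list w) * qq powi dotw D i (count_list w))"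
  have "Gw (j # w) * ?H = Gw w * (G j * ?H)" by (simp only: Gw.simps mult.assoc)
  also have "\<dots> = ?c \<bullet> ((Gw w * ?H) * G j)" unfolding G_HQ by (simp only: us_simps mult.assoc)
  also have "\<dots> = (?c * ?d) \<bullet> (?H * Gw (j # w))" unfolding Cons.IH by (simp only: us_simps mult.assoc Gw.simps)
  also have "?c * ?d = \<pi> powi dotw D i (count_list (j # w)) *
      (qq powi dotw D i (count_list (j # w)) * qq powi dotw D i (count_list (j # w)))"
    by (simp only: count_list_Cons dotw_simps qq_powi_add pi_powi_add ac_simps)
  finally show ?case .
qed

lemma pi_pow_cancel: "\<pi> ^ n * \<pi> ^ n = 1" "\<pi> ^ n * (\<pi> ^ n * c) = c"
proof -
  show "\<pi> ^ n * \<pi> ^ n = 1" by (simp flip: power_mult_distrib)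
  then show "\<pi> ^ n * (\<pi> ^ n * c) = c" by (simp flip: mult.assoc)
qed

text \<open>The bookkeeping shared by the induction steps of the two commutator formulas: \<open>A\<close> is the term where
  the generator has passed the whole word, \<open>R\<close> and \<open>L\<close> are the terms with the derivatives of the tail
  of the word, and \<open>Y\<close>, \<open>Z\<close> arise if the first letter is the generator itself.\<close>
lemma us_rearrange:
  assumes "a1 = a2" "l1 = g2 * l2" "P \<Longrightarrow> c = g2" "(e * c) \<bullet> Y = (e * (g * br)) \<bullet> Y'"
  shows "e \<bullet> (a1 \<bullet> A + (if P then c \<bullet> Y - c \<bullet> Z else 0) + g \<bullet> R - l1 \<bullet> L) =
      e \<bullet> (a2 \<bullet> A + g \<bullet> (R + (if P then br \<bullet> Y' else 0)) - g2 \<bullet> ((if P then Z else 0) + l2 \<bullet> L))"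
  using assms by (auto simp: us_add us_diff mult.assoc[where 'a = qpi])

text \<open>Each occurrence of \<open>E\<^sub>i\<close> in the word contributes \<open>J\<^sub>i K\<^sub>i\<close>, which is moved to the right, and
  \<open>K\<^sub>i\<^sup>-\<^sup>1\<close>, which is moved to the left; the powers of \<open>q\<close> that are picked up are those of the right
  and of the left derivation.  The scalar \<open>e\<close> is meant to be \<open>1\<close>, or \<open>1 + \<pi>\<close> if some \<open>i \<cdot> j\<close> is
  odd: then \<open>J\<^sub>i\<close> also picks up powers of \<open>\<pi>\<close> that the derivations do not see.\<close>
lemma pls_word_F:
  assumes e: "\<And>\<nu>. e * \<pi> powi dotw D i \<nu> = e"
  shows "e \<bullet> (pls (monom_word w) * F i) =
    e \<bullet> (\<pi> ^ (p i * par D (count_list w)) \<bullet> (F i * pls (monom_word w))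
      + gam i \<bullet> (pls (rdr_word D i w) * (Jp i * Kp i))
      - (gam i * \<pi> ^ (p i * (par D (count_list w) + p i))) \<bullet> (Km i * pls (ldr_word D i w)))"
proof (induction w)
  case Nil
  then show ?case by (simp add: count_list_Nil)
next
  case (Cons j w)
  let ?X = "pls (monom_word w)" and ?R = "pls (rdr_word D i w)" and ?L = "pls (ldr_word D i w)"
  let ?H = "Jp i * Kp i" and ?k = "par D (count_list w)" and ?d = "dotw D i (count_list w)"
  let ?b = "gam i * \<pi> ^ (p i * (?k + p i))"
  have EK: "E j * (Km i * ?L) = qq powi dot D j i \<bullet> (Km i * (E j * ?L))"
    by (simp only: mult.assoc[symmetric] E_Km us_simps dot_sym[of i j])
  have EF: "E j * (F i * ?X) = \<pi> ^ (p i * p j) \<bullet> (F i * (E j * ?X)) +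
      (if i = j then gam i \<bullet> (?H * ?X - Km i * ?X) else 0)"
    by (auto simp: E_F mult.assoc[symmetric] distrib_right left_diff_distrib mult.commute[of "p j"])
  have "e \<bullet> (pls (monom_word (j # w)) * F i) = E j * (e \<bullet> (?X * F i))"
    by (simp only: pls_word_Cons us_simps mult.assoc)
  also have "\<dots> = e \<bullet> (\<pi> ^ (p i * ?k) \<bullet> (E j * (F i * ?X)) + gam i \<bullet> (E j * ?R * ?H) - ?b \<bullet> (E j * (Km i * ?L)))"
    by (simp only: Cons.IH us_simps distrib_left right_diff_distrib mult.assoc)
  finally have lhs: "e \<bullet> (pls (monom_word (j # w)) * F i) =
      e \<bullet> ((\<pi> ^ (p i * ?k) * \<pi> ^ (p i * p j)) \<bullet> (F i * (E j * ?X)) +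
      (if i = j then (\<pi> ^ (p i * ?k) * gam i) \<bullet> (?H * ?X) - (\<pi> ^ (p i * ?k) * gam i) \<bullet> (Km i * ?X) else 0) +
      gam i \<bullet> (E j * ?R * ?H) - (?b * qq powi dot D j i) \<bullet> (Km i * (E j * ?L)))"
    unfolding EF EK by (auto simp: us_add us_diff mult.assoc[where 'a = qpi])
  have HX: "(e * (\<pi> ^ (p i * ?k) * gam i)) \<bullet> (?H * ?X) = (e * (gam i * braid D i (count_list w))) \<bullet> (?X * ?H)"
  proof -
    have "e * (\<pi> ^ (p i * ?k) * gam i) * (\<pi> powi ?d * qq powi ?d) =
        (e * \<pi> powi ?d) * (\<pi> ^ (p i * ?k) * gam i * qq powi ?d)" by (simp only: ac_simps)
    also have "\<dots> = e * (gam i * braid D i (count_list w))"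
      by (simp only: e braid_def ac_simps)
    finally show ?thesis by (simp only: HP_pls_word us_simps)
  qed
  have rdr: "pls (rdr_word D i (j # w)) * ?H =
      E j * ?R * ?H + (if i = j then braid D i (count_list w) \<bullet> (?X * ?H) else 0)"
    by (simp add: distrib_right)
  have ldr: "Km i * pls (ldr_word D i (j # w)) = (if i = j then Km i * ?X else 0) +
      (qq powi dot D j i * \<pi> ^ (p j * p i)) \<bullet> (Km i * (E j * ?L))"
    by (simp add: distrib_left)
  show ?case
    unfolding lhs unfolding rdr ldr pls_word_Cons
  proof (rule us_rearrange[OF _ _ _ HX])
    show "\<pi> ^ (p i * ?k) * \<pi> ^ (p i * p j) = \<pi> ^ (p i * par D (count_list (j # w)))"
      by (simp only: count_list_Cons par_simps distrib_left power_add mult.commute)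
    have pp: "\<pi> ^ (p i * (p j + ?k + p i)) * \<pi> ^ (p j * p i) = \<pi> ^ (p i * (?k + p i))"
      by (simp add: distrib_left power_add mult.commute[of "p j"] pi_pow_cancel ac_simps)
    have "?b * qq powi dot D j i =
        gam i * (\<pi> ^ (p i * (p j + ?k + p i)) * \<pi> ^ (p j * p i)) * qq powi dot D j i"
      unfolding pp ..
    then show "?b * qq powi dot D j i = gam i * \<pi> ^ (p i * (par D (count_list (j # w)) + p i)) *
        (qq powi dot D j i * \<pi> ^ (p j * p i))"
      by (simp only: count_list_Cons par_simps ac_simps)
    show "\<pi> ^ (p i * ?k) * gam i = gam i * \<pi> ^ (p i * (par D (count_list (j # w)) + p i))" if "i = j"
      using that by (simp add: count_list_Cons distrib_left power_add pi_pow_cancel ac_simps del: count_list.simps)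
  qed
qed

text \<open>The same computation for \<open>anti\<close>.  As \<open>anti\<close> reverses words, now \<open>J\<^sub>i K\<^sub>i\<^sup>2\<close> is moved to the left.\<close>
lemma E_Gw:
  assumes e: "\<And>\<nu>. e * \<pi> powi dotw D i \<nu> = e"
  shows "e \<bullet> (E i * Gw w) =
    e \<bullet> ((\<pi> ^ (p i * par D (count_list w)) * qq powi (- dotw D i (count_list w))) \<bullet> (Gw w * E i)
      + beta i \<bullet> (Jp i * Kp i * Kp i * anti (rdr_word D i w))
      - (beta i * \<pi> ^ (p i * (par D (count_list w) + p i)) *
           qq powi (dot D i i - dotw D i (count_list w))) \<bullet> anti (ldr_word D i w))"
proof (induction w)
  case Nil
  then show ?case by (simp add: count_list_Nil)
next
  case (Cons j w)
  let ?X = "Gw w" and ?R = "anti (rdr_word D i w)" and ?L = "anti (ldr_word D i w)"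
  let ?H = "Jp i * Kp i * Kp i" and ?k = "par D (count_list w)" and ?d = "dotw D i (count_list w)"
  let ?b = "beta i * \<pi> ^ (p i * (?k + p i)) * qq powi (dot D i i - ?d)"
  let ?c = "\<pi> ^ (p i * ?k) * qq powi (- ?d)"
  have EG: "?X * (E i * G j) = (\<pi> ^ (p i * p j) * qq powi (- dot D i j)) \<bullet> (?X * G j * E i) +
      (if i = j then beta i \<bullet> (?X * ?H - ?X) else 0)"
    by (auto simp: E_G distrib_left right_diff_distrib mult.assoc)
  have "e \<bullet> (E i * Gw (j # w)) = (e \<bullet> (E i * ?X)) * G j"
    by (simp only: Gw.simps us_simps mult.assoc)
  also have "\<dots> = e \<bullet> (?c \<bullet> (?X * (E i * G j)) + beta i \<bullet> (?H * (?R * G j)) - ?b \<bullet> (?L * G j))"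
    by (simp only: Cons.IH us_simps distrib_right left_diff_distrib mult.assoc)
  finally have lhs: "e \<bullet> (E i * Gw (j # w)) =
      e \<bullet> ((?c * (\<pi> ^ (p i * p j) * qq powi (- dot D i j))) \<bullet> (?X * G j * E i) +
      (if i = j then (?c * beta i) \<bullet> (?X * ?H) - (?c * beta i) \<bullet> ?X else 0) +
      beta i \<bullet> (?H * (?R * G j)) - ?b \<bullet> (?L * G j))"
    unfolding EG by (auto simp: us_add us_diff mult.assoc[where 'a = qpi])
  have HX: "(e * (?c * beta i)) \<bullet> (?X * ?H) = (e * (beta i * braid D i (count_list w))) \<bullet> (?H * ?X)"
  proof -
    have "e * (?c * beta i) * (\<pi> powi ?d * (qq powi ?d * qq powi ?d)) =
        (e * \<pi> powi ?d) * (\<pi> ^ (p i * ?k) * beta i * ((qq powi (- ?d) * qq powi ?d) * qq powi ?d))"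
      by (simp only: ac_simps)
    also have "\<dots> = e * (beta i * braid D i (count_list w))"
      by (simp only: e braid_def powi_minus_unit[OF qq_unit] mult_1 ac_simps)
    finally show ?thesis by (simp only: Gw_HQ us_simps)
  qed
  have rdr: "?H * anti (rdr_word D i (j # w)) =
      ?H * (?R * G j) + (if i = j then braid D i (count_list w) \<bullet> (?H * ?X) else 0)"
    by (simp add: anti_var distrib_left)
  have ldr: "anti (ldr_word D i (j # w)) = (if i = j then ?X else 0) +
      (qq powi dot D j i * \<pi> ^ (p j * p i)) \<bullet> (?L * G j)"
    by (simp add: anti_var)
  have q: "qq powi (dot D i i - (dot D i j + ?d)) * qq powi dot D j i = qq powi (dot D i i - ?d)"
    by (simp add: dot_sym[of j i] flip: qq_powi_add)
  show ?case
    unfolding lhs unfolding rdr ldr Gw.simps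
  proof (rule us_rearrange[OF _ _ _ HX])
    show "?c * (\<pi> ^ (p i * p j) * qq powi (- dot D i j)) =
        \<pi> ^ (p i * par D (count_list (j # w))) * qq powi (- dotw D i (count_list (j # w)))"
      by (simp only: count_list_Cons par_simps dotw_simps distrib_left power_add minus_add_distrib qq_powi_add)
        (simp only: ac_simps)
    have pp: "\<pi> ^ (p i * (p j + ?k + p i)) * \<pi> ^ (p j * p i) = \<pi> ^ (p i * (?k + p i))"
      by (simp add: distrib_left power_add mult.commute[of "p j"] pi_pow_cancel ac_simps)
    have "?b = beta i * (\<pi> ^ (p i * (p j + ?k + p i)) * \<pi> ^ (p j * p i)) *
        (qq powi (dot D i i - (dot D i j + ?d)) * qq powi dot D j i)"
      unfolding pp q ..
    then show "?b = beta i * \<pi> ^ (p i * (par D (count_list (j # w)) + p i)) *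
        qq powi (dot D i i - dotw D i (count_list (j # w))) * (qq powi dot D j i * \<pi> ^ (p j * p i))"
      by (simp only: count_list_Cons par_simps dotw_simps ac_simps)
    show "?c * beta i = beta i * \<pi> ^ (p i * (par D (count_list (j # w)) + p i)) *
        qq powi (dot D i i - dotw D i (count_list (j # w)))" if "i = j"
      using that by (simp add: count_list_Cons distrib_left power_add pi_pow_cancel ac_simps del: count_list.simps)
  qed
qed

end

lemma prod_inc:
  fixes f :: "'i::finite \<Rightarrow> qpi"
  shows "(\<Prod>j\<in>UNIV. f j ^ inc i \<nu> j) = f i * (\<Prod>j\<in>UNIV. f j ^ \<nu> j)"
proof -
  have "(\<Prod>j\<in>UNIV. f j ^ inc i \<nu> j) = (\<Prod>j\<in>UNIV. (if j = i then f i else 1) * f j ^ \<nu> j)"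
    by (intro prod.cong) (auto simp: inc_def)
  then show ?thesis by (simp add: prod.distrib)
qed

definition Om_coef :: "('i::finite, 'y, 'x) root_data \<Rightarrow> ('i \<Rightarrow> nat) \<Rightarrow> qpi" where
  "Om_coef D \<nu> = (- 1) ^ ht \<nu> * \<pi> ^ (par D \<nu> choose 2) * pi_wt D \<nu> * q_wt D \<nu>"

lemma Om_coef_inc:
  "Om_coef D (inc i \<nu>) = - (\<pi> ^ (pari D i * par D \<nu>) * (pi_of D i * q_of D i)) * Om_coef D \<nu>"
proof -
  have "pari D i + n choose 2 = pari D i * n + (n choose 2)" for n
    using pari_cases[of D i] by (auto simp: numeral_2_eq_2)
  then show ?thesis
    by (simp add: Om_coef_def pi_wt_def q_wt_def prod_inc power_add)
qed

lemma Om_coef_0: "Om_coef D (\<lambda>_. 0) = 1"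
  by (simp add: Om_coef_def pi_wt_def q_wt_def numeral_2_eq_2)

lemma finite_ht_le: "finite {\<nu> :: 'i::finite \<Rightarrow> nat. ht \<nu> \<le> n}"
proof (rule finite_subset)
  show "{\<nu> :: 'i \<Rightarrow> nat. ht \<nu> \<le> n} \<subseteq> PiE UNIV (\<lambda>_. {..n})"
  proof
    fix \<nu> :: "'i \<Rightarrow> nat" assume "\<nu> \<in> {\<nu>. ht \<nu> \<le> n}"
    then have "\<nu> i \<le> n" for i using member_le_sum[of i UNIV \<nu>] by (simp add: ht_def)
    then show "\<nu> \<in> PiE UNIV (\<lambda>_. {..n})" by auto
  qed
qed (simp add: finite_PiE)

text \<open>Here \<open>X \<nu>\<close> is the commutator with the weight component \<open>\<nu>\<close> of \<open>\<Omega>\<close>, which is supported in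
  bounded height on any vector.  The bijection \<open>\<nu> \<mapsto> \<nu> + i\<close> onto the weights that involve \<open>i\<close>
  pairs off the terms \<open>a\<close>.\<close>
lemma ht_telescope:
  fixes X a g :: "('i::finite \<Rightarrow> nat) \<Rightarrow> 'm::ab_group_add"
  assumes "\<And>\<nu>. X (inc i \<nu>) = a (inc i \<nu>) - a \<nu> + g \<nu>" "\<And>\<nu>. \<nu> i = 0 \<Longrightarrow> X \<nu> = a \<nu>"
    and "\<And>\<nu>. ht \<nu> = Suc n \<Longrightarrow> a \<nu> = 0"
  shows "(\<Sum>\<nu> | ht \<nu> \<le> Suc n. X \<nu>) = (\<Sum>\<nu> | ht \<nu> \<le> n. g \<nu>)"
proof -
  let ?Z = "{\<nu> :: 'i \<Rightarrow> nat. ht \<nu> \<le> Suc n \<and> \<nu> i = 0}" and ?N = "{\<nu> :: 'i \<Rightarrow> nat. ht \<nu> \<le> n}"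
  have "\<nu> \<in> inc i ` ?N" if "ht \<nu> \<le> Suc n" "\<nu> i \<noteq> 0" for \<nu>
  proof -
    have e: "\<nu> = inc i (\<nu>(i := \<nu> i - 1))" using that by (auto simp: inc_def)
    then have "ht \<nu> = Suc (ht (\<nu>(i := \<nu> i - 1)))" by (metis ht_simps(2))
    then show ?thesis using e that by auto
  qed
  then have s: "{\<nu> :: 'i \<Rightarrow> nat. ht \<nu> \<le> Suc n} = ?Z \<union> inc i ` ?N"
    by auto
  have d: "?Z \<inter> inc i ` ?N = {}" by (auto simp: inc_def)
  have f: "finite ?Z" "finite (inc i ` ?N)"
    using finite_ht_le[of "Suc n"] finite_ht_le[of n] by (auto elim: rev_finite_subset)
  have split: "(\<Sum>\<nu> | ht \<nu> \<le> Suc n. h \<nu>) = (\<Sum>\<nu>\<in>?Z. h \<nu>) + (\<Sum>\<nu>\<in>?N. h (inc i \<nu>))"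
    for h :: "('i \<Rightarrow> nat) \<Rightarrow> 'm"
    unfolding s sum.union_disjoint[OF f d]
    by (subst sum.reindex) (auto simp: inj_on_def inc_inject)
  have "(\<Sum>\<nu> | ht \<nu> \<le> Suc n. a \<nu>) = (\<Sum>\<nu>\<in>?N. a \<nu>)"
    by (rule sum.mono_neutral_right) (auto simp: finite_ht_le assms(3))
  moreover have "(\<Sum>\<nu>\<in>?Z. X \<nu>) = (\<Sum>\<nu>\<in>?Z. a \<nu>)"
    by (intro sum.cong) (auto simp: assms(2))
  ultimately show ?thesis
    using split[of X] split[of a] by (simp add: assms(1) sum.distrib sum_subtractf add_diff_eq)
qed

context supergroup
begin

lemma pls_F:
  assumes e: "\<And>\<nu>. e * \<pi> powi dotw D i \<nu> = e" and x: "x \<in> free_wt \<nu>"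
  shows "e \<bullet> (pls x * F i) = e \<bullet> (\<pi> ^ (p i * par D \<nu>) \<bullet> (F i * pls x)
      + gam i \<bullet> (pls (rdr D i x) * (Jp i * Kp i))
      - (gam i * \<pi> ^ (p i * (par D \<nu> + p i))) \<bullet> (Km i * pls (ldr D i x)))"
  using x
proof (induction rule: free_wt_induct)
  case (add x y)
  then show ?case by (simp add: us_add us_diff distrib_left distrib_right)
next
  case (monom c w)
  have "c \<bullet> (e \<bullet> (pls (monom_word w) * F i)) =
      c \<bullet> (e \<bullet> (\<pi> ^ (p i * par D \<nu>) \<bullet> (F i * pls (monom_word w))
      + gam i \<bullet> (pls (rdr_word D i w) * (Jp i * Kp i))
      - (gam i * \<pi> ^ (p i * (par D \<nu> + p i))) \<bullet> (Km i * pls (ldr_word D i w))))"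
    by (simp only: pls_word_F[OF e] monom)
  then show ?case
    by (simp add: us_add us_diff) (simp add: ac_simps)
qed simp

lemma E_anti:
  assumes e: "\<And>\<nu>. e * \<pi> powi dotw D i \<nu> = e" and x: "x \<in> free_wt \<nu>"
  shows "e \<bullet> (E i * anti x) =
    e \<bullet> ((\<pi> ^ (p i * par D \<nu>) * qq powi (- dotw D i \<nu>)) \<bullet> (anti x * E i)
      + beta i \<bullet> (Jp i * Kp i * Kp i * anti (rdr D i x))
      - (beta i * \<pi> ^ (p i * (par D \<nu> + p i)) * qq powi (dot D i i - dotw D i \<nu>)) \<bullet> anti (ldr D i x))"
  using x
proof (induction rule: free_wt_induct)
  case (add x y)
  then show ?case by (simp add: us_add us_diff distrib_left distrib_right)
next
  case (monom c w)
  have "c \<bullet> (e \<bullet> (E i * Gw w)) = c \<bullet> (e \<bullet> ((\<pi> ^ (p i * par D \<nu>) * qq powi (- dotw D i \<nu>)) \<bullet> (Gw w * E i)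
      + beta i \<bullet> (Jp i * Kp i * Kp i * anti (rdr_word D i w))
      - (beta i * \<pi> ^ (p i * (par D \<nu> + p i)) * qq powi (dot D i i - dotw D i \<nu>)) \<bullet> anti (ldr_word D i w)))"
    by (simp only: E_Gw[OF e] monom)
  then show ?case
    by (simp add: us_add us_diff) (simp add: ac_simps)
qed simp

section \<open>The antipode\<close>

definition mns :: "'i free_alg \<Rightarrow> 'u" where "mns x = minus_hom Q (f_proj Q x)"

lemma mns_simps [simp]:
  "mns 0 = 0" "mns 1 = 1" "mns (x + y) = mns x + mns y"
  "mns (x * y) = mns x * mns y" "mns (scal c) = U_scal Q c" "mns (var i) = F i"
proof -
  have h: "is_half_hom Q gF (minus_hom Q)" using qs by (simp add: quantum_supergroup_def)
  then have a: "is_additive (minus_hom Q)" by (simp add: is_half_hom_def is_ring_hom_def)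
  show "mns 0 = 0" "mns 1 = 1" "mns (x + y) = mns x + mns y"
    "mns (x * y) = mns x * mns y" "mns (scal c) = U_scal Q c" "mns (var i) = F i"
    using h additive_zero[OF a] additive_add[OF a]
    by (auto simp: mns_def is_half_hom_def is_ring_hom_def)
qed

lemma pls_word: "pls (monom_word w) = U_proj Q (monom_word (map gE w))"
  by (induction w) (simp_all add: monom_word_Cons)

lemma mns_word: "mns (monom_word w) = U_proj Q (monom_word (map gF w))"
  by (induction w) (simp_all add: monom_word_Cons)

lemma U_parI: "odd (length (filter (odd_gen D) w)) = b \<Longrightarrow> U_proj Q (monom_word w) \<in> U_par D Q b"
  by (auto simp: U_par_def intro!: imageI)

lemma length_odd:
  "length (filter (odd_gen D) (map gE w)) = par D (count_list w)"
  "length (filter (odd_gen D) (map gF w)) = par D (count_list w)"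
  by (induction w) (simp_all only: count_list_Cons count_list_Nil par_simps list.map filter.simps
      odd_gen.simps list.size pari_def if_distrib if_True if_False; auto)+

lemma is_antipode: "is_antipode D Q (antipode Q)"
  using qs by (simp add: quantum_supergroup_def)

text \<open>The antipode reverses a product at the cost of a sign for each pair of odd letters.  In total this
  is the power of \<open>\<pi>\<close> with exponent \<open>p(\<nu>) choose 2\<close> in the coefficient of \<open>\<Omega>\<close>.\<close>
lemma antipode_word: "Om_coef D (count_list w) \<bullet> antipode Q (mns (monom_word w)) = Gw w"
proof (induction w)
  case Nil
  have "antipode Q (K 0) = K (- 0)" using is_antipode by (simp only: is_antipode_def)
  then show ?case by (simp add: count_list_Nil Om_coef_0 K_0)
next
  case (Cons j w)
  let ?S = "antipode Q" and ?s = "if odd (p j) \<and> odd (par D (count_list w)) then \<pi> else 1"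
  have F: "F j \<in> U_par D Q (odd (p j))"
    using U_parI[of "map gF [j]" "odd (p j)"] length_odd(2)[of "[j]"]
    unfolding par_single by (simp add: var_def)
  have X: "mns (monom_word w) \<in> U_par D Q (odd (par D (count_list w)))"
    unfolding mns_word by (rule U_parI) (simp only: length_odd)
  have "?S (F j * mns (monom_word w)) = U_scal Q ?s * ?S (mns (monom_word w)) * ?S (F j)"
    using is_antipode F X unfolding is_antipode_def by blast
  moreover have "?S (F j) = - (F j * Kp j)"
    using is_antipode by (simp add: is_antipode_def Kp_def)
  moreover have "?s = \<pi> ^ (p j * par D (count_list w))"
    using pari_cases[of D j] pi_power_cong[of "par D (count_list w)" 0]
      pi_power_cong[of "par D (count_list w)" 1] by auto
  ultimately have "?S (mns (monom_word (j # w))) =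
      (- (\<pi> ^ (p j * par D (count_list w)))) \<bullet> (?S (mns (monom_word w)) * (F j * Kp j))"
    by (simp add: monom_word_Cons)
  then have "Om_coef D (count_list (j # w)) \<bullet> ?S (mns (monom_word (j # w))) =
      (Om_coef D (inc j (count_list w)) * - (\<pi> ^ (p j * par D (count_list w)))) \<bullet>
        (?S (mns (monom_word w)) * (F j * Kp j))"
    by (simp only: count_list_Cons us_simps mult_minus_right)
  also have "Om_coef D (inc j (count_list w)) * - (\<pi> ^ (p j * par D (count_list w))) =
      (\<pi> ^ (p j * par D (count_list w)) * \<pi> ^ (p j * par D (count_list w))) *
        (Om_coef D (count_list w) * (pi_of D j * q_of D j))"
    by (simp add: Om_coef_inc ac_simps)
  also have "\<dots> \<bullet> (?S (mns (monom_word w)) * (F j * Kp j)) =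
      (Om_coef D (count_list w) \<bullet> ?S (mns (monom_word w))) * G j"
    by (simp add: pi_pow_cancel G_def ac_simps)
  also have "\<dots> = Gw (j # w)" unfolding Cons.IH by simp
  finally show ?case .
qed

lemma antipode_anti:
  assumes "x \<in> free_wt \<nu>"
  shows "Om_coef D \<nu> \<bullet> antipode Q (minus_hom Q (f_proj Q x)) = anti x"
  using assms unfolding mns_def[symmetric]
proof (induction rule: free_wt_induct)
  case zero
  have "is_additive (antipode Q)" using is_antipode by (simp add: is_antipode_def)
  then show ?case by (simp add: additive_zero)
next
  case (add x y)
  have "is_additive (antipode Q)" using is_antipode by (simp add: is_antipode_def)
  then show ?case using add by (simp add: additive_add us_add)
next
  case (monom c w)
  have "antipode Q (U_scal Q c * u) = U_scal Q c * antipode Q u" for u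
    using is_antipode by (simp add: is_antipode_def)
  then have "Om_coef D \<nu> \<bullet> antipode Q (mns (scal c * monom_word w)) =
      c \<bullet> (Om_coef D (count_list w) \<bullet> antipode Q (mns (monom_word w)))"
    using monom by (simp add: mult.commute)
  then show ?case by (simp only: antipode_word anti_simps)
qed

lemma anti_radical: "x \<in> free_wt \<nu> \<Longrightarrow> x \<in> radical (form Q) \<Longrightarrow> anti x = 0"
  using antipode_anti[of x \<nu>] antipode_anti[of 0 \<nu>] by (simp flip: f_proj_eq_0_iff)

lemma pls_radical: "x \<in> radical (form Q) \<Longrightarrow> pls x = 0"
  using pls_simps(1) unfolding pls_def f_proj_eq_0_iff[symmetric] by simp

end

section \<open>The weight components of the Casimir element\<close>

context supergroup_basis
begin

text \<open>On a fixed weight space \<open>anti\<close> factors through the half algebra, so it may be applied to the expansion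
  in the basis.\<close>
lemma anti_expand:
  assumes "x \<in> free_wt \<nu>"
  shows "anti x = (\<Sum>b\<in>Bw \<nu>. form Q x (rep \<nu> (star b)) \<bullet> anti (rep \<nu> b))"
proof -
  have s: "anti (sum g A) = (\<Sum>a\<in>A. anti (g a))" for g and A :: "'f set"
    by (induction A rule: infinite_finite_induct) simp_all
  have "x - (\<Sum>b\<in>Bw \<nu>. scal (form Q x (rep \<nu> (star b))) * rep \<nu> b) \<in> free_wt \<nu>"
    using assms rep(1) by (auto intro!: free_wt_diff free_wt_sum)
  from anti_radical[OF this free_wt_expand_radical[OF assms]] show ?thesis by (simp add: s)
qed

lemma pls_expand:
  assumes "y \<in> free_wt \<nu>"
  shows "pls y = (\<Sum>b\<in>Bw \<nu>. form Q (rep \<nu> b) y \<bullet> pls (rep \<nu> (star b)))"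
proof -
  have s: "pls (sum g A) = (\<Sum>a\<in>A. pls (g a))" for g and A :: "'f set"
    by (induction A rule: infinite_finite_induct) simp_all
  from pls_radical[OF free_wt_dual_expand_radical[OF assms]] show ?thesis by (simp add: s)
qed

text \<open>The image of the canonical tensor \<open>\<Sum> b \<otimes> b\<^sup>*\<close> of weight \<open>\<nu>\<close>, with a middle factor \<open>z\<close> inserted.
  The commutators with \<open>E\<^sub>i\<close> and \<open>F\<^sub>i\<close> lead to middle factors other than \<open>1\<close>.\<close>
definition Om :: "('i \<Rightarrow> nat) \<Rightarrow> 'u \<Rightarrow> 'u" where
  "Om \<nu> z = (\<Sum>b\<in>Bw \<nu>. anti (rep \<nu> b) * z * pls (rep \<nu> (star b)))"

text \<open>Expanding \<open>\<phi> b\<close> in the basis of weight \<open>\<mu>\<close> and \<open>\<psi> (b\<^sup>*)\<close> in the dual basis of weight \<open>\<nu>\<close>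
  turns both sides into the same double sum over the two bases.\<close>
lemma adjoint_sum:
  assumes "\<And>x. x \<in> free_wt \<nu> \<Longrightarrow> \<phi> x \<in> free_wt \<mu>" "\<And>y. y \<in> free_wt \<mu> \<Longrightarrow> \<psi> y \<in> free_wt \<nu>"
    and adj: "\<And>x y. x \<in> free_wt \<nu> \<Longrightarrow> y \<in> free_wt \<mu> \<Longrightarrow> form Q (\<phi> x) y = \<kappa> * form Q x (\<psi> y)"
  shows "(\<Sum>b\<in>Bw \<nu>. anti (\<phi> (rep \<nu> b)) * z * pls (rep \<nu> (star b))) =
    \<kappa> \<bullet> (\<Sum>b\<in>Bw \<mu>. anti (rep \<mu> b) * z * pls (\<psi> (rep \<mu> (star b))))"
proof -
  have r: "rep \<nu> b \<in> free_wt \<nu>" "rep \<nu> (star b) \<in> free_wt \<nu>" if "b \<in> Bw \<nu>" for b \<nu>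
    using that rep(1) star_f_wt by auto
  let ?t = "\<lambda>b b'. anti (rep \<mu> b') * z * pls (rep \<nu> (star b))"
  have "(\<Sum>b\<in>Bw \<nu>. anti (\<phi> (rep \<nu> b)) * z * pls (rep \<nu> (star b))) =
      (\<Sum>b\<in>Bw \<nu>. \<Sum>b'\<in>Bw \<mu>. form Q (\<phi> (rep \<nu> b)) (rep \<mu> (star b')) \<bullet> ?t b b')"
    using assms(1) r by (intro sum.cong refl) (simp add: anti_expand[of "\<phi> _" \<mu>] sum_distrib_right)
  also have "\<dots> = (\<Sum>b'\<in>Bw \<mu>. \<Sum>b\<in>Bw \<nu>. (\<kappa> * form Q (rep \<nu> b) (\<psi> (rep \<mu> (star b')))) \<bullet> ?t b b')"
    by (subst sum.swap) (intro sum.cong refl; simp add: adj r)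
  also have "\<dots> = (\<Sum>b'\<in>Bw \<mu>. \<kappa> \<bullet> (anti (rep \<mu> b') * z * pls (\<psi> (rep \<mu> (star b')))))"
    using assms(2) r by (intro sum.cong refl) (simp add: pls_expand[of "\<psi> _" \<nu>] sum_distrib_left us_sum)
  finally show ?thesis by (simp add: us_sum)
qed

lemma us_cancel: "c * d = 1 \<Longrightarrow> c \<bullet> u = c \<bullet> v \<Longrightarrow> u = v"
  by (metis mult.commute us_simps(2,4))

lemma pi_q_unit: "\<exists>d. (pi_of D i * q_of D i) * d = 1"
proof -
  have "(pi_of D i * q_of D i) * (pi_of D i * qq powi (- dd D i)) =
      (pi_of D i * pi_of D i) * (q_of D i * qq powi (- dd D i))" by (simp only: ac_simps)
  also have "\<dots> = 1" using powi_minus_unit[OF qq_unit] by (simp add: pi_of_squared q_of_def)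
  finally show ?thesis by blast
qed

text \<open>The next four lemmas move the derivations in the commutators across the canonical tensor, where
  they become multiplications by \<open>\<theta>\<^sub>i\<close> in weight \<open>\<nu>\<close>.\<close>
lemma gam_sum_rdr:
  "gam i \<bullet> (\<Sum>b\<in>Bw (inc i \<nu>). anti (rep (inc i \<nu>) b) * pls (rdr D i (rep (inc i \<nu>) (star b)))) =
    F i * Kp i * Om \<nu> 1" (is "gam i \<bullet> ?s = _")
proof -
  have "(\<Sum>b\<in>Bw \<nu>. anti (rep \<nu> b * var i) * 1 * pls (rep \<nu> (star b))) =
      beta i \<bullet> (\<Sum>b\<in>Bw (inc i \<nu>). anti (rep (inc i \<nu>) b) * 1 * pls (rdr D i (rep (inc i \<nu>) (star b))))"
    by (rule adjoint_sum) (simp_all add: var_mult_free_wt rdr_free_wt form_var_right)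
  then have "beta i \<bullet> ?s = G i * Om \<nu> 1"
    by (simp add: anti_var Om_def sum_distrib_left mult.assoc)
  then have "(pi_of D i * q_of D i) \<bullet> (gam i \<bullet> ?s) = (pi_of D i * q_of D i) \<bullet> (F i * Kp i * Om \<nu> 1)"
    using gam_beta[of i] by (simp add: G_def mult.commute)
  then show ?thesis using us_cancel pi_q_unit by blast
qed

lemma gam_sum_ldr:
  "gam i \<bullet> (\<Sum>b\<in>Bw (inc i \<nu>). anti (rep (inc i \<nu>) b) * Km i * pls (ldr D i (rep (inc i \<nu>) (star b)))) =
    Om \<nu> (F i)" (is "gam i \<bullet> ?s = _")
proof -
  have "(\<Sum>b\<in>Bw \<nu>. anti (var i * rep \<nu> b) * Km i * pls (rep \<nu> (star b))) = beta i \<bullet> ?s"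
    by (rule adjoint_sum) (simp_all add: var_mult_free_wt ldr_free_wt form_var_left)
  moreover have "anti x * G i * Km i = (pi_of D i * q_of D i) \<bullet> (anti x * F i)" for x
    by (simp add: G_def mult.assoc Kp_Km)
  ultimately have "beta i \<bullet> ?s = (pi_of D i * q_of D i) \<bullet> Om \<nu> (F i)"
    by (simp add: anti_var Om_def us_sum)
  then have "(pi_of D i * q_of D i) \<bullet> (gam i \<bullet> ?s) = (pi_of D i * q_of D i) \<bullet> Om \<nu> (F i)"
    using gam_beta[of i] by (simp add: mult.commute)
  then show ?thesis using us_cancel pi_q_unit by blast
qed

lemma beta_sum_rdr:
  "beta i \<bullet> (\<Sum>b\<in>Bw (inc i \<nu>). anti (rdr D i (rep (inc i \<nu>) b)) * pls (rep (inc i \<nu>) (star b))) =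
    Om \<nu> 1 * E i"
proof -
  let ?k = "1 - pi_of D i * q_of D i powi (- 2)"
  have "form Q (rdr D i x) y = ?k * form Q x (y * var i)" for x y
    using beta_unit[of i] by (simp add: form_sym[of _ y] form_sym[of x] form_var_right flip: mult.assoc)
  then have "(\<Sum>b\<in>Bw (inc i \<nu>). anti (rdr D i (rep (inc i \<nu>) b)) * 1 * pls (rep (inc i \<nu>) (star b))) =
      ?k \<bullet> (\<Sum>b\<in>Bw \<nu>. anti (rep \<nu> b) * 1 * pls (rep \<nu> (star b) * var i))"
    by (intro adjoint_sum) (simp_all only: var_mult_free_wt rdr_free_wt)
  then show ?thesis using beta_unit[of i]
    by (simp add: Om_def sum_distrib_right mult.assoc mult.commute[of "beta i"])
qed

lemma beta_sum_ldr:
  "beta i \<bullet> (\<Sum>b\<in>Bw (inc i \<nu>). anti (ldr D i (rep (inc i \<nu>) b)) * pls (rep (inc i \<nu>) (star b))) =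
    Om \<nu> (E i)"
proof -
  let ?k = "1 - pi_of D i * q_of D i powi (- 2)"
  have "form Q (ldr D i x) y = ?k * form Q x (var i * y)" for x y
    using beta_unit[of i] by (simp add: form_sym[of _ y] form_sym[of x] form_var_left flip: mult.assoc)
  then have "(\<Sum>b\<in>Bw (inc i \<nu>). anti (ldr D i (rep (inc i \<nu>) b)) * 1 * pls (rep (inc i \<nu>) (star b))) =
      ?k \<bullet> (\<Sum>b\<in>Bw \<nu>. anti (rep \<nu> b) * 1 * pls (var i * rep \<nu> (star b)))"
    by (intro adjoint_sum) (simp_all only: var_mult_free_wt ldr_free_wt)
  then show ?thesis using beta_unit[of i]
    by (simp add: Om_def mult.assoc mult.commute[of "beta i"])
qed

text \<open>The part of the commutator with the left derivation reproduces the first term for the smaller weight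
  \<open>\<nu>\<close>, with the opposite sign; the part with the right derivation is the diagonal term.\<close>
lemma Om_F:
  assumes e: "\<And>\<nu>. e * \<pi> powi dotw D i \<nu> = e"
  shows "e \<bullet> (Om (inc i \<nu>) 1 * F i) =
    e \<bullet> (\<pi> ^ (p i * par D (inc i \<nu>)) \<bullet> Om (inc i \<nu>) (F i) - \<pi> ^ (p i * par D \<nu>) \<bullet> Om \<nu> (F i)
      + F i * Kp i * Om \<nu> 1 * (Jp i * Kp i))"
proof -
  let ?\<nu> = "inc i \<nu>"
  let ?b = "\<lambda>b. rep ?\<nu> b" and ?s = "\<lambda>b. rep ?\<nu> (star b)"
  have r: "b \<in> Bw ?\<nu> \<Longrightarrow> ?s b \<in> free_wt ?\<nu>" for b using rep(1) star_f_wt by auto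
  have "e \<bullet> (Om ?\<nu> 1 * F i) = (\<Sum>b\<in>Bw ?\<nu>. anti (?b b) * (e \<bullet> (pls (?s b) * F i)))"
    by (simp add: Om_def sum_distrib_right us_sum mult.assoc)
  also have "\<dots> = (\<Sum>b\<in>Bw ?\<nu>. e \<bullet> (\<pi> ^ (p i * par D ?\<nu>) \<bullet> (anti (?b b) * F i * pls (?s b))
      + gam i \<bullet> (anti (?b b) * pls (rdr D i (?s b)) * (Jp i * Kp i))
      - \<pi> ^ (p i * (par D ?\<nu> + p i)) \<bullet> (gam i \<bullet> (anti (?b b) * Km i * pls (ldr D i (?s b))))))"
    by (intro sum.cong refl, subst pls_F[OF e r])
      (simp_all add: us_add us_diff distrib_left right_diff_distrib mult.assoc mult.commute[of "gam i"])
  also have "\<dots> = e \<bullet> (\<pi> ^ (p i * par D ?\<nu>) \<bullet> Om ?\<nu> (F i)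
      + (gam i \<bullet> (\<Sum>b\<in>Bw ?\<nu>. anti (?b b) * pls (rdr D i (?s b)))) * (Jp i * Kp i)
      - \<pi> ^ (p i * (par D ?\<nu> + p i)) \<bullet> (gam i \<bullet> (\<Sum>b\<in>Bw ?\<nu>. anti (?b b) * Km i * pls (ldr D i (?s b)))))"
    by (simp only: us_sum[symmetric] sum.distrib sum_subtractf Om_def sum_distrib_right us_simps)
  also have "\<pi> ^ (p i * (par D ?\<nu> + p i)) = \<pi> ^ (p i * par D \<nu>)"
    by (rule pi_power_cong) (use pari_cases[of D i] in auto)
  finally show ?thesis unfolding gam_sum_rdr gam_sum_ldr by (simp add: algebra_simps us_add us_diff)
qed

lemma Om_F_0: "\<nu> i = 0 \<Longrightarrow> (\<And>\<nu>. e * \<pi> powi dotw D i \<nu> = e) \<Longrightarrow>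
    e \<bullet> (Om \<nu> 1 * F i) = e \<bullet> \<pi> ^ (p i * par D \<nu>) \<bullet> Om \<nu> (F i)"
proof -
  assume \<nu>: "\<nu> i = 0" and e: "\<And>\<nu>. e * \<pi> powi dotw D i \<nu> = e"
  let ?s = "\<lambda>b. rep \<nu> (star b)"
  have r: "b \<in> Bw \<nu> \<Longrightarrow> ?s b \<in> free_wt \<nu>" for b using rep(1) star_f_wt by auto
  have "e \<bullet> (Om \<nu> 1 * F i) = (\<Sum>b\<in>Bw \<nu>. anti (rep \<nu> b) * (e \<bullet> (pls (?s b) * F i)))"
    by (simp add: Om_def sum_distrib_right us_sum mult.assoc)
  also have "\<dots> = (\<Sum>b\<in>Bw \<nu>. e \<bullet> \<pi> ^ (p i * par D \<nu>) \<bullet> (anti (rep \<nu> b) * F i * pls (?s b)))"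
    by (intro sum.cong refl, subst pls_F[OF e r])
      (simp_all add: ldr_eq_0[OF r \<nu>] rdr_eq_0[OF r \<nu>] mult.assoc)
  finally show ?thesis by (simp add: Om_def us_sum)
qed

lemma E_Om:
  assumes e: "\<And>\<nu>. e * \<pi> powi dotw D i \<nu> = e"
  shows "e \<bullet> (E i * Om (inc i \<nu>) 1) =
    e \<bullet> ((\<pi> ^ (p i * par D (inc i \<nu>)) * qq powi (- dotw D i (inc i \<nu>))) \<bullet> Om (inc i \<nu>) (E i)
      - (\<pi> ^ (p i * par D \<nu>) * qq powi (- dotw D i \<nu>)) \<bullet> Om \<nu> (E i)
      + Jp i * Kp i * Kp i * Om \<nu> 1 * E i)"
proof -
  let ?\<nu> = "inc i \<nu>"
  let ?b = "\<lambda>b. rep ?\<nu> b" and ?s = "\<lambda>b. pls (rep ?\<nu> (star b))"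
  let ?c = "\<pi> ^ (p i * par D ?\<nu>) * qq powi (- dotw D i ?\<nu>)"
  let ?d = "\<pi> ^ (p i * (par D ?\<nu> + p i)) * qq powi (dot D i i - dotw D i ?\<nu>)"
  have r: "b \<in> Bw ?\<nu> \<Longrightarrow> ?b b \<in> free_wt ?\<nu>" for b using rep(1) by auto
  have "e \<bullet> (E i * Om ?\<nu> 1) = (\<Sum>b\<in>Bw ?\<nu>. (e \<bullet> (E i * anti (?b b))) * ?s b)"
    by (simp add: Om_def sum_distrib_left us_sum mult.assoc)
  also have "\<dots> = (\<Sum>b\<in>Bw ?\<nu>. e \<bullet> (?c \<bullet> (anti (?b b) * E i * ?s b)
      + beta i \<bullet> (Jp i * Kp i * Kp i * (anti (rdr D i (?b b)) * ?s b))
      - ?d \<bullet> (beta i \<bullet> (anti (ldr D i (?b b)) * ?s b))))"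
    by (intro sum.cong refl, subst E_anti[OF e r])
      (simp_all add: us_add us_diff distrib_right left_diff_distrib mult.assoc mult.left_commute[of "beta i"] mult.commute[of "beta i"])
  also have "\<dots> = e \<bullet> (?c \<bullet> Om ?\<nu> (E i)
      + Jp i * Kp i * Kp i * (beta i \<bullet> (\<Sum>b\<in>Bw ?\<nu>. anti (rdr D i (?b b)) * ?s b))
      - ?d \<bullet> (beta i \<bullet> (\<Sum>b\<in>Bw ?\<nu>. anti (ldr D i (?b b)) * ?s b)))"
    by (simp only: us_sum[symmetric] sum.distrib sum_subtractf Om_def sum_distrib_left us_simps)
  also have "\<pi> ^ (p i * (par D ?\<nu> + p i)) = \<pi> ^ (p i * par D \<nu>)"
    by (rule pi_power_cong) (use pari_cases[of D i] in auto)
  finally show ?thesis unfolding beta_sum_rdr beta_sum_ldr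
    by (simp add: algebra_simps us_add us_diff mult.assoc)
qed

lemma E_Om_0: "\<nu> i = 0 \<Longrightarrow> (\<And>\<nu>. e * \<pi> powi dotw D i \<nu> = e) \<Longrightarrow>
    e \<bullet> (E i * Om \<nu> 1) = e \<bullet> (\<pi> ^ (p i * par D \<nu>) * qq powi (- dotw D i \<nu>)) \<bullet> Om \<nu> (E i)"
proof -
  assume \<nu>: "\<nu> i = 0" and e: "\<And>\<nu>. e * \<pi> powi dotw D i \<nu> = e"
  have r: "b \<in> Bw \<nu> \<Longrightarrow> rep \<nu> b \<in> free_wt \<nu>" for b using rep(1) by auto
  have "e \<bullet> (E i * Om \<nu> 1) = (\<Sum>b\<in>Bw \<nu>. (e \<bullet> (E i * anti (rep \<nu> b))) * pls (rep \<nu> (star b)))"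
    by (simp add: Om_def sum_distrib_left us_sum mult.assoc)
  also have "\<dots> = (\<Sum>b\<in>Bw \<nu>. e \<bullet> (\<pi> ^ (p i * par D \<nu>) * qq powi (- dotw D i \<nu>)) \<bullet>
      (anti (rep \<nu> b) * E i * pls (rep \<nu> (star b))))"
    by (intro sum.cong refl, subst E_anti[OF e r])
      (simp_all add: ldr_eq_0[OF r \<nu>] rdr_eq_0[OF r \<nu>] mult.assoc)
  finally show ?thesis by (simp add: Om_def us_sum)
qed

text \<open>In weight \<open>0\<close> all vectors are scalars, and the sum is the expansion of \<open>1\<close> in the basis.\<close>
lemma Om_0: "Om (\<lambda>_. 0) 1 = 1"
proof -
  have 1: "1 \<in> free_wt (\<lambda>_. 0)" using free_wt_simps(5)[of "[]" "\<lambda>_. 0"] by (simp add: count_list_Nil)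
  have scalar: "\<exists>c. x = scal c" if "x \<in> free_wt (\<lambda>_. 0)" for x :: "'i free_alg"
    using that
  proof (induction rule: free_wt_induct)
    case (monom c w)
    then show ?case by (auto simp: count_list_eq_0_iff)
  qed (metis scal_simps(1), metis scal_simps(3))
  have "anti (rep (\<lambda>_. 0) b) * 1 * pls (rep (\<lambda>_. 0) (star b)) =
      form Q 1 (rep (\<lambda>_. 0) (star b)) \<bullet> anti (rep (\<lambda>_. 0) b)" if b: "b \<in> Bw (\<lambda>_. 0)" for b
  proof -
    obtain c where "rep (\<lambda>_. 0) (star b) = scal c * 1"
      using scalar[OF rep(1)[OF star_f_wt[OF b]]] by auto
    then show ?thesis using bl_Nil_Nil form_simps(6)[of 1 c 1] by (simp add: U_scal_commute[symmetric])
  qed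
  then have "Om (\<lambda>_. 0) 1 = anti 1"
    unfolding Om_def anti_expand[OF 1] by (intro sum.cong) auto
  then show ?thesis using anti_simps(5)[of "[]"] by simp
qed

end

lemma mult_scal: "var i * (scal c * y) = scal c * (var i * y)"
  by (simp only: mult.assoc[symmetric] scal_commute[of c "var i"])

lemma scal_scal: "scal c * (scal d * y) = scal (c * d) * y"
  by (simp only: scal_mult mult.assoc)

section \<open>Weight modules\<close>

lemma direct_sum_induct:
  assumes "direct_sum_on C A" "P 0" "\<And>x y. P x \<Longrightarrow> P y \<Longrightarrow> P (x + y)"
    "\<And>l x. l \<in> C \<Longrightarrow> x \<in> A l \<Longrightarrow> P x"
  shows "P m"
proof -
  obtain f where f: "\<forall>l\<in>C. f l \<in> A l" "\<forall>l. l \<notin> C \<longrightarrow> f l = 0" "m = (\<Sum>l | f l \<noteq> 0. f l)"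
    using assms(1) unfolding direct_sum_on_def by (elim allE[of _ m] ex1E) blast
  have "P (\<Sum>l\<in>S. f l)" for S
  proof (induction S rule: infinite_finite_induct)
    case (insert l S)
    have "P (f l)" using f(1,2) assms(2,4) by (cases "l \<in> C") auto
    then show ?case using insert assms(3) by simp
  qed (simp_all add: assms(2))
  then show ?thesis using f(3) by simp
qed

lemma xwt_inc:
  fixes D :: "('i::finite, 'y, 'x::ab_group_add) root_data"
  shows "xwt D (inc i \<nu>) = xmap D i + xwt D \<nu>"
proof -
  have s: "int_mult (int (Suc n)) x = x + int_mult (int n) x" for n and x :: 'x
    by (simp add: int_mult_def nat_add_distrib)
  have "xwt D (inc i \<nu>) = (\<Sum>j\<in>UNIV. (if j = i then xmap D i else 0) + int_mult (int (\<nu> j)) (xmap D j))"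
    unfolding xwt_def by (intro sum.cong) (auto simp: inc_def s simp del: of_nat_Suc)
  then show ?thesis by (simp add: sum.distrib xwt_def)
qed

lemma xwt_0: "xwt D (\<lambda>_. 0) = 0"
  by (simp add: xwt_def int_mult_def)

locale supergroup_module = supergroup D Q
  for D :: "('i::finite, 'y::ab_group_add, 'x::ab_group_add) root_data"
    and Q :: "('i, 'y, 'f::ring_1, 'u::ring_1) quantum_data" +
  fixes act :: "'u \<Rightarrow> 'm::ab_group_add \<Rightarrow> 'm"
  assumes um: "U_module act"
begin

abbreviation sc :: "qpi \<Rightarrow> 'm \<Rightarrow> 'm" where "sc \<equiv> scale Q act"
abbreviation wt :: "'x \<Rightarrow> 'm set" where "wt \<equiv> weight_space D Q act"
abbreviation pair :: "'i \<Rightarrow> 'x \<Rightarrow> int" where "pair i \<equiv> pairing D (ymap D i)"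

lemma act_simps [simp]:
  "act 1 m = m" "act 0 m = 0" "act u 0 = 0" "act (u * v) m = act u (act v m)"
  "act (u + v) m = act u m + act v m" "act (u - v) m = act u m - act v m" "act (- u) m = - act u m"
  "act u (m + n) = act u m + act u n" "act u (m - n) = act u m - act u n" "act u (- m) = - act u m"
  using um additive_zero[of "act u"] additive_zero[of "\<lambda>u. act u m"]
    additive_diff[of "act u"] additive_diff[of "\<lambda>u. act u m"]
    additive_minus[of "act u"] additive_minus[of "\<lambda>u. act u m"]
  by (auto simp: U_module_def is_additive_def)

lemma act_sum: "act u (sum g A) = (\<Sum>a\<in>A. act u (g a))" "act (sum h A) m = (\<Sum>a\<in>A. act (h a) m)"
  by (induction A rule: infinite_finite_induct) simp_all

lemma act_us [simp]: "act (c \<bullet> u) m = sc c (act u m)"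
  by (simp add: us_def scale_def del: us_fold)

lemma act_sc: "act u (sc c m) = sc c (act u m)"
  by (simp only: scale_def act_simps(4)[symmetric] U_scal_commute[of c u])

lemma sc_simps [simp]:
  "sc 0 m = 0" "sc 1 m = m" "sc c 0 = 0" "sc c (sc d m) = sc (c * d) m" "sc (- c) m = - sc c m"
  "sc c (m + n) = sc c m + sc c n" "sc c (m - n) = sc c m - sc c n" "sc c (- m) = - sc c m"
  by (simp_all add: scale_def U_scal_simps)

lemma sc_add_left: "sc (c + d) m = sc c m + sc d m"
  and sc_diff_left: "sc (c - d) m = sc c m - sc d m"
  by (simp_all add: scale_def U_scal_simps)

lemma sc_sum: "sc c (sum g A) = (\<Sum>a\<in>A. sc c (g a))"
  by (simp add: scale_def act_sum)

lemma act_U_scal [simp]: "act (U_scal Q c) m = sc c m"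
  by (simp add: scale_def)

lemma sc_cancel: "c * d = 1 \<Longrightarrow> sc c m = sc c n \<Longrightarrow> m = n"
  by (metis mult.commute sc_simps(2,4))

lemma qpi_decompose: "c = of_Qq (coeff_one c) + of_Qq (coeff_pi c) * \<pi>"
  by (simp add: of_Qq_def \<pi>_def plus_qpi_def times_qpi_def)

text \<open>On the component \<open>\<pi> = s\<close> of a module all scalars act through \<open>\<rat>(q)\<close>.\<close>
lemma sc_at_pi:
  assumes "sc \<pi> v = sc (of_Qq s) v"
  shows "sc c v = sc (of_Qq (at_pi s c)) v"
proof -
  have "sc c v = sc (of_Qq (coeff_one c)) v + sc (of_Qq (coeff_pi c)) (sc \<pi> v)"
    by (subst qpi_decompose[of c]) (simp add: sc_add_left)
  then show ?thesis unfolding assms by (simp add: at_pi_def sc_add_left mult.commute)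
qed

lemma sc_of_Qq_eq_0: "sc (of_Qq a) v = 0 \<Longrightarrow> a \<noteq> 0 \<Longrightarrow> v = 0"
proof -
  assume a: "sc (of_Qq a) v = 0" "a \<noteq> 0"
  have "of_Qq a * of_Qq (inverse a) = 1" using a(2) by (simp flip: of_Qq_simps)
  then show "v = 0" using sc_cancel[of "of_Qq a" _ v 0] a(1) by simp
qed

lemma wt_simps [simp]: "0 \<in> wt l" "m \<in> wt l \<Longrightarrow> n \<in> wt l \<Longrightarrow> m + n \<in> wt l"
  "m \<in> wt l \<Longrightarrow> sc c m \<in> wt l"
  by (auto simp: weight_space_def act_sc mult.commute)

lemma wt_sum: "(\<And>a. a \<in> A \<Longrightarrow> g a \<in> wt l) \<Longrightarrow> sum g A \<in> wt l"
  by (induction A rule: infinite_finite_induct) auto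

lemma pairing_add: "pairing D \<mu> (a + b) = pairing D \<mu> a + pairing D \<mu> b"
  "pairing D \<mu> (a - b) = pairing D \<mu> a - pairing D \<mu> b"
  using additive_add[OF pairing_additive(2)] additive_diff[OF pairing_additive(2)] by auto

lemma wt_E:
  assumes "m \<in> wt l"
  shows "act (E i) m \<in> wt (l + xmap D i)"
proof -
  have "act (K \<mu>) (act (E i) m) = act (K \<mu> * E i) m"
    "act (J \<mu>) (act (E i) m) = act (J \<mu> * E i) m" for \<mu> by simp_all
  then show ?thesis using assms
    by (simp only: K_E J_E)
      (simp add: weight_space_def act_sc pairing_add qq_powi_add pi_powi_add mult.commute)
qed

lemma wt_F:
  assumes "m \<in> wt l"
  shows "act (F i) m \<in> wt (l - xmap D i)"
proof -
  have "act (K \<mu>) (act (F i) m) = act (K \<mu> * F i) m"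
    "act (J \<mu>) (act (F i) m) = act (J \<mu> * F i) m" for \<mu> by simp_all
  moreover have "qq powi (a - b) = qq powi (- b) * qq powi a" "\<pi> powi (a - b) = \<pi> powi (- b) * \<pi> powi a" for a b
    by (simp_all flip: qq_powi_add pi_powi_add)
  ultimately show ?thesis using assms
    by (simp only: K_F J_F) (simp add: weight_space_def act_sc pairing_add)
qed

lemma wt_K:
  assumes "m \<in> wt l"
  shows "act (K \<mu>) m = sc (qq powi pairing D \<mu> l) m" "act (J \<mu>) m = sc (\<pi> powi pairing D \<mu> l) m"
  using assms by (auto simp: weight_space_def)

lemma wt_Kp:
  assumes "m \<in> wt l"
  shows "act (Kp i) m = sc (qq powi (dd D i * pair i l)) m" "act (Km i) m = sc (qq powi (- (dd D i * pair i l))) m"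
    "act (Jp i) m = sc (\<pi> powi (dd D i * pair i l)) m"
  using wt_K[OF assms] pairing_ymap[of 1 i l] pairing_ymap[of "- 1" i l]
  by (simp_all add: Kp_def Km_def Jp_def Kt_def Jt_def)

lemma wt_pls: "x \<in> free_wt \<nu> \<Longrightarrow> m \<in> wt l \<Longrightarrow> act (pls x) m \<in> wt (l + xwt D \<nu>)"
proof (induction x rule: free_wt_induct)
  case (monom c w)
  have "act (pls (monom_word w)) m \<in> wt (l + xwt D (count_list w))"
  proof (induction w)
    case (Cons i w)
    from wt_E[OF this, of i] show ?case
      by (simp add: count_list_Cons xwt_inc pls_word_Cons ac_simps del: count_list.simps)
  qed (simp add: count_list_Nil xwt_0 monom)
  then show ?case using monom by simp
qed simp_all

lemma wt_anti: "x \<in> free_wt \<nu> \<Longrightarrow> m \<in> wt l \<Longrightarrow> act (anti x) m \<in> wt (l - xwt D \<nu>)"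
proof (induction x rule: free_wt_induct)
  case (monom c w)
  have "act (Gw w) m \<in> wt (l - xwt D (count_list w))" if "m \<in> wt l" for m l
    using that
  proof (induction w arbitrary: m l)
    case (Cons i w)
    have "act (G i) m \<in> wt (l - xmap D i)"
      using Cons.prems by (simp add: G_def wt_Kp(1)[OF Cons.prems] act_sc wt_F)
    from Cons.IH[OF this] show ?case
      by (simp add: count_list_Cons xwt_inc algebra_simps del: count_list.simps)
  qed (simp add: count_list_Nil xwt_0)
  then show ?case using monom by simp
qed simp_all

end

section \<open>The case of an odd \<open>i \<cdot> j\<close>\<close>

context supergroup
begin

text \<open>Iterated \<open>q\<close>-commutators of \<open>\<theta>\<^sub>i\<close> with \<open>\<theta>\<^sub>j\<close>.  For \<open>k = 1 - \<langle>i, j'\<rangle>\<close> this is the quantum Serre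
  element.\<close>
fun serre :: "'i \<Rightarrow> 'i \<Rightarrow> nat \<Rightarrow> 'i free_alg" where
  "serre i j 0 = var j"
| "serre i j (Suc k) = var i * serre i j k -
     scal (qq powi (dot D i j + int k * dot D i i)) * (serre i j k * var i)"

fun serre_wt :: "'i \<Rightarrow> 'i \<Rightarrow> nat \<Rightarrow> 'i \<Rightarrow> nat" where
  "serre_wt i j 0 = inc j (\<lambda>_. 0)"
| "serre_wt i j (Suc k) = inc i (serre_wt i j k)"

lemma serre_free_wt: "serre i j k \<in> free_wt (serre_wt i j k)"
  by (induction k) (use var_mult_free_wt(1)[of 1 "\<lambda>_. 0" j] free_wt_simps(5)[of "[]" "\<lambda>_. 0"] in
      \<open>simp_all add: var_mult_free_wt count_list_Nil\<close>)

lemma dotw_serre_wt: "dotw D i (serre_wt i j k) = dot D i j + int k * dot D i i"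
  by (induction k) (simp_all add: algebra_simps)

lemma ldr_var_mult: "ldr D l (var i * x) = (if l = i then x else 0) +
    scal (qq powi dot D i l * \<pi> ^ (p i * p l)) * (var i * ldr D l x)"
proof (induction x rule: free_alg_induct)
  case (monom c w)
  have "var i * (scal c * monom_word w) = scal c * monom_word (i # w)"
    by (simp add: monom_word_Cons mult_scal)
  then show ?case by (simp add: distrib_left mult_scal scal_scal mult.commute[where 'a = qpi])
qed (simp_all add: distrib_left)

lemma ldr_mult_var: "x \<in> free_wt \<nu> \<Longrightarrow> ldr D l (x * var i) = ldr D l x * var i +
    (if l = i then scal (braid D l \<nu>) * x else 0)"
proof (induction x rule: free_wt_induct)
  case (monom c w)
  have "ldr_word D l (w @ [i]) = ldr_word D l w * var i +
    (if l = i then scal (braid D l (count_list w)) * monom_word w else 0)"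
  proof (induction w)
    case Nil
    then show ?case by (simp add: count_list_Nil braid_simps)
  next
    case (Cons j w)
    show ?case using Cons
      by (simp add: monom_word_append monom_word_Cons var_def[symmetric] count_list_Cons braid_simps distrib_left
          distrib_right mult.assoc mult_scal scal_scal dot_sym[of j l] mult.commute[of "p j"] del: count_list.simps)
  qed
  moreover have "scal c * monom_word w * var i = scal c * monom_word (w @ [i])"
    by (simp add: monom_word_append var_def mult.assoc)
  ultimately show ?case using monom
    by (auto simp: distrib_left mult.assoc scal_scal mult.commute[where 'a = qpi])
qed (auto simp: algebra_simps)

lemma serre_scalar: "qq powi (dot D i j + int k * dot D i i) = qq powi dot D i j * (qq powi dot D i i) ^ k"
  by (simp add: qq_powi_add powi_mult_unit[OF qq_unit])

lemma ldr_var: "ldr D l (var j) = (if l = j then 1 else 0)"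
  by (simp add: var_def)

text \<open>For an index other than \<open>i\<close>, the \<open>q\<close>-commutator is normalised such that the two contributions of
  \<open>\<theta>\<^sub>j\<close> cancel in the first step; afterwards there is nothing left.\<close>
lemma ldr_serre_other:
  assumes "p i = 0" "l \<noteq> i"
  shows "ldr D l (serre i j (Suc k)) = 0"
proof (induction k)
  case 0
  have "var j \<in> free_wt (inc j (\<lambda>_. 0))" using serre_free_wt[of i j 0] by simp
  from ldr_mult_var[OF this, of l i] show ?case using assms
    by (simp add: ldr_var_mult ldr_var)
next
  case (Suc k)
  have "ldr D l (serre i j (Suc k) * var i) = 0"
    using ldr_mult_var[OF serre_free_wt[of i j "Suc k"], of l i] Suc assms by (simp del: serre.simps)
  then show ?case using Suc assms
    by (subst serre.simps) (simp add: ldr_var_mult del: serre.simps)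
qed

text \<open>The factor vanishes for \<open>k = - \<langle>i, j'\<rangle>\<close>, where \<open>b\<^sup>2 x\<^sup>k = 1\<close>.\<close>
lemma ldr_serre_same:
  fixes i j
  defines "b \<equiv> qq powi dot D i j" and "x \<equiv> qq powi dot D i i"
  assumes "p i = 0" "i \<noteq> j"
  shows "ldr D i (serre i j (Suc k)) = scal ((1 - b * b * x ^ k) * (\<Sum>l\<le>k. x ^ l)) * serre i j k"
proof (induction k)
  case 0
  have "var j \<in> free_wt (inc j (\<lambda>_. 0))" using serre_free_wt[of i j 0] by simp
  from ldr_mult_var[OF this, of i i] show ?case using assms(3,4)
    by (simp add: ldr_var_mult ldr_var braid_simps b_def scal_scal left_diff_distrib)
next
  case (Suc k)
  let ?c = "\<lambda>k. (1 - b * b * x ^ k) * (\<Sum>l\<le>k. x ^ l)"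
  let ?y = "serre i j k" and ?z = "serre i j (Suc k)"
  have z: "var i * ?y = ?z + scal (b * x ^ k) * (?y * var i)"
    by (simp add: serre_scalar b_def x_def)
  have br: "braid D i (serre_wt i j (Suc k)) = b * x ^ Suc k"
    using dotw_serre_wt[of i j "Suc k"] assms(3)
    by (simp add: braid_def serre_scalar b_def x_def del: of_nat_Suc serre_wt.simps)
  have "ldr D i (serre i j (Suc (Suc k))) = ?z + scal x * (var i * (scal (?c k) * ?y)) -
      scal (b * x ^ Suc k) * (scal (?c k) * ?y * var i + scal (b * x ^ Suc k) * ?z)"
    using ldr_mult_var[OF serre_free_wt[of i j "Suc k"], of i i] assms(3)
    unfolding serre.simps(2)[of i j "Suc k"] ldr_simps ldr_var_mult serre_scalar b_def[symmetric]
      x_def[symmetric] Suc.IH br by (simp del: serre.simps)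
  also have "\<dots> = scal (1 - b * x ^ Suc k * (b * x ^ Suc k) + x * ?c k) * ?z"
    unfolding mult_scal z
    by (simp add: distrib_left right_diff_distrib scal_scal mult.assoc left_diff_distrib distrib_right
        mult.commute mult.left_commute del: serre.simps)
  also have "1 - b * x ^ Suc k * (b * x ^ Suc k) + x * ?c k = ?c (Suc k)"
  proof -
    let ?g = "\<Sum>l\<le>k. x ^ l"
    \<comment> \<open>The geometric sum is extended at its lower end in one place and at its upper end in the other.\<close>
    have g: "(\<Sum>l\<le>Suc k. x ^ l) = 1 + x * ?g"
      by (simp add: sum.atMost_Suc_shift sum_distrib_left del: sum.atMost_Suc)
    have g': "1 + x * ?g = ?g + x ^ Suc k" using g by simp
    have "?c (Suc k) = (1 + x * ?g) - b * b * x ^ Suc k * (1 + x * ?g)"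
      unfolding g by (simp only: left_diff_distrib mult_1)
    also have "\<dots> = (1 + x * ?g) - b * b * x ^ Suc k * (?g + x ^ Suc k)"
      by (simp only: g')
    finally have c: "?c (Suc k) = (1 + x * ?g) - b * b * x ^ Suc k * (?g + x ^ Suc k)" .
    show ?thesis unfolding c by (simp add: algebra_simps)
  qed
  finally show ?case .
qed

text \<open>If \<open>i\<close> is odd, then \<open>\<langle>i, j'\<rangle>\<close> is even by the definition of a super Cartan datum, and so is
  \<open>i \<cdot> j = d\<^sub>i \<langle>i, j'\<rangle>\<close>.\<close>
lemma odd_dot_even_parity:
  assumes "odd (dot D i j)"
  shows "p i = 0" "odd (dd D i)" "odd (pairing D (ymap D i) (xmap D j))" "i \<noteq> j"
proof -
  have "odd (dd D i * pairing D (ymap D i) (xmap D j))" using assms by (simp add: dd_pairing)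
  then show o: "odd (dd D i)" "odd (pairing D (ymap D i) (xmap D j))" by simp_all
  have "i \<in> odd_part D \<Longrightarrow> even (pairing D (ymap D i) (xmap D j))"
    using rd by (auto simp: root_datum_def super_cartan_datum_def)
  then show "p i = 0" using o by (auto simp: pari_def)
  show "i \<noteq> j" using assms dot_self[of i] by auto
qed

lemma serre_relation:
  assumes "odd (dot D i j)"
  obtains m where "pls (serre i j (Suc m)) = 0"
proof -
  note o = odd_dot_even_parity[OF assms]
  have "pairing D (ymap D i) (xmap D j) \<le> 0"
    using rd o(4) by (simp add: root_datum_def super_cartan_datum_def)
  then obtain m where m: "pairing D (ymap D i) (xmap D j) = - int m"
    by (metis minus_minus nonpos_int_cases)
  have "qq powi dot D i j * qq powi dot D i j * (qq powi dot D i i) ^ m =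
      qq powi (dot D i j + dot D i j + int m * dot D i i)"
    by (simp only: qq_powi_add powi_mult_unit[OF qq_unit])
  also have "dot D i j + dot D i j + int m * dot D i i = 0"
    using dd_pairing[of i j] m dot_self[of i] by (simp add: algebra_simps)
  finally have "ldr D i (serre i j (Suc m)) = 0"
    unfolding ldr_serre_same[OF o(1,4)] by simp
  then have "ldr D l (serre i j (Suc m)) = 0" for l
    using ldr_serre_other[OF o(1)] by metis
  moreover have "Poly_Mapping.lookup (serre i j (Suc m)) [] = 0"
  proof (rule ccontr)
    assume "Poly_Mapping.lookup (serre i j (Suc m)) [] \<noteq> 0"
    then have "count_list [] = serre_wt i j (Suc m)"
      using serre_free_wt[of i j "Suc m"] unfolding free_wt_def by (auto simp: in_keys_iff simp del: serre.simps)
    then show False by (auto simp: inc_def dest: fun_cong[of _ _ i])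
  qed
  ultimately have "pls (serre i j (Suc m)) = 0"
    by (intro pls_radical radical_if_ldr_eq_0)
  then show ?thesis by (rule that)
qed

text \<open>In the commutator of the iterated \<open>q\<close>-commutators with \<open>F\<^sub>j\<close> the contribution of \<open>K\<^sub>j\<^sup>-\<^sup>1\<close>
  drops out at the first step, by the choice of the powers of \<open>q\<close>.  The contribution of \<open>J\<^sub>j K\<^sub>j\<close>
  gets a factor \<open>1 - \<pi>\<^bsup>i \<cdot> j\<^esup> q\<^sup>n\<close> in each step.  For odd \<open>i \<cdot> j\<close> none of these factors vanishes
  at \<open>\<pi> = -1\<close>.\<close>
lemma serre_F:
  fixes i j
  defines "b \<equiv> qq powi dot D i j" and "x \<equiv> qq powi dot D i i" and "P \<equiv> \<pi> powi dot D i j"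
  assumes p: "p i = 0" "p j = 0" and "i \<noteq> j"
  shows "pls (serre i j (Suc k)) * F j = F j * pls (serre i j (Suc k)) +
    (gam j * (\<Prod>l\<le>k. 1 - b * x ^ l * (P * b))) \<bullet> (E i ^ Suc k * (Jp j * Kp j))"
proof (induction k)
  case 0
  have EiF: "E i * F j = F j * E i" using E_F[of i j] p assms(6) by simp
  have EjF: "E j * F j = F j * E j + gam j \<bullet> (Jp j * Kp j - Km j)" using E_F[of j j] p by simp
  have H: "Jp j * Kp j * E i = (P * b) \<bullet> (E i * (Jp j * Kp j))"
    using HP_E[of j i] by (simp only: P_def b_def dot_sym[of j i])
  have K: "E i * Km j = b \<bullet> (Km j * E i)" using E_Km[of i j] by (simp only: b_def dot_sym[of j i])
  have 1: "E i * E j * F j = F j * (E i * E j) + gam j \<bullet> (E i * (Jp j * Kp j) - b \<bullet> (Km j * E i))"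
  proof -
    have "E i * E j * F j = (E i * F j) * E j + gam j \<bullet> (E i * (Jp j * Kp j) - E i * Km j)"
      by (simp only: mult.assoc EjF distrib_left us_simps right_diff_distrib)
    then show ?thesis unfolding EiF K by (simp only: mult.assoc)
  qed
  have 2: "E j * E i * F j = F j * (E j * E i) + gam j \<bullet> ((P * b) \<bullet> (E i * (Jp j * Kp j)) - Km j * E i)"
  proof -
    have "E j * E i * F j = (E j * F j) * E i" by (simp only: mult.assoc EiF)
    also have "\<dots> = F j * E j * E i + gam j \<bullet> (Jp j * Kp j * E i - Km j * E i)"
      by (simp only: EjF distrib_right us_simps left_diff_distrib)
    finally show ?thesis unfolding H by (simp only: mult.assoc)
  qed
  have "pls (serre i j (Suc 0)) * F j = E i * E j * F j - b \<bullet> (E j * E i * F j)"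
    by (simp add: b_def left_diff_distrib)
  also have "\<dots> = F j * (E i * E j - b \<bullet> (E j * E i)) + (gam j * (1 - b * (P * b))) \<bullet> (E i * (Jp j * Kp j))"
    unfolding 1 2 by (simp add: us_add us_diff right_diff_distrib us_diff_left) (simp add: ac_simps)
  finally show ?case by (simp add: b_def)
next
  case (Suc k)
  let ?Y = "pls (serre i j (Suc k))" and ?t = "gam j * (\<Prod>l\<le>k. 1 - b * x ^ l * (P * b))"
  let ?H = "Jp j * Kp j" and ?s = "b * x ^ Suc k"
  have EiF: "E i * F j = F j * E i" using E_F[of i j] p assms(6) by simp
  have H: "?H * E i = (P * b) \<bullet> (E i * ?H)"
    using HP_E[of j i] by (simp only: P_def b_def dot_sym[of j i])
  have Y: "pls (serre i j (Suc (Suc k))) = E i * ?Y - ?s \<bullet> (?Y * E i)"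
    unfolding serre.simps(2)[of i j "Suc k"] serre_scalar by (simp add: b_def x_def del: serre.simps)
  have "pls (serre i j (Suc (Suc k))) * F j = E i * (?Y * F j) - ?s \<bullet> (?Y * (E i * F j))"
    unfolding Y by (simp only: left_diff_distrib us_simps mult.assoc)
  also have "?Y * (E i * F j) = (?Y * F j) * E i" by (simp only: EiF mult.assoc)
  also have "(?Y * F j) * E i = F j * (?Y * E i) + ?t \<bullet> (E i ^ Suc k * (?H * E i))"
    unfolding Suc.IH by (simp only: distrib_right us_simps mult.assoc)
  also have "E i ^ Suc k * (?H * E i) = (P * b) \<bullet> (E i ^ Suc (Suc k) * ?H)"
    unfolding H us_simps power_Suc2[of "E i" "Suc k"] by (simp only: mult.assoc)
  also have "E i * (?Y * F j) = F j * (E i * ?Y) + ?t \<bullet> (E i ^ Suc (Suc k) * ?H)"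
    unfolding Suc.IH distrib_left us_simps power_Suc[of "E i" "Suc k"]
    by (simp only: mult.assoc[symmetric] EiF)
  also have "F j * (E i * ?Y) + ?t \<bullet> (E i ^ Suc (Suc k) * ?H) -
      ?s \<bullet> (F j * (?Y * E i) + ?t \<bullet> (P * b) \<bullet> (E i ^ Suc (Suc k) * ?H)) =
      F j * (E i * ?Y - ?s \<bullet> (?Y * E i)) + (?t * (1 - ?s * (P * b))) \<bullet> (E i ^ Suc (Suc k) * ?H)"
    by (simp add: us_add us_diff right_diff_distrib us_diff_left del: power_Suc serre.simps)
      (simp add: ac_simps del: power_Suc serre.simps)
  finally show ?case unfolding Y by (simp add: mult.assoc del: serre.simps power_Suc)
qed

lemma at_pi_unit: "c * d = 1 \<Longrightarrow> s * s = 1 \<Longrightarrow> at_pi s c \<noteq> 0"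
  using at_pi_mult[of s c d] by auto

lemma at_pi_prod:
  assumes "\<And>l. at_pi s (f l) \<noteq> 0" "s * s = 1"
  shows "at_pi s (\<Prod>l\<le>(n::nat). f l) \<noteq> 0"
  using assms by (induction n) (simp_all add: at_pi_mult)

lemma at_pi_gam: "s * s = 1 \<Longrightarrow> at_pi s (gam i) \<noteq> 0"
proof (rule at_pi_unit)
  have "gam i * (pi_of D i * q_of D i * (1 - pi_of D i * q_of D i powi (- 2))) =
      (1 - pi_of D i * q_of D i powi (- 2)) * beta i"
    unfolding gam_beta[symmetric] by (simp only: ac_simps)
  then show "gam i * (pi_of D i * q_of D i * (1 - pi_of D i * q_of D i powi (- 2))) = 1"
    by (simp only: beta_unit)
qed

end

context supergroup_module
begin

text \<open>The Serre element acts as zero, hence so does its commutator with \<open>F\<^sub>j\<close>, which is an invertible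
  multiple of a power of \<open>E\<^sub>i\<close> on each weight space at \<open>\<pi> = -1\<close>.\<close>
lemma E_power_serre_eq_0:
  assumes odd: "odd (dot D i j)"
  obtains m where "\<And>v l. v \<in> wt l \<Longrightarrow> sc \<pi> v = - v \<Longrightarrow> act (E i ^ m) v = 0"
proof -
  obtain m where m: "pls (serre i j (Suc m)) = 0" by (rule serre_relation[OF odd])
  note oi = odd_dot_even_parity[OF odd] and oj = odd_dot_even_parity[of j i, unfolded dot_sym[of j i], OF odd]
  let ?b = "qq powi dot D i j" and ?x = "qq powi dot D i i"
  let ?t = "gam j * (\<Prod>l\<le>m. 1 - ?b * ?x ^ l * (\<pi> powi dot D i j * ?b))"
  have ne: "at_pi (- 1) (\<Prod>l\<le>n. 1 - ?b * ?x ^ l * (\<pi> powi dot D i j * ?b)) \<noteq> 0" for n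
  proof -
    have "at_pi (- 1) (1 - ?b * ?x ^ l * (\<pi> powi dot D i j * ?b)) \<noteq> 0" for l
    proof -
      have "?b * ?x ^ l * (\<pi> powi dot D i j * ?b) = \<pi> * qq powi (dot D i j + int l * dot D i i + dot D i j)"
        by (simp only: pi_powi_odd[OF odd] qq_powi_add powi_mult_unit[OF qq_unit] ac_simps)
      then show ?thesis using qX_powi_neq_minus[of 0 "dot D i j + int l * dot D i i + dot D i j"]
        by (simp add: at_pi_mult)
    qed
    then show ?thesis by (rule at_pi_prod) simp
  qed
  have "act (E i ^ Suc m) v = 0" if v: "v \<in> wt l" "sc \<pi> v = - v" for v l
  proof -
    let ?h = "\<pi> powi (dd D j * pair j l) * qq powi (dd D j * pair j l)"
    have s: "sc c v = sc (of_Qq (at_pi (- 1) c)) v" for c by (rule sc_at_pi) (simp add: v(2))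
    have "act (?t \<bullet> (E i ^ Suc m * (Jp j * Kp j))) v = 0"
      using serre_F[OF oi(1) oj(1) oi(4), of m] by (simp add: m del: serre.simps power_Suc)
    then have "act (E i ^ Suc m) (sc (?t * ?h) v) = 0"
      by (simp add: wt_Kp[OF v(1)] act_sc mult.commute del: power_Suc)
    then have "sc (of_Qq (at_pi (- 1) (?t * ?h))) (act (E i ^ Suc m) v) = 0"
      unfolding s[of "?t * ?h"] by (simp only: act_sc)
    moreover have "at_pi (- 1) (?t * ?h) \<noteq> 0"
      using ne[of m] at_pi_gam[of "- 1" j] by (simp add: at_pi_mult at_pi_pi_powi)
    ultimately show ?thesis by (rule sc_of_Qq_eq_0)
  qed
  then show ?thesis by (rule that)
qed

text \<open>The scalar in \<open>E\<^sup>n\<^sup>+\<^sup>1 F v = F E\<^sup>n\<^sup>+\<^sup>1 v + kap \<cdot> E\<^sup>n v\<close> at \<open>\<pi> = -1\<close>, if \<open>d\<^sub>i\<close> and the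
  value of \<open>i\<close> on the weight of \<open>v\<close> are odd; there both terms of \<open>[E, F]\<close> have the same sign, so that it does not vanish.\<close>
fun kap :: "'i \<Rightarrow> nat \<Rightarrow> int \<Rightarrow> Qq" where
  "kap i 0 k = - at_pi (- 1) (gam i) * (qX powi (dd D i * k) + qX powi (- (dd D i * k)))"
| "kap i (Suc n) k = kap i n (k + 2) + kap i 0 k"

text \<open>Multiplied by \<open>q\<^sub>i - q\<^sub>i\<^sup>-\<^sup>1\<close>, the sum that defines \<open>kap\<close> telescopes: up to a nonzero
  constant the result is a difference of two distinct powers of \<open>q\<close> times a sum of two powers of \<open>q\<close>.\<close>
lemma kap_nonzero: "kap i n k \<noteq> 0"
proof -
  let ?g = "at_pi (- 1) (gam i)"
  define e where "e k = qX powi (dd D i * k)" for k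
  have e: "e a * e b = e (a + b)" for a b
    by (simp add: e_def distrib_left power_int_add)
  have e_0: "kap i 0 k = - ?g * (e k + e (- k))" for k by (simp add: e_def)
  have "(e 1 - e (- 1)) * kap i n k =
      - ?g * ((e (int n + 1) - e (- int n - 1)) * (e (k + int n) + e (- k - int n)))"
  proof (induction n arbitrary: k)
    case 0
    then show ?case by (simp only: e_0) (simp add: algebra_simps)
  next
    case (Suc n)
    have "(e 1 - e (- 1)) * kap i (Suc n) k =
        (e 1 - e (- 1)) * kap i n (k + 2) + (e 1 - e (- 1)) * (- ?g * (e k + e (- k)))"
      by (simp only: kap.simps(2) e_0 distrib_left)
    also have "\<dots> = - ?g * ((e (int n + 1) - e (- int n - 1)) * (e (k + 2 + int n) + e (- (k + 2) - int n)) +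
        (e 1 - e (- 1)) * (e k + e (- k)))"
      unfolding Suc.IH by (simp only: distrib_left mult.left_commute)
    also have "(e (int n + 1) - e (- int n - 1)) * (e (k + 2 + int n) + e (- (k + 2) - int n)) +
        (e 1 - e (- 1)) * (e k + e (- k)) =
        (e (int (Suc n) + 1) - e (- int (Suc n) - 1)) * (e (k + int (Suc n)) + e (- k - int (Suc n)))"
      by (simp add: left_diff_distrib distrib_left e)
    finally show ?case .
  qed
  moreover have "e (int n + 1) \<noteq> e (- int n - 1)" "e (k + int n) + e (- k - int n) \<noteq> 0" "?g \<noteq> 0"
    using dd_pos[of i] qX_powi_neq_minus[of "dd D i * (k + int n)" "dd D i * (- k - int n)"]
    by (auto simp: e_def at_pi_gam eq_neg_iff_add_eq_0)
  ultimately show ?thesis by auto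
qed

lemma E_power_F:
  assumes "p i = 0" and d: "odd (dd D i)"
    and "v \<in> wt l" "sc \<pi> v = - v" "odd (pair i l)"
  shows "act (E i ^ Suc n) (act (F i) v) =
    act (F i) (act (E i ^ Suc n) v) + sc (of_Qq (kap i n (pair i l))) (act (E i ^ n) v)"
  using assms(3-)
proof (induction n arbitrary: v l)
  have EF: "act (E i) (act (F i) v) = act (F i) (act (E i) v) + sc (of_Qq (kap i 0 (pair i l))) v"
    if v: "v \<in> wt l" "sc \<pi> v = - v" "odd (pair i l)" for v l
  proof -
    let ?k = "dd D i * pair i l"
    have "act (E i) (act (F i) v) = act (E i * F i) v" by simp
    also have "\<dots> = act (F i) (act (E i) v) + sc (gam i * (\<pi> powi ?k * qq powi ?k - qq powi (- ?k))) v"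
      unfolding E_F using assms(1)
      by (simp add: wt_Kp[OF v(1)] act_sc mult.commute sc_diff_left right_diff_distrib)
    also have "sc (gam i * (\<pi> powi ?k * qq powi ?k - qq powi (- ?k))) v =
        sc (of_Qq (at_pi (- 1) (gam i * (\<pi> powi ?k * qq powi ?k - qq powi (- ?k))))) v"
      by (rule sc_at_pi) (simp add: v(2))
    also have "at_pi (- 1) (gam i * (\<pi> powi ?k * qq powi ?k - qq powi (- ?k))) = kap i 0 (pair i l)"
      using d v(3) by (simp add: at_pi_mult at_pi_pi_powi) (simp add: algebra_simps)
    finally show ?thesis .
  qed
  {
    case 0
    then show ?case using EF[OF 0] by simp
  next
    case (Suc n)
    have "pair i (xmap D i) = 2"
      using dd_pairing[of i i] dd_pos[of i] by (simp add: dot_self)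
    then have p: "pair i (l + xmap D i) = pair i l + 2" by (simp add: pairing_add)
    have Ev: "act (E i) v \<in> wt (l + xmap D i)" "sc \<pi> (act (E i) v) = - act (E i) v"
      using Suc.prems by (simp_all add: wt_E flip: act_sc)
    have pow: "act (E i ^ Suc k) w = act (E i ^ k) (act (E i) w)" for k w
      by (simp only: power_Suc2 act_simps)
    have "act (E i ^ Suc (Suc n)) (act (F i) v) = act (E i ^ Suc n) (act (F i) (act (E i) v)) +
        sc (of_Qq (kap i 0 (pair i l))) (act (E i ^ Suc n) v)"
      by (simp only: pow[of "Suc n"] EF[OF Suc.prems] act_simps act_sc)
    also have "act (E i ^ Suc n) (act (F i) (act (E i) v)) =
        act (F i) (act (E i ^ Suc n) (act (E i) v)) + sc (of_Qq (kap i n (pair i l + 2))) (act (E i ^ n) (act (E i) v))"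
      using Suc.IH[OF Ev] Suc.prems(3) by (simp add: p del: power_Suc)
    finally show ?case by (simp only: pow[of "Suc n", symmetric] pow[of n, symmetric] kap.simps(2)
        of_Qq_simps sc_add_left add.assoc)
  }
qed

text \<open>Some fixed power of \<open>E\<^sub>i\<close> annihilates all such vectors, and also their images under \<open>F\<^sub>i\<close>, which
  are of the same kind.  Commuting \<open>F\<^sub>i\<close> past \<open>E\<^sub>i\<^bsup>n+1\<^esup>\<close> then shows that already \<open>E\<^sub>i\<^sup>n\<close> annihilates
  them, and so on down to \<open>n = 0\<close>.\<close>
lemma odd_weight_vanish:
  assumes odd: "odd (dot D i j)" and v: "v \<in> wt l" "sc \<pi> v = - v" "odd (pair i l)"
  shows "v = 0"
proof -
  note oi = odd_dot_even_parity[OF odd]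
  obtain m where m: "\<And>v l. v \<in> wt l \<Longrightarrow> sc \<pi> v = - v \<Longrightarrow> act (E i ^ m) v = 0"
    using E_power_serre_eq_0[OF odd] by blast
  have "pair i (xmap D i) = 2"
    using dd_pairing[of i i] dd_pos[of i] by (simp add: dot_self)
  then have p: "pair i (l - xmap D i) = pair i l - 2" for l by (simp add: pairing_add)
  have "\<forall>v l. v \<in> wt l \<longrightarrow> sc \<pi> v = - v \<longrightarrow> odd (pair i l) \<longrightarrow> act (E i ^ m) v = 0"
    using m by blast
  then have "\<forall>v l. v \<in> wt l \<longrightarrow> sc \<pi> v = - v \<longrightarrow> odd (pair i l) \<longrightarrow> act (E i ^ 0) v = 0"
  proof (induction m)
    case (Suc n)
    have "act (E i ^ n) v = 0" if v: "v \<in> wt l" "sc \<pi> v = - v" "odd (pair i l)" for v l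
    proof -
      have "act (F i) v \<in> wt (l - xmap D i)" "sc \<pi> (act (F i) v) = - act (F i) v"
        using v by (simp_all add: wt_F flip: act_sc)
      then have "act (E i ^ Suc n) (act (F i) v) = 0" using Suc.prems v(3) p by force
      moreover have "act (E i ^ Suc n) v = 0" using Suc.prems v by blast
      ultimately have "sc (of_Qq (kap i n (pair i l))) (act (E i ^ n) v) = 0"
        using E_power_F[OF oi(1,2) v, of n] by (simp del: power_Suc)
      then show ?thesis using sc_of_Qq_eq_0 kap_nonzero by blast
    qed
    then show ?case using Suc.IH by blast
  qed simp
  then show ?thesis using v by simp
qed

text \<open>On the component \<open>\<pi> = -1\<close> only even values \<open>\<langle>i, \<lambda>\<rangle>\<close> occur, but \<open>E\<^sub>j\<close> and \<open>F\<^sub>j\<close> change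
  their parity.\<close>
lemma odd_dot_vanish:
  assumes ds: "direct_sum_on UNIV wt" and odd: "odd (dot D i j)"
  shows "sc (1 - \<pi>) (act (E j) m) = 0" "sc (1 - \<pi>) (act (F j) m) = 0"
proof -
  have "sc (1 - \<pi>) (act (E j) m) = 0 \<and> sc (1 - \<pi>) (act (F j) m) = 0"
  proof (rule direct_sum_induct[OF ds, of "\<lambda>m. sc (1 - \<pi>) (act (E j) m) = 0 \<and> sc (1 - \<pi>) (act (F j) m) = 0"])
    fix l v assume v: "v \<in> wt l"
    let ?v = "sc (1 - \<pi>) v"
    have m: "sc \<pi> ?v = - ?v" by (simp add: right_diff_distrib flip: sc_simps(5))
    have w: "?v \<in> wt l" using v by simp
    have o: "odd (pair i (xmap D j))" using odd_dot_even_parity[OF odd] by simp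
    have "act (E j) ?v = 0 \<and> act (F j) ?v = 0"
    proof (cases "odd (pair i l)")
      case True
      then have "?v = 0" using odd_weight_vanish[OF odd w m] by simp
      then show ?thesis by simp
    next
      case False
      have mm: "sc \<pi> (act u ?v) = - act u ?v" for u using m by (metis act_sc act_simps(10))
      have "act (E j) ?v = 0" using False o
        by (intro odd_weight_vanish[OF odd wt_E[OF w] mm]) (simp add: pairing_add)
      moreover have "act (F j) ?v = 0" using False o
        by (intro odd_weight_vanish[OF odd wt_F[OF w] mm]) (simp add: pairing_add)
      ultimately show ?thesis by simp
    qed
    then show "sc (1 - \<pi>) (act (E j) v) = 0 \<and> sc (1 - \<pi>) (act (F j) v) = 0"
      by (simp add: act_sc)
  qed auto
  then show "sc (1 - \<pi>) (act (E j) m) = 0" "sc (1 - \<pi>) (act (F j) m) = 0" by auto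
qed

end

section \<open>The Casimir operator\<close>

lemma int_mult_Suc: "int_mult (n + 1) x = int_mult n x + x" "int_mult (n - 1) x = int_mult n x - x"
proof -
  have s: "int_mult (n + 1) x = int_mult n x + x" for n
  proof (cases "n \<ge> 0")
    case True
    then show ?thesis by (simp add: int_mult_def nat_add_distrib)
  next
    case False
    then have e: "nat (- n) = Suc (nat (- (n + 1)))" by simp
    show ?thesis using False unfolding int_mult_def e by simp
  qed
  show "int_mult (n + 1) x = int_mult n x + x" by (rule s)
  show "int_mult (n - 1) x = int_mult n x - x" using s[of "n - 1"] by simp
qed

lemma sum_closed:
  assumes "P 0" "\<And>x y. P x \<Longrightarrow> P y \<Longrightarrow> P (x + y)" "\<And>a. a \<in> A \<Longrightarrow> P (h a)"
  shows "P (sum h A)"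
  using assms(3) by (induction A rule: infinite_finite_induct) (auto intro: assms(1,2))

lemma root_coset_shift:
  fixes D :: "('i::finite, 'y, 'x::ab_group_add) root_data"
  assumes "l \<in> root_coset D l0"
  shows "l + xmap D i \<in> root_coset D l0" "l - xmap D i \<in> root_coset D l0"
proof -
  obtain n where n: "l = l0 + (\<Sum>j\<in>UNIV. int_mult (n j) (xmap D j))"
    using assms by (auto simp: root_coset_def)
  have "(\<Sum>j\<in>UNIV. int_mult ((n(i := n i + 1)) j) (xmap D j)) =
      (\<Sum>j\<in>UNIV. int_mult (n j) (xmap D j) + (if j = i then xmap D i else 0))"
    by (intro sum.cong) (auto simp: int_mult_Suc)
  then have "l + xmap D i = l0 + (\<Sum>j\<in>UNIV. int_mult ((n(i := n i + 1)) j) (xmap D j))"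
    by (simp add: n sum.distrib add.assoc)
  then show "l + xmap D i \<in> root_coset D l0" unfolding root_coset_def by blast
  have "(\<Sum>j\<in>UNIV. int_mult ((n(i := n i - 1)) j) (xmap D j)) =
      (\<Sum>j\<in>UNIV. int_mult (n j) (xmap D j) - (if j = i then xmap D i else 0))"
    by (intro sum.cong) (auto simp: int_mult_Suc)
  then have "l - xmap D i = l0 + (\<Sum>j\<in>UNIV. int_mult ((n(i := n i - 1)) j) (xmap D j))"
    by (simp add: n sum_subtractf)
  then show "l - xmap D i \<in> root_coset D l0" unfolding root_coset_def by blast
qed

lemma free_wt_mult:
  "x \<in> free_wt \<mu> \<Longrightarrow> y \<in> free_wt \<nu> \<Longrightarrow> x * y \<in> free_wt (\<lambda>i. \<mu> i + \<nu> i)"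
proof (induction x rule: free_wt_induct)
  case (monom c w)
  have "monom_word w * y \<in> free_wt (\<lambda>i. \<mu> i + \<nu> i)"
    using monom(2)
  proof (induction y rule: free_wt_induct)
    case (monom d v)
    have "monom_word w * (scal d * monom_word v) = scal d * monom_word (w @ v)"
      by (simp only: monom_word_append mult.assoc[symmetric] scal_commute[of d "monom_word w"])
    then show ?case using monom \<open>count_list w = \<mu>\<close> by (auto simp: count_list_append fun_eq_iff)
  qed (simp_all add: distrib_left)
  then show ?case by (simp add: mult.assoc)
qed (simp_all add: distrib_right)

locale supergroup_O = supergroup_basis D Q B star + supergroup_module D Q act
  for D :: "('i::finite, 'y::ab_group_add, 'x::ab_group_add) root_data"
    and Q :: "('i, 'y, 'f::ring_1, 'u::ring_1) quantum_data"
    and B :: "'f set" and star :: "'f \<Rightarrow> 'f"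
    and act :: "'u \<Rightarrow> 'm::ab_group_add \<Rightarrow> 'm" +
  fixes gr :: "bool \<Rightarrow> 'm set"
  assumes cO: "category_O D Q act gr"
begin

lemma cC: "category_C D Q act gr"
  using cO by (simp add: category_O_def)

abbreviation Omg :: "'m \<Rightarrow> 'm" where "Omg \<equiv> Omega D Q B star act"

text \<open>A bound for the heights of the weights that contribute to \<open>\<Omega> m\<close>.\<close>
definition killed :: "nat \<Rightarrow> 'm \<Rightarrow> bool" where
  "killed n m \<longleftrightarrow> (\<forall>\<nu> x. n < ht \<nu> \<longrightarrow> x \<in> free_wt \<nu> \<longrightarrow> act (pls x) m = 0)"

lemma killed_ex: "\<exists>n. killed n m"
proof -
  obtain n where n: "\<forall>\<nu>. ht \<nu> \<ge> n \<longrightarrow> (\<forall>x\<in>f_wt Q \<nu>. act (plus_hom Q x) m = 0)"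
    using cO unfolding category_O_def by meson
  have "killed n m" unfolding killed_def
  proof (intro allI impI)
    fix \<nu> and x :: "'i free_alg" assume "n < ht \<nu>" "x \<in> free_wt \<nu>"
    then have "n \<le> ht \<nu>" "f_proj Q x \<in> f_wt Q \<nu>" by (auto simp: f_wt_def)
    then show "act (pls x) m = 0" using n by (simp add: pls_def)
  qed
  then show ?thesis by blast
qed

lemma killed_mono: "killed n m \<Longrightarrow> n \<le> k \<Longrightarrow> killed k m"
  unfolding killed_def by force

lemma killed_common: "\<exists>n. killed n a \<and> killed n b \<and> killed n c"
proof -
  obtain i j k where "killed i a" "killed j b" "killed k c" using killed_ex by blast
  then have "killed (i + j + k) a \<and> killed (i + j + k) b \<and> killed (i + j + k) c"
    by (auto elim!: killed_mono)
  then show ?thesis by blast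
qed

lemma Omega_term_eq:
  assumes b: "b \<in> Bw \<nu>"
  shows "Omega_term D Q star act m b = act (anti (rep \<nu> b)) (act (pls (rep \<nu> (star b))) m)"
proof -
  have r: "rep \<nu> b \<in> free_wt \<nu>" "f_proj Q (rep \<nu> b) = b" "f_proj Q (rep \<nu> (star b)) = star b"
    using rep b star_f_wt by auto
  have "Omega_term D Q star act m b =
      sc (Om_coef D \<nu>) (act (antipode Q (minus_hom Q b)) (act (plus_hom Q (star b)) m))"
    unfolding Omega_term_def f_weight_B[OF b] by (simp add: Om_coef_def)
  also have "\<dots> = act (Om_coef D \<nu> \<bullet> antipode Q (minus_hom Q (f_proj Q (rep \<nu> b)))) (act (pls (rep \<nu> (star b))) m)"
    by (simp add: r pls_def)
  finally show ?thesis unfolding antipode_anti[OF r(1)] .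
qed

lemma act_Om: "act (Om \<nu> z) m = (\<Sum>b\<in>Bw \<nu>. act (anti (rep \<nu> b)) (act z (act (pls (rep \<nu> (star b))) m)))"
  by (simp add: Om_def act_sum)

lemma killed_rep: "killed n m \<Longrightarrow> n < ht \<nu> \<Longrightarrow> b \<in> Bw \<nu> \<Longrightarrow> act (pls (rep \<nu> (star b))) m = 0"
  using rep(1)[OF star_f_wt] by (auto simp: killed_def)

lemma act_Om_killed: "killed n m \<Longrightarrow> n < ht \<nu> \<Longrightarrow> act (Om \<nu> z) m = 0"
  unfolding act_Om by (intro sum.neutral ballI) (simp add: killed_rep)

lemma Omega_eq:
  assumes "killed n m"
  shows "Omg m = (\<Sum>\<nu> | ht \<nu> \<le> n. act (Om \<nu> 1) m)"
proof -
  let ?W = "{\<nu> :: 'i \<Rightarrow> nat. ht \<nu> \<le> n}" and ?t = "Omega_term D Q star act m"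
  have "Omg m = (\<Sum>b\<in>(\<Union>\<nu>\<in>?W. Bw \<nu>). ?t b)"
    unfolding Omega_def
  proof (rule sum.mono_neutral_left)
    show "finite (\<Union>\<nu>\<in>?W. Bw \<nu>)" using finite_ht_le finite_Bw by blast
    show "{b. b \<in> B \<and> ?t b \<noteq> 0} \<subseteq> (\<Union>\<nu>\<in>?W. Bw \<nu>)"
    proof
      fix b assume "b \<in> {b. b \<in> B \<and> ?t b \<noteq> 0}"
      then have b: "b \<in> B" "?t b \<noteq> 0" by auto
      obtain \<nu> where \<nu>: "b \<in> Bw \<nu>" using b(1) B_eq_Union by blast
      have "ht \<nu> \<le> n"
      proof (rule ccontr)
        assume "\<not> ht \<nu> \<le> n"
        then have "act (pls (rep \<nu> (star b))) m = 0" using killed_rep[OF assms _ \<nu>] by simp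
        then show False using b(2) Omega_term_eq[OF \<nu>] by simp
      qed
      then show "b \<in> (\<Union>\<nu>\<in>?W. Bw \<nu>)" using \<nu> by blast
    qed
  qed auto
  also have "\<dots> = (\<Sum>\<nu>\<in>?W. \<Sum>b\<in>Bw \<nu>. ?t b)"
  proof (rule sum.UNION_disjoint)
    show "\<forall>\<mu>\<in>?W. \<forall>\<nu>\<in>?W. \<mu> \<noteq> \<nu> \<longrightarrow> Bw \<mu> \<inter> Bw \<nu> = {}"
      using f_weight_B by blast
  qed (use finite_ht_le finite_Bw in auto)
  also have "\<dots> = (\<Sum>\<nu>\<in>?W. act (Om \<nu> 1) m)"
    unfolding act_Om by (intro sum.cong refl) (simp add: Omega_term_eq)
  finally show ?thesis .
qed

lemma Omg_add: "Omg (m + m') = Omg m + Omg m'"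
proof -
  obtain n where "killed n m" "killed n m'" "killed n (m + m')" using killed_common by blast
  then show ?thesis by (simp add: Omega_eq sum.distrib)
qed

lemma Omg_sc: "Omg (sc c m) = sc c (Omg m)"
proof -
  obtain n where "killed n m" "killed n (sc c m)" using killed_common by blast
  then show ?thesis by (simp add: Omega_eq sc_sum act_sc)
qed

lemma Omg_0: "Omg 0 = 0"
  using Omg_sc[of 0 0] by simp

lemma wt_Omg: "m \<in> wt l \<Longrightarrow> Omg m \<in> wt l"
proof -
  assume m: "m \<in> wt l"
  obtain n where n: "killed n m" using killed_ex by blast
  have "act (anti (rep \<nu> b)) (act (pls (rep \<nu> (star b))) m) \<in> wt l" if b: "b \<in> Bw \<nu>" for \<nu> b
  proof -
    have "rep \<nu> b \<in> free_wt \<nu>" "rep \<nu> (star b) \<in> free_wt \<nu>" using rep(1) b star_f_wt by auto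
    from wt_anti[OF this(1) wt_pls[OF this(2) m]] show ?thesis by simp
  qed
  then show ?thesis unfolding Omega_eq[OF n] act_Om by (auto intro!: wt_sum)
qed

text \<open>In the sum over all weights the differences in the commutators telescope.  The last one vanishes
  because \<open>n\<close> bounds the heights that matter for \<open>m\<close>.\<close>
lemma Omg_F_eps:
  assumes e: "\<And>\<nu>. e * \<pi> powi dotw D i \<nu> = e"
  shows "sc e (Omg (act (F i) m)) = sc e (act (F i) (act (Kp i) (Omg (act (Jp i * Kp i) m))))"
proof -
  obtain n where k: "killed n m" "killed n (act (F i) m)" "killed n (act (Jp i * Kp i) m)"
    using killed_common by blast
  let ?X = "\<lambda>\<nu>. act (e \<bullet> (Om \<nu> 1 * F i)) m"
  let ?a = "\<lambda>\<nu>. act (e \<bullet> (\<pi> ^ (p i * par D \<nu>) \<bullet> Om \<nu> (F i))) m"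
  let ?g = "\<lambda>\<nu>. act (e \<bullet> (F i * Kp i * Om \<nu> 1 * (Jp i * Kp i))) m"
  have "killed (Suc n) (act (F i) m)" using k(2) killed_mono by simp
  from Omega_eq[OF this] have "sc e (Omg (act (F i) m)) = (\<Sum>\<nu> | ht \<nu> \<le> Suc n. ?X \<nu>)"
    by (simp add: sc_sum)
  also have "\<dots> = (\<Sum>\<nu> | ht \<nu> \<le> n. ?g \<nu>)"
  proof (rule ht_telescope[where i = i and a = ?a])
    show "?X (inc i \<nu>) = ?a (inc i \<nu>) - ?a \<nu> + ?g \<nu>" for \<nu>
      unfolding Om_F[OF e] by (simp only: us_add us_diff act_simps)
    show "?X \<nu> = ?a \<nu>" if "\<nu> i = 0" for \<nu>
      by (simp only: Om_F_0[where \<nu> = \<nu> and i = i, OF that e])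
    show "?a \<nu> = 0" if "ht \<nu> = Suc n" for \<nu>
      using act_Om_killed[OF k(1), of \<nu>] that by simp
  qed
  also have "\<dots> = sc e (act (F i) (act (Kp i) (Omg (act (Jp i * Kp i) m))))"
    unfolding Omega_eq[OF k(3)] by (simp add: act_sum sc_sum)
  finally show ?thesis .
qed

lemma Omg_E_eps:
  assumes e: "\<And>\<nu>. e * \<pi> powi dotw D i \<nu> = e"
  shows "sc e (act (E i) (Omg m)) = sc e (act (Jp i * Kp i * Kp i) (Omg (act (E i) m)))"
proof -
  obtain n where k: "killed n m" "killed n (act (E i) m)"
    using killed_common by blast
  let ?X = "\<lambda>\<nu>. act (e \<bullet> (E i * Om \<nu> 1)) m"
  let ?a = "\<lambda>\<nu>. act (e \<bullet> ((\<pi> ^ (p i * par D \<nu>) * qq powi (- dotw D i \<nu>)) \<bullet> Om \<nu> (E i))) m"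
  let ?g = "\<lambda>\<nu>. act (e \<bullet> (Jp i * Kp i * Kp i * Om \<nu> 1 * E i)) m"
  have "killed (Suc n) m" using k(1) killed_mono by simp
  then have "sc e (act (E i) (Omg m)) = (\<Sum>\<nu> | ht \<nu> \<le> Suc n. ?X \<nu>)"
    by (simp add: Omega_eq sc_sum act_sum)
  also have "\<dots> = (\<Sum>\<nu> | ht \<nu> \<le> n. ?g \<nu>)"
  proof (rule ht_telescope[where i = i and a = ?a])
    show "?X (inc i \<nu>) = ?a (inc i \<nu>) - ?a \<nu> + ?g \<nu>" for \<nu>
      unfolding E_Om[OF e] by (simp only: us_add us_diff act_simps)
    show "?X \<nu> = ?a \<nu>" if "\<nu> i = 0" for \<nu>
      by (simp only: E_Om_0[where \<nu> = \<nu> and i = i, OF that e])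
    show "?a \<nu> = 0" if "ht \<nu> = Suc n" for \<nu>
      using act_Om_killed[OF k(1), of \<nu>] that by simp
  qed
  also have "\<dots> = sc e (act (Jp i * Kp i * Kp i) (Omg (act (E i) m)))"
    unfolding Omega_eq[OF k(2)] by (simp add: act_sum sc_sum)
  finally show ?thesis .
qed

text \<open>The scalar \<open>1 + \<pi>\<close> absorbs all powers of \<open>\<pi>\<close>, so the two vectors always agree on the component
  \<open>\<pi> = 1\<close>.  If an odd \<open>j \<cdot> i\<close> prevents the choice \<open>e = 1\<close>, they both vanish on the other one.\<close>
lemma combine_components:
  assumes eq: "\<And>e. (\<And>\<nu>. e * \<pi> powi dotw D i \<nu> = e) \<Longrightarrow> sc e a = sc e b"
    and van: "\<And>j. odd (dot D j i) \<Longrightarrow> sc (1 - \<pi>) a = 0 \<and> sc (1 - \<pi>) b = 0"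
  shows "a = b"
proof (cases "\<exists>j. odd (dot D j i)")
  case True
  have "(1 + \<pi>) * \<pi> powi k = 1 + \<pi>" for k
    by (cases "even k") (simp_all add: pi_powi_odd algebra_simps)
  then have "sc (1 + \<pi>) a = sc (1 + \<pi>) b" by (rule eq)
  moreover have "sc (1 - \<pi>) a = sc (1 - \<pi>) b" using van True by metis
  moreover have "sc (1 + \<pi>) x + sc (1 - \<pi>) x = sc (1 + 1) x" for x
    by (simp only: sc_add_left[symmetric]) simp
  ultimately have "sc (1 + 1) a = sc (1 + 1) b" by metis
  moreover have "(1 + 1) * of_Qq (1 / 2) = 1"
    by (simp add: distrib_right flip: of_Qq_simps)
  ultimately show ?thesis using sc_cancel by blast
next
  case False
  then have "even (dotw D i \<nu>)" for \<nu>
    unfolding dotw_def by (intro dvd_sum) (simp add: dot_sym[of i])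
  then show ?thesis using eq[of 1] by simp
qed

lemma direct_sum_wt: "direct_sum_on UNIV wt"
  using cC by (simp add: category_C_def)

lemma Omg_F: "Omg (act (F i) m) = act (F i) (act (Kp i) (Omg (act (Jp i * Kp i) m)))"
proof (rule combine_components[OF Omg_F_eps])
  show "sc (1 - \<pi>) (Omg (act (F i) m)) = 0 \<and>
      sc (1 - \<pi>) (act (F i) (act (Kp i) (Omg (act (Jp i * Kp i) m)))) = 0" if "odd (dot D j i)" for j
    using odd_dot_vanish(2)[OF direct_sum_wt that] by (simp add: Omg_0 flip: Omg_sc)
qed

lemma Omg_E: "act (E i) (Omg m) = act (Jp i * Kp i * Kp i) (Omg (act (E i) m))"
proof (rule combine_components[OF Omg_E_eps])
  show "sc (1 - \<pi>) (act (E i) (Omg m)) = 0 \<and>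
      sc (1 - \<pi>) (act (Jp i * Kp i * Kp i) (Omg (act (E i) m))) = 0" if "odd (dot D j i)" for j
  proof -
    have "sc (1 - \<pi>) (act u (Omg v)) = act u (Omg (sc (1 - \<pi>) v))" for u v
      by (simp only: act_sc Omg_sc)
    from this[of _ "act (E i) m"] have "sc (1 - \<pi>) (act u (Omg (act (E i) m))) = 0" for u
      unfolding odd_dot_vanish(1)[OF direct_sum_wt that] Omg_0 by simp
    then show ?thesis using odd_dot_vanish(1)[OF direct_sum_wt that] by blast
  qed
qed

section \<open>The grading\<close>

text \<open>\<open>u\<close> acts with parity \<open>a\<close>; parities add up to \<open>a \<noteq> b\<close> in terms of booleans.\<close>
definition shifts :: "bool \<Rightarrow> 'u \<Rightarrow> bool" where
  "shifts a u \<longleftrightarrow> (\<forall>b. \<forall>m\<in>gr b. act u m \<in> gr (a \<noteq> b))"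

lemma gr_add: "0 \<in> gr b" "m \<in> gr b \<Longrightarrow> n \<in> gr b \<Longrightarrow> m + n \<in> gr b"
  using cC by (auto simp: category_C_def)

lemma gr_sum: "(\<And>a. a \<in> A \<Longrightarrow> g a \<in> gr b) \<Longrightarrow> sum g A \<in> gr b"
  by (induction A rule: infinite_finite_induct) (auto simp: gr_add)

lemma shifts_U_par: "u \<in> U_par D Q a \<Longrightarrow> shifts a u"
  using cC by (auto simp: category_C_def shifts_def)

lemma shifts_add: "shifts a u \<Longrightarrow> shifts a v \<Longrightarrow> shifts a (u + v)"
  by (auto simp: shifts_def intro!: gr_add)

lemma shifts_0: "shifts a 0"
  by (simp add: shifts_def gr_add)

lemma shifts_mult: "shifts a u \<Longrightarrow> shifts b v \<Longrightarrow> shifts (a \<noteq> b) (u * v)"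
proof -
  assume u: "shifts a u" and v: "shifts b v"
  have "act u (act v m) \<in> gr (a \<noteq> (b \<noteq> c))" if "m \<in> gr c" for m c
    using u v that unfolding shifts_def by blast
  moreover have e: "(a \<noteq> (b \<noteq> c)) = ((a \<noteq> b) \<noteq> c)" for c by blast
  ultimately show "shifts (a \<noteq> b) (u * v)" unfolding shifts_def act_simps e by blast
qed

lemma gr_sc: "m \<in> gr b \<Longrightarrow> sc c m \<in> gr b"
proof -
  have "U_scal Q c \<in> U_par D Q False"
    unfolding U_par_def U_scal_def
    by (intro imageI) (auto simp: scal_def in_keys_iff lookup_single when_def split: if_splits)
  from shifts_U_par[OF this] show "m \<in> gr b \<Longrightarrow> sc c m \<in> gr b"
    by (auto simp: shifts_def)
qed

lemma shifts_us: "shifts a u \<Longrightarrow> shifts a (c \<bullet> u)"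
  by (auto simp: shifts_def intro: gr_sc)

lemma shifts_F: "shifts (odd (p i)) (F i)"
proof (rule shifts_U_par)
  have "U_proj Q (monom_word (map gF [i])) \<in> U_par D Q (odd (par D (count_list [i])))"
    by (rule U_parI) (simp only: length_odd)
  then show "F i \<in> U_par D Q (odd (p i))" unfolding par_single by (simp add: var_def)
qed

lemma shifts_Kp: "shifts False (Kp i)"
  unfolding Kp_def Kt_def var_def by (rule shifts_U_par, rule U_parI) simp

lemma shifts_pls: "x \<in> free_wt \<nu> \<Longrightarrow> shifts (odd (par D \<nu>)) (pls x)"
proof (induction x rule: free_wt_induct)
  case (monom c w)
  have "pls (monom_word w) \<in> U_par D Q (odd (par D (count_list w)))"
    unfolding pls_word by (rule U_parI) (simp only: length_odd)
  then show ?case using monom by (auto intro: shifts_us shifts_U_par)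
qed (simp_all add: shifts_0 shifts_add)

lemma shifts_anti: "x \<in> free_wt \<nu> \<Longrightarrow> shifts (odd (par D \<nu>)) (anti x)"
proof (induction x rule: free_wt_induct)
  case (monom c w)
  have "shifts (odd (par D (count_list w))) (Gw w)"
  proof (induction w)
    case Nil
    then show ?case by (simp add: shifts_def count_list_Nil)
  next
    case (Cons i w)
    have "shifts (odd (p i)) (G i)"
      using shifts_mult[OF shifts_F shifts_Kp] unfolding G_def by (auto intro: shifts_us)
    from shifts_mult[OF Cons.IH this] show ?case
      unfolding count_list_Cons par_simps Gw.simps by (simp add: eq_commute)
  qed
  then show ?case using monom by (auto intro: shifts_us)
qed (simp_all add: shifts_0 shifts_add)

text \<open>The two factors of each summand have the same parity, so their effects on the grading cancel.\<close>
lemma gr_Omg: "m \<in> gr b \<Longrightarrow> Omg m \<in> gr b"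
proof -
  assume m: "m \<in> gr b"
  obtain n where n: "killed n m" using killed_ex by blast
  have "act (anti (rep \<nu> c)) (act (pls (rep \<nu> (star c))) m) \<in> gr b" if c: "c \<in> Bw \<nu>" for \<nu> c
  proof -
    have "shifts (odd (par D \<nu>)) (anti (rep \<nu> c))" "shifts (odd (par D \<nu>)) (pls (rep \<nu> (star c)))"
      using rep(1) c star_f_wt shifts_anti shifts_pls by auto
    then have "act (anti (rep \<nu> c)) (act (pls (rep \<nu> (star c))) m)
        \<in> gr (odd (par D \<nu>) \<noteq> (odd (par D \<nu>) \<noteq> b))"
      using m unfolding shifts_def by blast
    moreover have "(odd (par D \<nu>) \<noteq> (odd (par D \<nu>) \<noteq> b)) = b" by blast
    ultimately show ?thesis by (simp only:)
  qed
  then show ?thesis unfolding Omega_eq[OF n] act_Om by (auto intro!: gr_sum)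
qed

lemma gr_decompose_unique:
  assumes "m0 \<in> gr False" "m1 \<in> gr True" "m0 + m1 \<in> gr b"
  shows "m0 + m1 = (if b then m1 else m0)"
proof -
  \<comment> \<open>Two decompositions of the same vector along the grading.\<close>
  let ?f = "\<lambda>c. if c then m1 else m0" and ?g = "\<lambda>c. if c = b then m0 + m1 else 0"
  have ex: "\<exists>!f. (\<forall>l\<in>UNIV. f l \<in> gr l) \<and> (\<forall>l. l \<notin> UNIV \<longrightarrow> f l = 0) \<and>
               finite {l. f l \<noteq> 0} \<and> m0 + m1 = (\<Sum>l | f l \<noteq> 0. f l)" (is "\<exists>!f. ?P f")
    using cC unfolding category_C_def direct_sum_on_def by blast
  obtain h where h: "\<forall>f. ?P f \<longrightarrow> f = h" by (rule ex1E[OF ex]) (rule that, assumption)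
  have s: "(\<Sum>l | f l \<noteq> 0. f l) = f False + f True" for f :: "bool \<Rightarrow> 'm"
  proof -
    have "(\<Sum>l | f l \<noteq> 0. f l) = (\<Sum>l\<in>UNIV. f l)" by (rule sum.mono_neutral_left) auto
    then show ?thesis by (simp add: UNIV_bool)
  qed
  have "?P ?f" using assms unfolding s by auto
  then have "?f = h" by (rule h[THEN spec, THEN mp])
  moreover have "?P ?g" using assms gr_add unfolding s by auto
  then have "?g = h" by (rule h[THEN spec, THEN mp])
  ultimately have "?f = ?g" by simp
  then have "?f b = ?g b" by (rule fun_cong)
  then show ?thesis by simp
qed

end

section \<open>The operator \<open>\<Omega> \<Xi>\<close>\<close>

text \<open>That every vector is a sum of weight vectors with weights in \<open>C\<close> is known both if the module is the
  direct sum of these weight spaces and if it is a quotient of a Verma module.\<close>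
locale casimir = supergroup_O D Q B star act gr
  for D :: "('i::finite, 'y::ab_group_add, 'x::ab_group_add) root_data"
    and Q :: "('i, 'y, 'f::ring_1, 'u::ring_1) quantum_data"
    and B :: "'f set" and star :: "'f \<Rightarrow> 'f"
    and act :: "'u \<Rightarrow> 'm::ab_group_add \<Rightarrow> 'm" and gr :: "bool \<Rightarrow> 'm set" +
  fixes C :: "'x set" and lam0 :: 'x and cG :: "'x \<Rightarrow> int" and Xi :: "'m \<Rightarrow> 'm"
  assumes C: "C = root_coset D lam0" and cf_G: "casimir_function D C cG" and Xi: "is_Xi D Q act C cG Xi"
    and wt_induct: "\<And>P m. P 0 \<Longrightarrow> (\<And>x y. P x \<Longrightarrow> P y \<Longrightarrow> P (x + y)) \<Longrightarrow>
      (\<And>l x. l \<in> C \<Longrightarrow> x \<in> wt l \<Longrightarrow> P x) \<Longrightarrow> P m"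
begin

definition T :: "'m \<Rightarrow> 'm" where "T m = Omg (Xi m)"

definition g :: "int \<Rightarrow> qpi" where "g c = (\<pi> * qq\<^sup>2) powi c"

lemma Xi_wt: "l \<in> C \<Longrightarrow> m \<in> wt l \<Longrightarrow> Xi m = sc (g (cG l)) m"
  using Xi by (auto simp: is_Xi_def g_def)

lemma T_wt: "l \<in> C \<Longrightarrow> m \<in> wt l \<Longrightarrow> T m = sc (g (cG l)) (Omg m)"
  by (simp add: T_def Xi_wt Omg_sc)

lemma T_add: "T (m + n) = T m + T n"
  using Xi by (simp add: T_def is_Xi_def additive_add Omg_add)

lemma T_sc: "T (sc c m) = sc c (T m)"
  using Xi by (simp add: T_def is_Xi_def Omg_sc)

lemma T_0: "T 0 = 0"
  using T_sc[of 0 0] by simp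

lemma T_minus: "T (- m) = - T m"
  using T_sc[of "- 1" m] by simp

lemma T_diff: "T (m - n) = T m - T n"
  using T_add[of m "- n"] by (simp add: T_minus)

lemma g_add: "g (a + b) = g a * g b"
  unfolding g_def by (rule pi_qq_powi_add)

lemma g_eq: "g c = \<pi> powi c * (qq powi c * qq powi c)"
  unfolding g_def by (rule pi_qq_powi)

lemma C_shift: "l \<in> C \<Longrightarrow> l + xmap D i \<in> C" "l \<in> C \<Longrightarrow> l - xmap D i \<in> C"
  unfolding C by (simp_all add: root_coset_shift)

lemma C_shift_xwt:
  assumes "l \<in> C"
  shows "l + xwt D \<nu> \<in> C" "l - xwt D \<nu> \<in> C"
proof -
  have "\<exists>w. count_list w = \<nu>"
  proof -
    have "\<exists>w. count_list w = \<nu>" if "ht \<nu> = n" for n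
      using that
    proof (induction n arbitrary: \<nu>)
      case 0
      then have "\<nu> = (\<lambda>_. 0)" by (auto simp: ht_def)
      then show ?case using count_list_Nil by metis
    next
      case (Suc n)
      then obtain i where "\<nu> i > 0" by (auto simp: ht_def dest!: sum_SucD)
      then have e: "\<nu> = inc i (\<nu>(i := \<nu> i - 1))" by (auto simp: inc_def)
      then have "ht (\<nu>(i := \<nu> i - 1)) = n" using Suc.prems by (metis ht_simps(2) nat.inject)
      then obtain w where "count_list w = \<nu>(i := \<nu> i - 1)" using Suc.IH by blast
      then have "count_list (i # w) = \<nu>" using e by (simp only: count_list_Cons)
      then show ?case by blast
    qed
    then show ?thesis by blast
  qed
  then obtain w where w: "count_list w = \<nu>" by blast
  have "l + xwt D (count_list w) \<in> C \<and> l - xwt D (count_list w) \<in> C"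
  proof (induction w)
    case (Cons i w)
    then show ?case using C_shift(1)[of "l + xwt D (count_list w)" i]
        C_shift(2)[of "l - xwt D (count_list w)" i]
      by (simp add: count_list_Cons xwt_inc algebra_simps del: count_list.simps)
  qed (simp add: count_list_Nil xwt_0 assms)
  then show "l + xwt D \<nu> \<in> C" "l - xwt D \<nu> \<in> C" by (auto simp: w)
qed

text \<open>The powers of \<open>q\<close> and \<open>\<pi>\<close> that remain from the commutation of \<open>\<Omega>\<close> and \<open>F\<^sub>i\<close> are the ratio of the
  values of \<open>\<Xi>\<close> at the weights \<open>\<lambda>\<close> and \<open>\<lambda> - i'\<close>.\<close>
lemma T_F_wt:
  assumes l: "l \<in> C" and m: "m \<in> wt l"
  shows "T (act (F i) m) = act (F i) (T m)"
proof -
  let ?k = "dd D i * pair i l"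
  have k: "cG l = cG (l - xmap D i) + ?k"
    using cf_G[unfolded casimir_function_def, rule_format, OF l, of i] by simp
  have "Omg (act (F i) m) = sc (g ?k) (act (F i) (Omg m))"
    unfolding Omg_F g_eq
    by (simp add: wt_Kp[OF m] act_sc Omg_sc wt_Kp[OF wt_Omg[OF m]] ac_simps)
  then show ?thesis
    by (simp add: T_wt[OF C_shift(2)[OF l] wt_F[OF m]] T_wt[OF l m] act_sc k g_add)
qed

lemma T_E_wt:
  assumes l: "l \<in> C" and m: "m \<in> wt l"
  shows "T (act (E i) m) = act (E i) (T m)"
proof -
  let ?l = "l + xmap D i"
  let ?k = "dd D i * pair i ?l"
  have k: "cG ?l = cG l + ?k"
    using cf_G[unfolded casimir_function_def, rule_format, OF C_shift(1)[OF l, of i], of i] by simp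
  have w: "Omg (act (E i) m) \<in> wt ?l" by (intro wt_Omg wt_E m)
  have "act (E i) (Omg m) = sc (g ?k) (Omg (act (E i) m))"
    unfolding Omg_E g_eq by (simp add: wt_Kp[OF w] act_sc ac_simps)
  then show ?thesis
    by (simp add: T_wt[OF C_shift(1)[OF l] wt_E[OF m]] T_wt[OF l m] act_sc k g_add)
qed

lemma T_act: "T (act u m) = act u (T m)"
proof -
  have gen: "T (act (U_proj Q (var x)) m) = act (U_proj Q (var x)) (T m)" for x m
  proof (rule wt_induct[of "\<lambda>m. T (act (U_proj Q (var x)) m) = act (U_proj Q (var x)) (T m)"])
    fix l v assume v: "l \<in> C" "v \<in> wt l"
    have w: "T v \<in> wt l" unfolding T_wt[OF v] by (intro wt_simps wt_Omg v)
    show "T (act (U_proj Q (var x)) v) = act (U_proj Q (var x)) (T v)"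
      using T_E_wt[OF v] T_F_wt[OF v] wt_K[OF v(2)] wt_K[OF w] by (cases x) (simp_all add: T_sc)
  qed (simp_all add: T_0 T_add)
  obtain x where x: "u = U_proj Q x" using surjE[OF surj_U_proj] by blast
  have "T (act (U_proj Q x) m) = act (U_proj Q x) (T m)"
  proof (induction x rule: free_alg_induct)
    case (monom c w)
    have "T (act (U_proj Q (monom_word w)) m) = act (U_proj Q (monom_word w)) (T m)" for m
      by (induction w) (simp_all add: monom_word_Cons gen)
    then show ?case by (simp add: T_sc)
  qed (simp_all add: T_0 T_add)
  then show ?thesis using x by simp
qed

lemma T_U_hom: "U_hom act act T"
  by (simp add: U_hom_def is_additive_def T_add T_act)

text \<open>Since the weight spaces are graded, every vector has even and odd parts that are sums of homogeneous
  weight vectors, and on these \<open>\<Xi>\<close> acts by scalars.\<close>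
lemma gr_T: "m \<in> gr b \<Longrightarrow> T m \<in> gr b"
proof -
  assume m: "m \<in> gr b"
  let ?P = "\<lambda>m. \<exists>m0\<in>gr False. \<exists>m1\<in>gr True. m = m0 + m1 \<and> T m0 \<in> gr False \<and> T m1 \<in> gr True"
  have "?P m"
  proof (rule wt_induct[of ?P])
    show "?P 0" using gr_add(1) by (intro bexI[of _ 0]) (auto simp: T_0)
  next
    fix x y assume "?P x" "?P y"
    then obtain x0 x1 y0 y1 where "x0 \<in> gr False" "x1 \<in> gr True" "x = x0 + x1"
      "T x0 \<in> gr False" "T x1 \<in> gr True" "y0 \<in> gr False" "y1 \<in> gr True" "y = y0 + y1"
      "T y0 \<in> gr False" "T y1 \<in> gr True" by blast
    then show "?P (x + y)"
      by (intro bexI[of _ "x0 + y0"] bexI[of _ "x1 + y1"]) (auto simp: T_add gr_add)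
  next
    fix l v assume v: "l \<in> C" "v \<in> wt l"
    then obtain v0 v1 where "v0 \<in> wt l \<inter> gr False" "v1 \<in> wt l \<inter> gr True" "v = v0 + v1"
      using cC unfolding category_C_def by blast
    then show "?P v"
      by (intro bexI[of _ v0] bexI[of _ v1]) (auto simp: T_wt[OF v(1)] intro: gr_sc gr_Omg)
  qed
  then obtain m0 m1 where d: "m0 \<in> gr False" "m1 \<in> gr True" "m = m0 + m1" "T m0 \<in> gr False" "T m1 \<in> gr True"
    by blast
  have "m = (if b then m1 else m0)"
    using gr_decompose_unique[OF d(1,2)] m d(3) by simp
  then show ?thesis using d(4,5) by (cases b) auto
qed

text \<open>On a weight vector \<open>T\<close> is triangular: \<open>T m - (\<pi> q\<^sup>2)\<^bsup>G(\<lambda>)\<^esup> m\<close> is built from the vectors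
  \<open>x\<^sup>+ m\<close> with \<open>x\<close> of positive weight, which are closer to being annihilated by all \<open>x\<^sup>+\<close>.\<close>
lemma triangular_induct:
  assumes "P 0" and add: "\<And>x y. P x \<Longrightarrow> P y \<Longrightarrow> P (x + y)" and act: "\<And>u x. P x \<Longrightarrow> P (act u x)"
    and step: "\<And>c m r. T m = sc (g c) m + r \<Longrightarrow> P r \<Longrightarrow> P m"
  shows "P m"
proof -
  have "P v" if "killed n v" "l \<in> C" "v \<in> wt l" for n v l
    using that
  proof (induction n arbitrary: v l)
    case (0 v l)
    show ?case
    proof (rule step)
      have "{\<nu> :: 'i \<Rightarrow> nat. ht \<nu> \<le> 0} = {\<lambda>_. 0}" by (auto simp: ht_def)
      then show "T v = sc (g (cG l)) v + 0"
        by (simp only: T_wt[OF 0(2,3)] Omega_eq[OF 0(1)]) (simp add: Om_0)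
    qed (rule assms(1))
  next
    case (Suc n v l)
    let ?W = "{\<nu> :: 'i \<Rightarrow> nat. ht \<nu> \<le> Suc n}" and ?z = "\<lambda>_ :: 'i. 0 :: nat"
    have z: "?z \<in> ?W" by simp
    have "Omg v = act (Om ?z 1) v + (\<Sum>\<nu>\<in>?W - {?z}. act (Om \<nu> 1) v)"
      unfolding Omega_eq[OF Suc.prems(1)] by (rule sum.remove[OF finite_ht_le z])
    then have "T v = sc (g (cG l)) v + act (U_scal Q (g (cG l))) (\<Sum>\<nu>\<in>?W - {?z}. act (Om \<nu> 1) v)"
      by (simp add: T_wt[OF Suc.prems(2,3)] Om_0)
    then show ?case
    proof (rule step)
      have "P (act (Om \<nu> 1) v)" if \<nu>: "\<nu> \<in> ?W - {?z}" for \<nu>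
        unfolding act_Om
      proof (rule sum_closed[of P, OF assms(1) add])
        fix b assume b: "b \<in> Bw \<nu>"
        then have r: "rep \<nu> (star b) \<in> free_wt \<nu>" using rep(1) star_f_wt by blast
        have pos: "ht \<nu> > 0" using \<nu> by (auto simp: ht_def fun_eq_iff intro: ccontr)
        have "killed n (act (pls (rep \<nu> (star b))) v)"
          unfolding killed_def
        proof (intro allI impI)
          fix \<mu> and x :: "'i free_alg" assume x: "n < ht \<mu>" "x \<in> free_wt \<mu>"
          have "ht (\<lambda>i. \<mu> i + \<nu> i) = ht \<mu> + ht \<nu>" by (simp add: ht_def sum.distrib)
          then have "Suc n < ht (\<lambda>i. \<mu> i + \<nu> i)" using x(1) pos by simp
          then have "act (pls (x * rep \<nu> (star b))) v = 0"
            using Suc.prems(1) free_wt_mult[OF x(2) r] unfolding killed_def by blast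
          then show "act (pls x) (act (pls (rep \<nu> (star b))) v) = 0" by simp
        qed
        then have "P (act (pls (rep \<nu> (star b))) v)"
          using Suc.IH C_shift_xwt(1)[OF Suc.prems(2)] wt_pls[OF r Suc.prems(3)] by blast
        then show "P (act (anti (rep \<nu> b)) (act 1 (act (pls (rep \<nu> (star b))) v)))"
          by (rule act[OF act])
      qed
      then show "P (act (U_scal Q (g (cG l))) (\<Sum>\<nu>\<in>?W - {?z}. act (Om \<nu> 1) v))"
        by (intro act[OF sum_closed[of P, OF assms(1) add]])
    qed
  qed
  then show ?thesis using killed_ex wt_induct[of P m, OF assms(1) add] by blast
qed

subsection \<open>Local finiteness\<close>

sublocale qm: module sc
  by standard (simp_all add: sc_add_left)

lemma stable_span:
  assumes "\<And>a. a \<in> A \<Longrightarrow> T a \<in> qm.span A" "m \<in> qm.span A"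
  shows "T m \<in> qm.span A"
  using assms(2)
proof (induction rule: qm.span_induct_alt)
  case (step c x y)
  then show ?case using assms(1) by (simp add: T_add T_sc qm.span_add qm.span_scale)
qed (simp add: T_0 qm.span_zero)

text \<open>The translate of a \<open>T\<close>-stable submodule by an element of the algebra is again stable because \<open>T\<close>
  commutes with the action, and a vector \<open>m\<close> may be added to a stable submodule that contains
  \<open>T m\<close> up to a multiple of \<open>m\<close>.\<close>
lemma finite_stable: "\<exists>A. finite A \<and> m \<in> qm.span A \<and> (\<forall>a\<in>A. T a \<in> qm.span A)"
proof (rule triangular_induct[of "\<lambda>m. \<exists>A. finite A \<and> m \<in> qm.span A \<and> (\<forall>a\<in>A. T a \<in> qm.span A)"])
  show "\<exists>A. finite A \<and> 0 \<in> qm.span A \<and> (\<forall>a\<in>A. T a \<in> qm.span A)"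
    by (intro exI[of _ "{}"]) (simp add: qm.span_zero)
next
  fix x y
  assume "\<exists>A. finite A \<and> x \<in> qm.span A \<and> (\<forall>a\<in>A. T a \<in> qm.span A)"
    "\<exists>A. finite A \<and> y \<in> qm.span A \<and> (\<forall>a\<in>A. T a \<in> qm.span A)"
  then obtain A A' where A: "finite A" "x \<in> qm.span A" "\<forall>a\<in>A. T a \<in> qm.span A"
    "finite A'" "y \<in> qm.span A'" "\<forall>a\<in>A'. T a \<in> qm.span A'" by blast
  have "qm.span A \<subseteq> qm.span (A \<union> A')" "qm.span A' \<subseteq> qm.span (A \<union> A')"
    by (simp_all add: qm.span_mono)
  then show "\<exists>A. finite A \<and> x + y \<in> qm.span A \<and> (\<forall>a\<in>A. T a \<in> qm.span A)"
    using A by (intro exI[of _ "A \<union> A'"]) (auto intro: qm.span_add)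
next
  fix u x
  assume "\<exists>A. finite A \<and> x \<in> qm.span A \<and> (\<forall>a\<in>A. T a \<in> qm.span A)"
  then obtain A where A: "finite A" "x \<in> qm.span A" "\<forall>a\<in>A. T a \<in> qm.span A" by blast
  have im: "act u y \<in> qm.span (act u ` A)" if "y \<in> qm.span A" for y
    using that
  proof (induction rule: qm.span_induct_alt)
    case (step c a y)
    then show ?case by (simp add: act_sc qm.span_add qm.span_scale qm.span_base)
  qed (simp add: qm.span_zero)
  show "\<exists>A. finite A \<and> act u x \<in> qm.span A \<and> (\<forall>a\<in>A. T a \<in> qm.span A)"
    using A im by (intro exI[of _ "act u ` A"]) (auto simp: T_act)
next
  fix c m r
  assume T: "T m = sc (g c) m + r" and "\<exists>A. finite A \<and> r \<in> qm.span A \<and> (\<forall>a\<in>A. T a \<in> qm.span A)"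
  then obtain A where A: "finite A" "r \<in> qm.span A" "\<forall>a\<in>A. T a \<in> qm.span A" by blast
  have s: "qm.span A \<subseteq> qm.span (insert m A)" by (rule qm.span_mono) auto
  have m: "m \<in> qm.span (insert m A)" by (simp add: qm.span_base)
  then have "T m \<in> qm.span (insert m A)"
    unfolding T using A(2) s by (auto intro: qm.span_add qm.span_scale)
  then show "\<exists>A. finite A \<and> m \<in> qm.span A \<and> (\<forall>a\<in>A. T a \<in> qm.span A)"
    using A s m by (intro exI[of _ "insert m A"]) auto
qed

text \<open>A submodule generated by \<open>A\<close> over the ground ring is generated by \<open>A\<close> and \<open>\<pi> A\<close> over \<open>\<rat>(q)\<close>.\<close>
lemma locally_finite_T: "locally_finite Q act T"
proof -
  interpret mq: module "\<lambda>a. sc (of_Qq a)"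
    by standard (simp_all add: sc_add_left)
  have span: "qm.span A = mq.span (A \<union> sc \<pi> ` A)" for A
  proof
    let ?A = "A \<union> sc \<pi> ` A"
    have pi: "sc \<pi> y \<in> mq.span ?A" if "y \<in> mq.span ?A" for y
      using that
    proof (induction rule: mq.span_induct_alt)
      case (step c x y)
      have "sc \<pi> x \<in> mq.span ?A" using step(1) by (auto intro!: mq.span_base)
      then have "sc (of_Qq c) (sc \<pi> x) + sc \<pi> y \<in> mq.span ?A"
        using step(2) by (intro mq.span_add mq.span_scale)
      then show ?case by (simp add: mult.commute)
    qed (simp add: mq.span_zero)
    have sc: "sc c y \<in> mq.span ?A" if "y \<in> mq.span ?A" for c y
    proof -
      have "sc (of_Qq (coeff_one c)) y + sc (of_Qq (coeff_pi c)) (sc \<pi> y) \<in> mq.span ?A"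
        using that pi by (intro mq.span_add mq.span_scale)
      then show ?thesis
        by (subst qpi_decompose[of c]) (simp add: sc_add_left)
    qed
    show "qm.span A \<subseteq> mq.span ?A"
    proof
      fix y assume "y \<in> qm.span A"
      then show "y \<in> mq.span ?A"
      proof (induction rule: qm.span_induct_alt)
        case (step c x y)
        have "x \<in> mq.span ?A" by (rule mq.span_base) (use step(1) in simp)
        then show ?case using step(2) by (intro mq.span_add sc)
      qed (rule mq.span_zero)
    qed
    show "mq.span ?A \<subseteq> qm.span A"
    proof
      fix y assume "y \<in> mq.span ?A"
      then show "y \<in> qm.span A"
      proof (induction rule: mq.span_induct_alt)
        case (step c x y)
        then have "x \<in> qm.span A" by (auto intro: qm.span_base qm.span_scale)
        then show ?case using step by (intro qm.span_add qm.span_scale)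
      qed (rule qm.span_zero)
    qed
  qed
  show ?thesis unfolding locally_finite_def
  proof
    fix m
    obtain A where A: "finite A" "m \<in> qm.span A" "\<forall>a\<in>A. T a \<in> qm.span A"
      using finite_stable by blast
    then have "T ` qm.span A \<subseteq> qm.span A" using stable_span by blast
    then show "\<exists>A. finite A \<and> m \<in> mq.span A \<and> T ` mq.span A \<subseteq> mq.span A"
      using A unfolding span by (intro exI[of _ "A \<union> sc \<pi> ` A"]) simp
  qed
qed

subsection \<open>Eigenvalues\<close>

definition shifted :: "int \<Rightarrow> 'm \<Rightarrow> 'm" where
  "shifted c m = T m - sc (g c) m"

text \<open>The operator \<open>\<Prod>\<^sub>c (T - (\<pi> q\<^sup>2)\<^sup>c)\<close>.\<close>
fun annihilator :: "int list \<Rightarrow> 'm \<Rightarrow> 'm" where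
  "annihilator [] m = m"
| "annihilator (c # cs) m = annihilator cs (shifted c m)"

lemma shifted_simps:
  "shifted c (m + n) = shifted c m + shifted c n" "shifted c 0 = 0"
  "shifted c (act u m) = act u (shifted c m)" "shifted c (shifted d m) = shifted d (shifted c m)"
  by (simp_all add: shifted_def T_add T_0 T_act act_sc T_diff T_sc algebra_simps)

lemma annihilator_simps:
  "annihilator cs (m + n) = annihilator cs m + annihilator cs n"
  "annihilator cs 0 = 0"
  "annihilator cs (act u m) = act u (annihilator cs m)"
  by (induction cs arbitrary: m n) (simp_all add: shifted_simps)

lemma annihilator_append: "annihilator (cs @ ds) m = annihilator ds (annihilator cs m)"
  by (induction cs arbitrary: m) simp_all

lemma annihilator_sc: "annihilator cs (sc c m) = sc c (annihilator cs m)"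
  using annihilator_simps(3)[of cs "U_scal Q c" m] by simp

lemma annihilator_commute: "annihilator cs (annihilator ds m) = annihilator ds (annihilator cs m)"
proof -
  have "annihilator cs (shifted d m) = shifted d (annihilator cs m)" for d m
    by (induction cs arbitrary: m) (simp_all add: shifted_simps(4)[of _ d])
  then show ?thesis by (induction ds arbitrary: m) simp_all
qed

lemma annihilated: "\<exists>cs. annihilator cs m = 0"
proof (rule triangular_induct[of "\<lambda>m. \<exists>cs. annihilator cs m = 0"])
  fix x y
  assume "\<exists>cs. annihilator cs x = 0" "\<exists>cs. annihilator cs y = 0"
  then obtain cs ds where "annihilator cs x = 0" "annihilator ds y = 0" by blast
  then have "annihilator (cs @ ds) (x + y) = 0"
    by (simp add: annihilator_append annihilator_simps annihilator_commute[of ds cs])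
  then show "\<exists>cs. annihilator cs (x + y) = 0" by blast
next
  fix u x
  assume "\<exists>cs. annihilator cs x = 0"
  then show "\<exists>cs. annihilator cs (act u x) = 0" by (metis annihilator_simps(3) act_simps(3))
next
  fix c m r
  assume "T m = sc (g c) m + r" "\<exists>cs. annihilator cs r = 0"
  then obtain cs where "annihilator (c # cs) m = 0" by (auto simp: shifted_def)
  then show "\<exists>cs. annihilator cs m = 0" by blast
qed (intro exI[of _ "[]"], simp)

lemma annihilator_eigen:
  "T m = sc a m \<Longrightarrow> annihilator cs m = sc (\<Prod>c\<leftarrow>cs. a - g c) m"
proof (induction cs)
  case (Cons c cs)
  have "annihilator (c # cs) m = annihilator cs (sc (a - g c) m)"
    using Cons.prems by (simp add: shifted_def sc_diff_left)
  then show ?case using Cons by (simp add: annihilator_sc)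
qed simp

lemma eigenvalue_at_pi:
  assumes s: "s * s = 1" and m: "sc \<pi> m = sc (of_Qq s) m" "m \<noteq> 0" "T m = sc a m"
  shows "\<exists>c. at_pi s a = at_pi s (g c)"
proof (rule ccontr)
  assume n: "\<not> ?thesis"
  obtain cs where "annihilator cs m = 0" using annihilated by blast
  then have "sc (of_Qq (at_pi s (\<Prod>c\<leftarrow>cs. a - g c))) m = 0"
    by (simp add: annihilator_eigen[OF m(3)] flip: sc_at_pi[OF m(1)])
  moreover have "at_pi s (\<Prod>c\<leftarrow>cs. a - g c) \<noteq> 0"
    by (induction cs) (use n in \<open>auto simp: at_pi_mult[OF s]\<close>)
  ultimately show False using sc_of_Qq_eq_0 m(2) by blast
qed

text \<open>Applied to an eigenvector, an annihilating product of operators \<open>T - (\<pi> q\<^sup>2)\<^sup>c\<close> becomes a product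
  of scalars.  At \<open>\<pi> = 1\<close> and at \<open>\<pi> = -1\<close> scalars lie in a field, so one factor vanishes.  If the
  eigenvector has both components, its eigenvalue from \<open>\<rat>(q)\<close> is a power of \<open>q\<^sup>2\<close> and also a power of
  \<open>- q\<^sup>2\<close>; then the two exponents agree and are even.\<close>
lemma eigenvalue:
  assumes "eigenvector Q act T a m"
  shows "\<exists>c. sc a m = sc (g c) m"
proof -
  have m: "m \<noteq> 0" "T m = sc a m" using assms by (auto simp: eigenvector_def)
  have component: "\<exists>c. sc a m = sc (g c) m" if s: "s * s = 1" "sc \<pi> m = sc (of_Qq s) m" for s
  proof -
    obtain c where "at_pi s a = at_pi s (g c)" using eigenvalue_at_pi[OF s m] by blast
    then show ?thesis by (metis sc_at_pi[OF s(2)])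
  qed
  have plus: ?thesis if "sc \<pi> m = m" using component[of 1] that by simp
  have minus: ?thesis if "sc \<pi> m = - m" using component[of "- 1"] that by simp
  show ?thesis
  proof (cases "sc \<pi> m = m \<or> sc \<pi> m = - m")
    case True
    then show ?thesis using plus minus by blast
  next
    case False
    then obtain a' where a: "a = of_Qq a'" using assms by (auto simp: eigenvector_def)
    have ne: "m - sc \<pi> m \<noteq> 0" "m + sc \<pi> m \<noteq> 0" using False by (auto simp: add_eq_0_iff)
    have "\<exists>c. at_pi 1 a = at_pi 1 (g c)"
    proof (rule eigenvalue_at_pi)
      show "sc \<pi> (m + sc \<pi> m) = sc (of_Qq 1) (m + sc \<pi> m)" by simp
      show "T (m + sc \<pi> m) = sc a (m + sc \<pi> m)"
        using m(2) by (simp add: T_add T_sc mult.commute)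
    qed (use ne in auto)
    then obtain c where c: "a' = qX powi (2 * c)"
      by (auto simp: a g_def at_pi_pi_qq_powi)
    have "\<exists>c. at_pi (- 1) a = at_pi (- 1) (g c)"
    proof (rule eigenvalue_at_pi)
      show "sc \<pi> (m - sc \<pi> m) = sc (of_Qq (- 1)) (m - sc \<pi> m)" by simp
      show "T (m - sc \<pi> m) = sc a (m - sc \<pi> m)"
        using m(2) by (simp add: T_diff T_sc mult.commute)
    qed (use ne in auto)
    then obtain d where d: "a' = (if even d then 1 else - 1) * qX powi (2 * d)"
      by (auto simp: a g_def at_pi_pi_qq_powi)
    have "even d"
      using c d qX_powi_neq_minus[of "2 * c" "2 * d"] by (auto split: if_splits)
    then have "c = d" using c d by simp
    have "g c = qq powi c * qq powi c" using \<open>even d\<close> \<open>c = d\<close> by (simp add: g_eq)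
    also have "\<dots> = a" unfolding a c qq_powi by (simp flip: of_Qq_simps power_int_add)
    finally show ?thesis by blast
  qed
qed

end

lemma (in supergroup_O) casimir_properties:
  assumes "C = root_coset D lam0" "direct_sum_on C wt" "casimir_function D C cG" "is_Xi D Q act C cG Xi"
  shows "U_hom act act (Omg \<circ> Xi)" "m \<in> gr b \<Longrightarrow> (Omg \<circ> Xi) m \<in> gr b"
    "locally_finite Q act (Omg \<circ> Xi)"
    "eigenvector Q act (Omg \<circ> Xi) a v \<Longrightarrow> \<exists>c. sc a v = sc ((\<pi> * qq\<^sup>2) powi c) v"
proof -
  interpret casimir D Q B star act gr C lam0 cG Xi
  proof
    show "P m" if "P 0" "\<And>x y. P x \<Longrightarrow> P y \<Longrightarrow> P (x + y)" "\<And>l x. l \<in> C \<Longrightarrow> x \<in> wt l \<Longrightarrow> P x" for P m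
      by (rule direct_sum_induct[OF assms(2)]) (fact that)+
  qed (fact assms)+
  have T: "Omg \<circ> Xi = T" by (simp add: fun_eq_iff T_def)
  show "U_hom act act (Omg \<circ> Xi)" "m \<in> gr b \<Longrightarrow> (Omg \<circ> Xi) m \<in> gr b"
    "locally_finite Q act (Omg \<circ> Xi)"
    "eigenvector Q act (Omg \<circ> Xi) a v \<Longrightarrow> \<exists>c. sc a v = sc ((\<pi> * qq\<^sup>2) powi c) v"
    unfolding T by (rule T_U_hom gr_T locally_finite_T; assumption?)+
      (use eigenvalue[of a v] in \<open>simp add: g_def\<close>)
qed

subsection \<open>Quotients of Verma modules\<close>

text \<open>The image \<open>v\<close> of \<open>1\<close> generates the module.  All summands of \<open>\<Omega> v\<close> except the one of weight \<open>0\<close>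
  vanish because \<open>v\<close> is annihilated by all \<open>E\<^sub>i\<close>.\<close>
lemma (in supergroup_O) casimir_verma:
  assumes v: "verma D Q lam actV" and hom: "U_hom actV act \<phi>" and "surj \<phi>"
    and G: "casimir_function D (root_coset D lam) cG" and Xi: "is_Xi D Q act (root_coset D lam) cG Xi"
  shows "Omg (Xi m) = sc ((\<pi> * qq\<^sup>2) powi cG lam) m"
proof -
  have \<phi>: "\<phi> (x + y) = \<phi> x + \<phi> y" "\<phi> (actV u y) = act u (\<phi> y)" for x y u
    using hom by (auto simp: U_hom_def is_additive_def)
  have aV: "is_additive (actV u)" "is_additive (\<lambda>u. actV u y)" "actV 1 y = y"
    "actV (u * w) y = actV u (actV w y)" for u w y
    using v by (auto simp: verma_def U_module_def)
  have vV: "actV (U_scal Q c) y = f_scal Q c * y" "actV (F i) y = f_proj Q (var i) * y" "actV (E i) 1 = 0" for c y i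
    using v by (auto simp: verma_def)
  have \<phi>_0: "\<phi> 0 = 0" using \<phi>(1)[of 0 0] by simp
  have wt: "\<phi> y \<in> wt (lam - xwt D \<nu>)" if "y \<in> f_wt Q \<nu>" for y \<nu>
  proof -
    have "actV (K \<mu>) y = actV (U_scal Q (qq powi pairing D \<mu> (lam - xwt D \<nu>))) y"
      "actV (J \<mu>) y = actV (U_scal Q (\<pi> powi pairing D \<mu> (lam - xwt D \<nu>))) y" for \<mu>
      using v that unfolding verma_def by auto
    then have "act (K \<mu>) (\<phi> y) = sc (qq powi pairing D \<mu> (lam - xwt D \<nu>)) (\<phi> y)"
      "act (J \<mu>) (\<phi> y) = sc (\<pi> powi pairing D \<mu> (lam - xwt D \<nu>)) (\<phi> y)" for \<mu>
      by (simp_all only: \<phi>(2)[symmetric]) (simp_all only: \<phi>(2) act_U_scal)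
    then show ?thesis by (simp add: weight_space_def)
  qed
  have coset: "lam - xwt D (count_list w) \<in> root_coset D lam" for w
  proof (induction w)
    case Nil
    have "\<exists>n. lam = lam + (\<Sum>i\<in>UNIV. int_mult (n i) (xmap D i))"
      by (rule exI[of _ "\<lambda>_. 0"]) (simp add: int_mult_def)
    then show ?case unfolding root_coset_def count_list_Nil xwt_0 diff_0_right by blast
  next
    case (Cons i w)
    from root_coset_shift(2)[OF this, of i] show ?case
      by (simp add: count_list_Cons xwt_inc algebra_simps del: count_list.simps)
  qed
  have ind: "P m" if P: "P 0" "\<And>x y. P x \<Longrightarrow> P y \<Longrightarrow> P (x + y)"
      "\<And>l x. l \<in> root_coset D lam \<Longrightarrow> x \<in> wt l \<Longrightarrow> P x" for P m
  proof -
    have "P (\<phi> (f_proj Q x))" for x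
    proof (induction x rule: free_alg_induct)
      case (monom c w)
      have "f_proj Q (scal c * monom_word w) \<in> f_wt Q (count_list w)"
        unfolding f_wt_def by (intro imageI) simp
      then show ?case using P(3)[OF coset wt] by blast
    qed (simp_all add: \<phi> \<phi>_0 P)
    then show ?thesis using \<open>surj \<phi>\<close> surj_f_proj by (metis surj_def)
  qed
  interpret casimir D Q B star act gr "root_coset D lam" lam cG Xi
  proof
    show "P m" if "P 0" "\<And>x y. P x \<Longrightarrow> P y \<Longrightarrow> P (x + y)"
      "\<And>l x. l \<in> root_coset D lam \<Longrightarrow> x \<in> wt l \<Longrightarrow> P x" for P m
      by (rule ind) (fact that)+
  qed (rule refl G Xi)+
  have gen: "actV (mns x) 1 = f_proj Q x" for x
  proof (induction x rule: free_alg_induct)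
    case (monom c w)
    have "actV (mns (monom_word w)) 1 = f_proj Q (monom_word w)"
      by (induction w) (simp_all add: monom_word_Cons aV vV)
    then show ?case by (simp add: aV vV del: us_fold)
  qed (simp_all add: additive_zero[OF aV(2)] additive_add[OF aV(2)])
  let ?v = "\<phi> 1"
  have w: "?v \<in> wt lam"
  proof -
    have "1 \<in> free_wt (\<lambda>_. 0)" using free_wt_simps(5)[of "[]" "\<lambda>_. 0"] by (simp add: count_list_Nil)
    then have "1 \<in> f_wt Q (\<lambda>_. 0)" unfolding f_wt_def by (intro image_eqI[of _ _ 1]) simp_all
    from wt[OF this] show ?thesis by (simp add: xwt_0)
  qed
  have k: "killed 0 ?v" unfolding killed_def
  proof (intro allI impI)
    fix \<nu> and x :: "'i free_alg" assume ht: "0 < ht \<nu>" and x: "x \<in> free_wt \<nu>"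
    from x show "act (pls x) ?v = 0"
    proof (induction rule: free_wt_induct)
      case (monom c w)
      then have "w \<noteq> []" using ht by (auto simp: count_list_Nil)
      then obtain w' i where w: "w = w' @ [i]" by (metis rev_exhaust)
      have "act (E i) ?v = 0" using vV(3) \<phi>_0 by (simp flip: \<phi>(2))
      then show ?case by (simp add: w monom_word_append flip: var_def)
    qed simp_all
  qed
  have "Omg ?v = ?v"
  proof -
    have "{\<nu> :: 'i \<Rightarrow> nat. ht \<nu> \<le> 0} = {\<lambda>_. 0}" by (auto simp: ht_def)
    then show ?thesis using Omega_eq[OF k] by (simp add: Om_0)
  qed
  then have T: "T ?v = sc (g (cG lam)) ?v"
    using T_wt[OF _ w] coset[of "[]"] by (simp add: count_list_Nil xwt_0)
  obtain x where x: "m = \<phi> (f_proj Q x)" using \<open>surj \<phi>\<close> surj_f_proj by (metis surj_def)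
  have "m = act (mns x) ?v" unfolding x gen[symmetric] \<phi> ..
  then have "T m = sc (g (cG lam)) m" by (simp add: T_act T act_sc)
  then show ?thesis by (simp add: T_def g_def)
qed

theorem proposition3p2p3:
  fixes D :: "('i::finite, 'y::ab_group_add, 'x::ab_group_add) root_data"
    and Q :: "('i, 'y, 'f::ring_1, 'u::ring_1) quantum_data"
    and B :: "'f set" and star :: "'f \<Rightarrow> 'f"
    and act :: "'u \<Rightarrow> 'm::ab_group_add \<Rightarrow> 'm" and gr :: "bool \<Rightarrow> 'm set"
  assumes "root_datum D"
    and "quantum_supergroup D Q"
    and "weight_basis Q B" and "dual_basis Q B star"
    and "category_O D Q act gr"
  shows
    "(\<forall>lam0 C G Xi.
       C = root_coset D lam0 \<and> direct_sum_on C (weight_space D Q act) \<and>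
       casimir_function D C G \<and> is_Xi D Q act C G Xi \<longrightarrow>
         U_hom act act (Omega D Q B star act \<circ> Xi) \<and>
         (\<forall>b. \<forall>m\<in>gr b. (Omega D Q B star act \<circ> Xi) m \<in> gr b) \<and>
         locally_finite Q act (Omega D Q B star act \<circ> Xi)) \<and>
     (\<forall>lam' actV \<phi> G Xi.
       verma D Q lam' actV \<and> U_hom actV act \<phi> \<and> surj \<phi> \<and>
       casimir_function D (root_coset D lam') G \<and> is_Xi D Q act (root_coset D lam') G Xi \<longrightarrow>
         (\<forall>m. (Omega D Q B star act \<circ> Xi) m = scale Q act ((\<pi> * qq\<^sup>2) powi G lam') m)) \<and>
     (\<forall>lam0 C G Xi.
       C = root_coset D lam0 \<and> direct_sum_on C (weight_space D Q act) \<and>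
       casimir_function D C G \<and> is_Xi D Q act C G Xi \<longrightarrow>
         (\<forall>a m. eigenvector Q act (Omega D Q B star act \<circ> Xi) a m \<longrightarrow>
            (\<exists>c::int. scale Q act a m = scale Q act ((\<pi> * qq\<^sup>2) powi c) m)))"
proof -
  have um: "U_module act" using assms(5) by (simp add: category_O_def category_C_def)
  interpret supergroup_O D Q B star act gr
    by unfold_locales (fact assms um)+
  show ?thesis
  proof (intro conjI allI impI ballI; (elim conjE)?)
    fix lam0 C G Xi
    assume a: "C = root_coset D lam0" "direct_sum_on C (weight_space D Q act)"
      "casimir_function D C G" "is_Xi D Q act C G Xi"
    show "U_hom act act (Omega D Q B star act \<circ> Xi)" by (rule casimir_properties(1)[OF a])
    show "(Omega D Q B star act \<circ> Xi) m \<in> gr b" if "m \<in> gr b" for b m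
      by (rule casimir_properties(2)[OF a that])
    show "locally_finite Q act (Omega D Q B star act \<circ> Xi)" by (rule casimir_properties(3)[OF a])
    show "\<exists>c. scale Q act e m = scale Q act ((\<pi> * qq\<^sup>2) powi c) m"
      if "eigenvector Q act (Omega D Q B star act \<circ> Xi) e m" for e m
      by (rule casimir_properties(4)[OF a that])
  next
    fix lam' actV \<phi> G Xi m
    assume "verma D Q lam' actV" "U_hom actV act \<phi>" "surj \<phi>"
      "casimir_function D (root_coset D lam') G" "is_Xi D Q act (root_coset D lam') G Xi"
    from casimir_verma[OF this]
    show "(Omega D Q B star act \<circ> Xi) m = scale Q act ((\<pi> * qq\<^sup>2) powi G lam') m" by simp
  qed
qed

end
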